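(* Let $N\ge 1$ and let $F_j$ and $G_j$ be polynomials in $z$ and $\bar z$ for $j=1,\ldots,N$. Then there exists $H\in L^1(\mathbb{D},dA)$ such that $\sum_{j=1}^{N}T_{F_j}T_{G_j}-T_{H}$ is of finite rank if and only if $\sum_{j=1}^{N}F_j\diamond G_j\in L^1(\mathbb{D},dA)$.
   Context: $\mathbb{D}$ is the open unit disk in $\mathbb{C}$, $dA$ is normalized Lebesgue area measure on $\mathbb{D}$, and $A^2$ is the Bergman space of holomorphic functions on $\mathbb{D}$ that are square integrable with respect to $dA$. Toeplitz operators. For $f\in L^1(\mathbb{D},dA)$, the Toeplitz operator $T_f$ is defined (at least) on holomorphic polynomials $h$ by $T_f(h)(z)=\int_{\mathbb{D}}\frac{f(w)h(w)}{(1-\bar w z)^2}\,dA(w)$, $z\in\mathbb{D}$. Toeplitz operators whose symbols are finite sums of integrable functions of the form $\phi(r)e^{im\theta}$ ($m\in\mathbb{Z}$) map holomorphic polynomials to holomorphic polynomials, so products of two such operators are defined on holomorphic polynomials. A finite sum of products of such (possibly unbounded) operators, whose domain contains the holomorphic polynomials, is said to have finite rank if the image of the space of holomorphic polynomials is finite dimensional. Mellin transform. For a measurable function $\varphi$ on $(0,1)$, $\widehat{\varphi}(\zeta)=\int_0^1\varphi(r)r^{\zeta-1}\,dr$ for all $\zeta\in\mathbb{C}$ for which the integral exists. Nearly integrable functions. A measurable function $\varphi$ on $(0,1)$ is nearly integrable if $\varphi\in L^1((0,1),r^{\alpha}dr)$ for some $\alpha>0$; a measurable function $f$ on $\mathbb{D}$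 is nearly integrable if $f\in L^1(\mathbb{D},|z|^{\alpha}dA)$ for some $\alpha>0$. A function on $\mathbb{D}$ is quasihomogeneous of degree $m\in\mathbb{Z}$ if it equals $\phi(r)e^{im\theta}$ (with $z=re^{i\theta}$) almost everywhere for some function $\phi$. Convolution $\diamond$. (a) Let $f_m(re^{i\theta})=\phi(r)e^{im\theta}$ and $g_n(re^{i\theta})=\psi(r)e^{in\theta}$ be nearly integrable. If there is a nearly integrable function $\omega$ on $(0,1)$ with $\widehat{\omega}(\zeta)=(\zeta-m+n)\,\widehat{\phi}(\zeta+n)\,\widehat{\psi}(\zeta-m)$ on some right half-plane in $\mathbb{C}$, then $f_m\diamond g_n$ is defined as $(f_m\diamond g_n)(re^{i\theta})=\omega(r)e^{i(m+n)\theta}$. (b) If $f=\sum_m f_m$ and $g=\sum_n g_n$ are finite sums of nearly integrable quasihomogeneous functions ($f_m$ of degree $m$, $g_n$ of degree $n$) and $f_m\diamond g_n$ exists for every pair $(m,n)$, then $f\diamond g=\sum_{m,n}f_m\diamond g_n$. For polynomials $F,G$ in $z$ and $\bar z$, the convolution $F\diamond G$ always exists. *)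

theory Defs
  imports
    "HOL-Analysis.Analysis"
    "HOL-Computational_Algebra.Polynomial"
    "HOL-Library.Function_Algebras"
begin

abbreviation unit_disk :: "complex set"
  where "unit_disk \<equiv> ball 0 1"

definition area_measure :: "complex measure"
  where "area_measure = density (lebesgue_on unit_disk) (\<lambda>_. ennreal (1 / pi))"

definition z_zbar_polynomial :: "(complex \<Rightarrow> complex) \<Rightarrow> bool"
  where "z_zbar_polynomial F \<longleftrightarrow>
    (\<exists>(d::nat) (c :: nat \<Rightarrow> nat \<Rightarrow> complex). \<forall>z. F z = (\<Sum>k\<le>d. \<Sum>l\<le>d. c k l * z ^ k * cnj z ^ l))"

text \<open>Functions on the disk are represented by functions on \<open>complex\<close>. The value of a Toeplitz
  operator is set to 0 outside the disk, so that linear relations between such functions are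
  relations on the disk only.\<close>

definition toeplitz :: "(complex \<Rightarrow> complex) \<Rightarrow> (complex \<Rightarrow> complex) \<Rightarrow> complex \<Rightarrow> complex"
  where "toeplitz f h z =
    (if z \<in> unit_disk then (LINT w|area_measure. f w * h w / (1 - cnj w * z)\<^sup>2) else 0)"

interpretation cfun: vector_space "\<lambda>(c::complex) (f::complex \<Rightarrow> complex) z. c * f z"
  by unfold_locales (auto simp: fun_eq_iff algebra_simps)

definition finite_rank :: "((complex \<Rightarrow> complex) \<Rightarrow> complex \<Rightarrow> complex) \<Rightarrow> bool"
  where "finite_rank S \<longleftrightarrow> (\<exists>B. finite B \<and> S ` range poly \<subseteq> cfun.span B)"

definition mellin :: "(real \<Rightarrow> complex) \<Rightarrow> complex \<Rightarrow> complex"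
  where "mellin \<phi> \<zeta> = (LINT r|lebesgue_on {0<..<1}. \<phi> r * complex_of_real r powr (\<zeta> - 1))"

definition nearly_integrable_interval :: "(real \<Rightarrow> complex) \<Rightarrow> bool"
  where "nearly_integrable_interval \<phi> \<longleftrightarrow>
    (\<exists>\<alpha>>0. integrable (lebesgue_on {0<..<1}) (\<lambda>r. complex_of_real (r powr \<alpha>) * \<phi> r))"

definition nearly_integrable_disk :: "(complex \<Rightarrow> complex) \<Rightarrow> bool"
  where "nearly_integrable_disk f \<longleftrightarrow>
    (\<exists>\<alpha>>0. integrable area_measure (\<lambda>z. complex_of_real (cmod z powr \<alpha>) * f z))"

definition quasihom :: "int \<Rightarrow> (real \<Rightarrow> complex) \<Rightarrow> complex \<Rightarrow> complex"
  where "quasihom m \<phi> z = \<phi> (cmod z) * cis (of_int m * Arg z)"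

text \<open>\<open>quasihom_conv m \<phi> n \<psi> \<omega>\<close>: the convolution of \<open>\<phi>(r) e\<^sup>i\<^sup>m\<^sup>\<theta>\<close> and \<open>\<psi>(r) e\<^sup>i\<^sup>n\<^sup>\<theta>\<close> exists and is
  \<open>\<omega>(r) e\<^sup>i\<^sup>(\<^sup>m\<^sup>+\<^sup>n\<^sup>)\<^sup>\<theta>\<close>. By near integrability all three Mellin integrals converge absolutely
  once \<open>Re \<zeta>\<close> is large; since \<open>a\<close> may be enlarged, the default value 0 of a divergent integral
  plays no role.\<close>

definition quasihom_conv ::
    "int \<Rightarrow> (real \<Rightarrow> complex) \<Rightarrow> int \<Rightarrow> (real \<Rightarrow> complex) \<Rightarrow> (real \<Rightarrow> complex) \<Rightarrow> bool"
  where "quasihom_conv m \<phi> n \<psi> \<omega> \<longleftrightarrow>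
    nearly_integrable_disk (quasihom m \<phi>) \<and> nearly_integrable_disk (quasihom n \<psi>) \<and>
    nearly_integrable_interval \<omega> \<and>
    (\<exists>a::real. \<forall>\<zeta>. Re \<zeta> > a \<longrightarrow>
       mellin \<omega> \<zeta> = (\<zeta> - of_int m + of_int n) * mellin \<phi> (\<zeta> + of_int n) * mellin \<psi> (\<zeta> - of_int m))"

text \<open>\<open>is_diamond f g k\<close>: the convolution of \<open>f\<close> and \<open>g\<close> exists and is represented by \<open>k\<close>, where
  \<open>M\<close> and \<open>N\<close> are the finite sets of degrees occurring in the decompositions of \<open>f\<close> and \<open>g\<close>.\<close>

definition is_diamond ::
    "(complex \<Rightarrow> complex) \<Rightarrow> (complex \<Rightarrow> complex) \<Rightarrow> (complex \<Rightarrow> complex) \<Rightarrow> bool"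
  where "is_diamond f g k \<longleftrightarrow>
    (\<exists>M N \<phi> \<psi> \<omega>. finite M \<and> finite N \<and>
       (AE z in area_measure. f z = (\<Sum>m\<in>M. quasihom m (\<phi> m) z)) \<and>
       (AE z in area_measure. g z = (\<Sum>n\<in>N. quasihom n (\<psi> n) z)) \<and>
       (\<forall>m\<in>M. nearly_integrable_disk (quasihom m (\<phi> m))) \<and>
       (\<forall>n\<in>N. nearly_integrable_disk (quasihom n (\<psi> n))) \<and>
       (\<forall>m\<in>M. \<forall>n\<in>N. quasihom_conv m (\<phi> m) n (\<psi> n) (\<omega> m n)) \<and>
       (AE z in area_measure. k z = (\<Sum>m\<in>M. \<Sum>n\<in>N. quasihom (m + n) (\<omega> m n) z)))"

text \<open>Both the homogeneous decomposition and the inverse Mellin transform are unique up to null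
  sets, so \<open>is_diamond f g\<close> determines its third argument almost everywhere. The choice below
  picks a representative; it is meaningful only when the convolution exists, as it does for
  polynomials in \<open>z\<close> and its conjugate.\<close>

definition diamond :: "(complex \<Rightarrow> complex) \<Rightarrow> (complex \<Rightarrow> complex) \<Rightarrow> complex \<Rightarrow> complex"
  (infixl "\<diamondop>" 70)
  where "f \<diamondop> g = (SOME k. is_diamond f g k)"

end

theory Submission
  imports Defs "HOL-Complex_Analysis.Complex_Analysis" "Jordan_Normal_Form.Determinant"
begin

text \<open>Write \<open>D\<close> for the sum of the convolutions \<open>F\<^sub>j \<diamondop> G\<^sub>j\<close>, and write the moments of a function as
  \<open>f\<^sub>p\<^sub>q = \<integral> f w\<^sup>p (cnj w)\<^sup>q dA\<close>. Everything is read off from moments, because expanding the Bergman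
  kernel gives \<open>T\<^sub>f w\<^sup>p = \<Sum>\<^sub>q (q + 1) f\<^sub>p\<^sub>q z\<^sup>q\<close> (\<open>toeplitz_monomial_sums\<close>).

  In polar coordinates a quasihomogeneous function of degree \<open>m\<close> has \<open>f\<^sub>p\<^sub>q = 0\<close> unless \<open>p + m = q\<close>,
  and then \<open>f\<^sub>p\<^sub>q\<close> is twice the Mellin transform of its radial part at \<open>p + q + 2\<close>
  (\<open>moment_quasihom\<close>). The identity that defines the convolution therefore says exactly that
  \<open>(F \<diamondop> G)\<^sub>p\<^sub>q = \<Sum>\<^sub>l (l + 1) G\<^sub>p\<^sub>l F\<^sub>l\<^sub>q\<close> for large \<open>p\<close> and all \<open>q\<close> (\<open>is_diamond_moments\<close>), which is the
  formula for the matrix entries of \<open>T\<^sub>F T\<^sub>G\<close>. Hence \<open>\<Sum>\<^sub>j T\<^bsub>F\<^sub>j\<^esub> T\<^bsub>G\<^sub>j\<^esub> - T\<^sub>H\<close> maps \<open>w\<^sup>p\<close> to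
  \<open>\<Sum>\<^sub>q (q + 1) (D\<^sub>p\<^sub>q - H\<^sub>p\<^sub>q) z\<^sup>q\<close> for all large \<open>p\<close>. If \<open>D\<close> is integrable, then \<open>H = D\<close> makes this vanish for
  all but finitely many \<open>p\<close>, and the rank is finite. Only existence of the convolution has to be
  checked for this (\<open>is_diamond_exists\<close>, by partial fractions), since every representative has these moments.

  Conversely, let the rank be finite for some integrable \<open>H\<close>. For large \<open>m\<close> the function
  \<open>u = |z|\<^sup>2\<^sup>m (D - H)\<close> is integrable, and its moment matrix has finite rank. Such a matrix is zero
  (\<open>finite_rank_moments_zero\<close>, a version of Luecking's theorem on finite rank Toeplitz operators for
  absolutely continuous measures), so \<open>u = 0\<close> almost everywhere by the Stone--Weierstrass theorem
  (\<open>zero_moments_AE_zero\<close>), and \<open>D\<close> agrees with the integrable function \<open>H\<close>.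

  The moment matrix is treated as follows. If its rank is \<open>r\<close>, choose an invertible \<open>r \<times> r\<close> submatrix
  \<open>A\<close> with rows \<open>I\<close> and columns \<open>J\<close>. Every other \<open>r \<times> r\<close> submatrix factors through \<open>A\<inverse>\<close>, and by
  linearity so does the matrix \<open>M\<^sub>s\<close> with the entries
  \<open>\<integral> u w\<^sup>i e\<^sup>s\<^sup>w cnj (w\<^sup>j e\<^sup>-\<^sup>s\<^sup>w) dA\<close> for \<open>i \<in> I\<close> and \<open>j \<in> J\<close>. Thus \<open>det M\<^sub>s det A = f(s) cnj (g(s))\<close> with entire
  functions \<open>f\<close> and \<open>g\<close>. The kernel \<open>e\<^sup>s\<^sup>w cnj (e\<^sup>-\<^sup>s\<^sup>w)\<close> is unimodular, so \<open>f g\<close> is bounded, hence constant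
  by Liouville's theorem, and \<open>|det M\<^sub>s| = |det A|\<close> for every \<open>s\<close>. But the entries of \<open>M\<^sub>s\<close> are
  Fourier coefficients of integrable functions, and for \<open>s = n\<close> they are all small for suitable \<open>n\<close>
  (\<open>osc_simultaneously_small\<close>). This forces \<open>r = 0\<close>.\<close>

section \<open>Lebesgue measure and rotations of the plane\<close>

text \<open>Lebesgue measure is a completion, and the functions of interest are merely Lebesgue measurable;
  this passes from a measure-preserving Borel map to the completed measures.\<close>

lemma measurable_distr_completion:
  assumes T: "T \<in> M \<rightarrow>\<^sub>M N" and d: "distr M N T = N"
  shows "T \<in> completion M \<rightarrow>\<^sub>M completion N" "distr (completion M) (completion N) T = completion N"
proof -
  have T': "T \<in> completion M \<rightarrow>\<^sub>M N" by (rule measurable_completion[OF T])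
  have "distr (completion M) N T = distr M N T"
    by (rule measure_eqI) (use T T' in \<open>auto simp: emeasure_distr measurable_sets\<close>)
  then have d': "distr (completion M) N T = N" using d by simp
  show "T \<in> completion M \<rightarrow>\<^sub>M completion N"
    by (rule completion.measurable_completion2[OF T']) (simp add: d')
  show "distr (completion M) (completion N) T = completion N"
    using completion.completion_distr_eq[OF T'] by (simp add: d')
qed

text \<open>Volumes of orthogonal images are computed in \<open>real^'n\<close>, so the plane is identified with
  \<open>real^2\<close>.\<close>

lemma orthogonal_distr_lborel:
  fixes f :: "real^'n::{finite,wellorder} \<Rightarrow> real^'n::_"
  assumes f: "orthogonal_transformation f"
  shows "distr lborel borel f = lborel"
proof (rule sym, rule lborel_eqI)
  obtain g where g: "orthogonal_transformation g" "\<And>x. g (f x) = x" "\<And>x. f (g x) = x"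
    using orthogonal_transformation_inv[OF f] orthogonal_transformation_bij[OF f]
    by (metis bij_is_surj orthogonal_transformation_inj f inv_f_f surj_f_inv_f)
  have [measurable]: "f \<in> borel_measurable borel"
    using f by (intro borel_measurable_continuous_onI linear_continuous_on)
      (simp add: linear_conv_bounded_linear[symmetric] orthogonal_transformation_linear)
  fix l u :: "real^'n::_" assume lu: "\<And>b. b \<in> Basis \<Longrightarrow> l \<bullet> b \<le> u \<bullet> b"
  have im: "f -` box l u = g ` box l u" using g by (auto simp: image_iff) metis
  have "g ` box l u \<in> lmeasurable" by (rule measurable_orthogonal_image[OF g(1)]) simp
  then have "emeasure lebesgue (g ` box l u) = ennreal (measure lebesgue (g ` box l u))"
    by (simp add: emeasure_eq_measure2 fmeasurableD2)
  also have "\<dots> = ennreal (measure lebesgue (box l u))"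
    by (subst measure_orthogonal_image[OF g(1)]) auto
  also have "ennreal (measure lebesgue (box l u)) = (\<Prod>b\<in>Basis. (u - l) \<bullet> b)"
    using lu by (simp add: emeasure_eq_measure2[symmetric] main_part)
  finally have *: "emeasure lebesgue (g ` box l u) = (\<Prod>b\<in>Basis. (u - l) \<bullet> b)" .
  have "f -` box l u \<in> sets borel" using measurable_sets[of f borel borel "box l u"] by simp
  then have "emeasure lborel (f -` box l u) = emeasure lebesgue (f -` box l u)"
    by (simp add: main_part)
  then show "emeasure (distr lborel borel f) (box l u) = (\<Prod>b\<in>Basis. (u - l) \<bullet> b)"
    using * im by (simp add: emeasure_distr)
qed simp

lemma distr_lborel_real2_complex:
  "distr lborel borel (\<lambda>v::real^2. Complex (v$1) (v$2)) = lborel" (is "distr _ _ ?T = _")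
proof (rule sym, rule lborel_eqI)
  have [measurable]: "?T \<in> borel_measurable borel"
    by (rule borel_measurable_continuous_onI) (auto simp: Complex_eq intro!: continuous_intros)
  fix l u :: complex assume lu: "\<And>b. b \<in> Basis \<Longrightarrow> l \<bullet> b \<le> u \<bullet> b"
  let ?l = "vector [Re l, Im l] :: real^2" and ?u = "vector [Re u, Im u] :: real^2"
  have ri: "Re l \<le> Re u" "Im l \<le> Im u" using lu[of 1] lu[of \<i>] by (auto simp: Basis_complex_def)
  have pre: "?T -` box l u = box ?l ?u"
    by (auto simp: in_box_complex_iff box_vec_eq_empty mem_box_cart forall_2)
  have basis: "(Basis :: (real^2) set) = {axis 1 1, axis 2 1}"
    by (auto simp: Basis_vec_def UNIV_2)
  have "emeasure lborel (box ?l ?u) = (\<Prod>b\<in>Basis. (?u - ?l) \<bullet> b)"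
    using ri by (intro emeasure_lborel_box) (auto simp: basis inner_axis)
  also have "(\<Prod>b\<in>Basis. (?u - ?l) \<bullet> b) = (Re u - Re l) * (Im u - Im l)"
    by (simp add: basis axis_eq_axis inner_axis)
  also have "\<dots> = (\<Prod>b\<in>Basis. (u - l) \<bullet> b)"
    by (simp add: Basis_complex_def)
  finally show "emeasure (distr lborel borel ?T) (box l u) = (\<Prod>b\<in>Basis. (u - l) \<bullet> b)"
    using pre by (simp add: emeasure_distr)
qed simp

lemma distr_lebesgue_rotation:
  fixes c :: complex
  assumes c: "cmod c = 1"
  shows "(\<lambda>z. c * z) \<in> lebesgue \<rightarrow>\<^sub>M lebesgue" "distr lebesgue lebesgue (\<lambda>z. c * z) = lebesgue"
proof -
  let ?T = "\<lambda>v::real^2. Complex (v$1) (v$2)"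
  let ?O = "\<lambda>v::real^2. (vector [Re c * v$1 - Im c * v$2, Re c * v$2 + Im c * v$1] :: real^2)"
  have cc: "(Re c)^2 + (Im c)^2 = 1" using c by (simp add: cmod_def)
  have lin: "linear ?O"
    by (rule linearI) (auto simp: Finite_Cartesian_Product.vec_eq_iff forall_2 algebra_simps)
  have orth: "orthogonal_transformation ?O" unfolding orthogonal_transformation
  proof (intro conjI allI lin)
    fix v :: "real^2"
    have "(Re c * v$1 - Im c * v$2)^2 + (Re c * v$2 + Im c * v$1)^2 = ((Re c)^2 + (Im c)^2) * ((v$1)^2 + (v$2)^2)"
      by (simp add: power2_eq_square algebra_simps)
    then show "norm (?O v) = norm v" using cc
      by (simp add: norm_vec_def L2_set_def sum_2)
  qed
  have [measurable]: "?T \<in> borel_measurable borel"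
    by (rule borel_measurable_continuous_onI) (auto simp: Complex_eq intro!: continuous_intros)
  have [measurable]: "?O \<in> borel_measurable borel"
    using lin by (intro borel_measurable_continuous_onI linear_continuous_on)
      (simp add: linear_conv_bounded_linear[symmetric])
  have [measurable]: "(\<lambda>z. c * z) \<in> borel_measurable borel" by measurable
  have "distr lborel borel (\<lambda>z. c * z) = distr (distr lborel borel ?T) borel (\<lambda>z. c * z)"
    by (simp add: distr_lborel_real2_complex)
  also have "\<dots> = distr lborel borel ((\<lambda>z. c * z) \<circ> ?T)" by (rule distr_distr) auto
  also have "(\<lambda>z. c * z) \<circ> ?T = ?T \<circ> ?O" by (auto simp: complex_eq_iff)
  also have "distr lborel borel (?T \<circ> ?O) = distr (distr lborel borel ?O) borel ?T"
    by (rule distr_distr[symmetric]) auto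
  also have "\<dots> = lborel" using orthogonal_distr_lborel[OF orth] distr_lborel_real2_complex by simp
  finally have "distr lborel borel (\<lambda>z. c * z) = lborel" .
  then have d: "distr lborel lborel (\<lambda>z. c * z) = lborel"
    by (metis distr_cong sets_lborel)
  show "(\<lambda>z. c * z) \<in> lebesgue \<rightarrow>\<^sub>M lebesgue" "distr lebesgue lebesgue (\<lambda>z. c * z) = lebesgue"
    by (rule measurable_distr_completion[OF _ d]; simp)+
qed

section \<open>The radial distribution of area measure\<close>

abbreviation area_borel :: "(complex \<Rightarrow> 'b :: topological_space) set"
  where "area_borel \<equiv> borel_measurable area_measure"

abbreviation unit_borel :: "(real \<Rightarrow> 'b :: topological_space) set"
  where "unit_borel \<equiv> borel_measurable (lebesgue_on {0<..<1})"

lemma space_area [simp]: "space area_measure = unit_disk"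
  by (simp add: area_measure_def)

lemma sets_area: "sets area_measure = sets (lebesgue_on unit_disk)"
  by (simp add: area_measure_def)

lemma finite_measure_area: "finite_measure area_measure"
proof
  have "emeasure area_measure (space area_measure) = ennreal (1/pi) * emeasure (lebesgue_on unit_disk) unit_disk"
    unfolding area_measure_def by (subst emeasure_density) (auto simp: nn_integral_cmult_indicator)
  also have "emeasure (lebesgue_on unit_disk) unit_disk = emeasure lborel unit_disk"
    by (simp add: emeasure_restrict_space main_part)
  finally show "emeasure area_measure (space area_measure) \<noteq> \<infinity>"
    using emeasure_lborel_ball_finite[of "0::complex" 1] by (auto simp: ennreal_mult_eq_top_iff)
qed

interpretation area: finite_measure area_measure by (rule finite_measure_area)

lemma AE_area_iff: "(AE z in area_measure. P z) \<longleftrightarrow> (AE z in lebesgue_on unit_disk. P z)"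
  unfolding area_measure_def by (subst AE_density) auto

lemma AE_area_of_lebesgue:
  assumes "AE z in lebesgue. P z"
  shows "AE z in area_measure. P z"
proof -
  have "AE z in lebesgue. z \<in> unit_disk \<longrightarrow> P z" using assms by eventually_elim auto
  then show ?thesis unfolding AE_area_iff by (subst AE_restrict_space_iff) auto
qed

lemma borel_measurable_area: "area_borel = borel_measurable (lebesgue_on unit_disk)"
  by (rule measurable_cong_sets) (auto simp: sets_area)

lemma continuous_measurable_area: "continuous_on UNIV f \<Longrightarrow> f \<in> area_borel"
  by (simp add: borel_measurable_area continuous_imp_measurable_on_sets_lebesgue continuous_on_subset)

lemma emeasure_area:
  "A \<in> sets lebesgue \<Longrightarrow> A \<subseteq> unit_disk \<Longrightarrow> emeasure area_measure A = ennreal (1/pi) * emeasure lebesgue A"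
  unfolding area_measure_def
  by (subst emeasure_density) (auto simp: sets_restrict_space_iff nn_integral_cmult_indicator emeasure_restrict_space)

lemma cmod_measurable_area_borel [measurable]: "cmod \<in> area_borel"
  by (rule continuous_measurable_area) (intro continuous_intros)

text \<open>The distribution of \<open>cmod\<close> under normalized area, with density \<open>2 r\<close> on the unit interval.\<close>

definition radial_measure :: "real measure" where
  "radial_measure = density lborel (\<lambda>r. ennreal (2 * r) * indicator {0<..<1} r)"

text \<open>Both measures are finite and agree on rays, because a disk of radius \<open>r\<close> has normalized area
  \<open>r\<^sup>2\<close>.\<close>

lemma distr_cmod_borel: "distr area_measure borel cmod = radial_measure"
proof (rule measure_eqI_lessThan)
  show "sets (distr area_measure borel cmod) = sets borel" "sets radial_measure = sets borel"
    by (simp_all add: radial_measure_def)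
  fix x :: real
  have pre: "cmod -` {x<..} \<inter> unit_disk = unit_disk - cball 0 x" by auto
  have e1: "emeasure (distr area_measure borel cmod) {x<..} = emeasure area_measure (unit_disk - cball 0 x)"
    by (subst emeasure_distr[OF cmod_measurable_area_borel]) (simp_all add: pre)
  show "emeasure (distr area_measure borel cmod) {x<..} < \<infinity>"
    unfolding e1 infinity_ennreal_def less_top[symmetric] by (rule area.emeasure_finite)
  have e2: "emeasure radial_measure {x<..} = (\<integral>\<^sup>+r. ennreal (2*r) * indicator {max 0 x..1} r \<partial>lborel)"
    unfolding radial_measure_def
    by (subst emeasure_density, simp, simp, rule nn_integral_cong_AE)
       (use AE_lborel_singleton[of "max 0 x"] AE_lborel_singleton[of 1] in eventually_elim, auto simp: indicator_def)
  let ?y = "min 1 (max 0 x)"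
  have e3: "(\<integral>\<^sup>+r. ennreal (2*r) * indicator {max 0 x..1} r \<partial>lborel) = ennreal (1 - ?y^2)"
  proof (cases "x \<le> 1")
    case True
    have "(\<integral>\<^sup>+r. ennreal (2*r) * indicator {max 0 x..1} r \<partial>lborel) = ennreal (1^2 - (max 0 x)^2)"
      by (rule nn_integral_FTC_Icc) (use True in \<open>auto intro!: derivative_eq_intros\<close>)
    moreover have "?y = max 0 x" using True by auto
    ultimately show ?thesis by simp
  next
    case False
    then have "{max 0 x..1} = {}" by auto
    then show ?thesis using False by (simp add: min_def)
  qed
  have e4: "emeasure area_measure (unit_disk - cball 0 x) = ennreal (1 - ?y^2)"
  proof -
    have disk: "measure lborel (unit_disk :: complex set) = pi"
      by (simp add: content_ball unit_ball_vol_2)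
    have "emeasure lborel (unit_disk - cball (0::complex) x) \<le> emeasure lborel (unit_disk :: complex set)"
      by (rule emeasure_mono) auto
    also have "\<dots> < \<infinity>" using emeasure_lborel_ball_finite[of "0::complex" 1] by simp
    finally have fin: "emeasure lborel (unit_disk - cball (0::complex) x) \<noteq> \<infinity>" by simp
    have eq: "unit_disk - (unit_disk \<inter> cball (0::complex) x) = unit_disk - cball 0 x" by auto
    have "emeasure lebesgue (unit_disk - cball 0 x) = ennreal (measure lborel (unit_disk - cball 0 x))"
      using fin by (simp add: main_part emeasure_eq_ennreal_measure)
    also have "unit_disk - cball 0 x = unit_disk - (unit_disk \<inter> cball (0::complex) x)" by auto
    also have "measure lborel \<dots> = measure lborel unit_disk - measure lborel (unit_disk \<inter> cball (0::complex) x)"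
      using emeasure_lborel_ball_finite[of "0::complex" 1] by (intro measure_Diff)  auto
    also have "measure lborel (unit_disk \<inter> cball (0::complex) x) = pi * ?y^2"
    proof (cases "x < 0")
      case True then show ?thesis by (simp add: max_def)
    next
      case False
      show ?thesis
      proof (cases "x < 1")
        case True
        then have "unit_disk \<inter> cball (0::complex) x = cball 0 x" by auto
        then show ?thesis using True False by (simp add: content_cball unit_ball_vol_2)
      next
        case F: False
        then have "unit_disk \<inter> cball (0::complex) x = unit_disk" by auto
        then show ?thesis using F by (simp add: content_ball unit_ball_vol_2)
      qed
    qed
    finally have "emeasure lebesgue (unit_disk - cball 0 x) = ennreal (pi - pi * ?y^2)"
      unfolding disk eq .
    then have "emeasure area_measure (unit_disk - cball 0 x) = ennreal (1/pi) * ennreal (pi - pi * ?y^2)"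
      by (subst emeasure_area) auto
    also have "\<dots> = ennreal ((1/pi) * (pi - pi * ?y^2))"
      by (rule ennreal_mult'[symmetric]) simp
    also have "(1/pi) * (pi - pi * ?y^2) = 1 - ?y^2" by (simp add: field_simps)
    finally show ?thesis .
  qed
  show "emeasure (distr area_measure borel cmod) {x<..} = emeasure radial_measure {x<..}"
    unfolding e1 e2 e3 e4 ..
qed

lemma null_sets_radial: "N \<in> null_sets lborel \<Longrightarrow> N \<in> null_sets radial_measure"
  unfolding radial_measure_def using null_sets_density_iff[of "\<lambda>r. ennreal (2 * r) * indicator {0<..<1} r" lborel N]
  by (auto dest: AE_not_in)

lemma null_sets_cmod_vimage:
  assumes "N \<in> null_sets lebesgue"
  shows "cmod -` N \<inter> unit_disk \<in> null_sets lebesgue"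
proof -
  obtain B where B: "B \<in> null_sets lborel" "N \<subseteq> B" using assms by (auto simp: null_sets_completion_iff2)
  have [measurable]: "B \<in> sets borel" using B(1) by auto
  have "emeasure area_measure (cmod -` B \<inter> unit_disk) = emeasure radial_measure B"
    by (subst distr_cmod_borel[symmetric], subst emeasure_distr[OF cmod_measurable_area_borel]) auto
  also have "\<dots> = 0" using null_sets_radial[OF B(1)] by auto
  finally have z: "emeasure area_measure (cmod -` B \<inter> unit_disk) = 0" .
  have m: "cmod -` B \<inter> unit_disk \<in> sets lebesgue"
    using measurable_sets[OF cmod_measurable_area_borel, of B] by (simp add: sets_area sets_restrict_space_iff)
  have "emeasure lebesgue (cmod -` B \<inter> unit_disk) = 0"
    using z m by (subst (asm) emeasure_area) auto
  then have "cmod -` B \<inter> unit_disk \<in> null_sets lebesgue" using m by auto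
  then show ?thesis using B(2) by (intro null_sets_completion_subset[OF _ \<open>cmod -` B \<inter> unit_disk \<in> null_sets lebesgue\<close>]) auto
qed

lemma cmod_vimage_lebesgue:
  assumes "E \<in> sets lebesgue"
  shows "cmod -` E \<inter> unit_disk \<in> sets lebesgue"
proof -
  obtain S Z Z' where SZ: "E = S \<union> Z" "Z \<subseteq> Z'" "Z' \<in> null_sets lborel" "S \<in> sets lborel"
    using assms by (rule sets_completionE)
  have "Z \<in> null_sets lebesgue" using SZ by (auto simp: null_sets_completion_iff2)
  then have "cmod -` Z \<inter> unit_disk \<in> sets lebesgue" using null_sets_cmod_vimage by blast
  moreover have "cmod -` S \<inter> unit_disk \<in> sets lebesgue"
    using measurable_sets[OF cmod_measurable_area_borel, of S] SZ(4) by (simp add: sets_area sets_restrict_space_iff)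
  moreover have "cmod -` E \<inter> unit_disk = (cmod -` S \<inter> unit_disk) \<union> (cmod -` Z \<inter> unit_disk)" using SZ(1) by auto
  ultimately show ?thesis by auto
qed

lemma cmod_measurable_area: "cmod \<in> area_measure \<rightarrow>\<^sub>M lebesgue"
  by (rule measurableI) (auto simp: sets_area sets_restrict_space_iff cmod_vimage_lebesgue)

lemma distr_cmod: "distr area_measure lebesgue cmod = density lebesgue (\<lambda>r. ennreal (2 * r) * indicator {0<..<1} r)"
  (is "?L = ?R")
proof (rule measure_eqI)
  fix E assume "E \<in> sets ?L"
  then have E: "E \<in> sets lebesgue" by simp
  then obtain S Z Z' where SZ: "E = S \<union> Z" "Z \<subseteq> Z'" "Z' \<in> null_sets lborel" "S \<in> sets lborel"
    by (rule sets_completionE)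
  have ZN: "Z \<in> null_sets lebesgue" using SZ by (auto simp: null_sets_completion_iff2)
  let ?d = "\<lambda>r. ennreal (2 * r) * indicator {0<..<1} r"
  have md: "?d \<in> borel_measurable lborel" by measurable
  have mdc: "?d \<in> borel_measurable lebesgue" by (rule measurable_completion[OF md])
  have "AE r in lebesgue. r \<in> Z \<longrightarrow> ?d r = 0"
    using AE_not_in[OF ZN] by eventually_elim auto
  then have nR: "Z \<in> null_sets ?R"
    using ZN by (subst null_sets_density_iff[OF mdc]) auto
  have "emeasure area_measure (cmod -` Z \<inter> unit_disk) = 0"
    using null_sets_cmod_vimage[OF ZN] by (subst emeasure_area) auto
  then have nL: "Z \<in> null_sets ?L"
    using ZN cmod_measurable_area by (intro null_setsI) (auto simp: emeasure_distr)
  have "emeasure ?L E = emeasure ?L S" using nL SZ by (simp add: emeasure_Un_null_set)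
  also have "\<dots> = emeasure (distr area_measure borel cmod) S"
    using SZ cmod_measurable_area by (simp add: emeasure_distr emeasure_distr[OF cmod_measurable_area_borel])
  also have "\<dots> = emeasure radial_measure S" by (simp add: distr_cmod_borel)
  also have "\<dots> = (\<integral>\<^sup>+r. ?d r * indicator S r \<partial>lborel)"
    unfolding radial_measure_def by (rule emeasure_density[OF md SZ(4)])
  also have "\<dots> = (\<integral>\<^sup>+r. ?d r * indicator S r \<partial>lebesgue)"
    by (simp add: nn_integral_completion)
  also have "\<dots> = emeasure ?R S"
    by (rule emeasure_density[OF mdc, symmetric]) (use SZ(4) in auto)
  also have "\<dots> = emeasure ?R E" using nR SZ by (simp add: emeasure_Un_null_set)
  finally show "emeasure ?L E = emeasure ?R E" .
qed simp

text \<open>A set of radii is measurable as soon as the corresponding union of circles is. Up to a null set, a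
  measurable plane set is a countable union of compact sets, whose image under \<open>cmod\<close> is again such
  a union. Applied to \<open>E\<close> and to its complement this encloses \<open>E\<close> between two Borel sets that
  differ by a set \<open>?G\<close> of radii with null preimage, and \<open>?G\<close> is then null itself. The decomposition of a
  function into quasihomogeneous parts comes with arbitrary radial factors, so this direction is
  indispensable for evaluating their Mellin transforms.\<close>

lemma lebesgue_of_cmod_vimage:
  assumes E: "E \<subseteq> {0<..<1}" and m: "cmod -` E \<inter> unit_disk \<in> sets lebesgue"
  shows "E \<in> sets lebesgue"
proof -
  have core: "\<exists>K\<in>sets borel. K \<subseteq> A \<and> cmod -` (A - K) \<inter> unit_disk \<in> null_sets lebesgue"
    if A: "cmod -` A \<inter> unit_disk \<in> sets lebesgue" for A
  proof -
    obtain C T where C: "fsigma C" "T \<in> null_sets lebesgue" "C \<union> T = cmod -` A \<inter> unit_disk"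
      using lebesgue_set_almost_fsigma[OF A] by metis
    obtain F :: "nat \<Rightarrow> complex set" where F: "range F \<subseteq> Collect compact" "C = \<Union>(F ` UNIV)"
      using C(1) unfolding fsigma_Union_compact by blast
    have "compact (cmod ` F n)" for n
      using F(1) by (intro compact_continuous_image) (auto intro: continuous_intros)
    then have "cmod ` C \<in> sets borel" unfolding F(2) image_UN by (intro sets.countable_UN) (auto intro: borel_compact)
    moreover have "cmod ` C \<subseteq> A" using C(3) by auto
    moreover have "cmod -` (A - cmod ` C) \<inter> unit_disk \<subseteq> T" using C(3) by auto
    then have "cmod -` (A - cmod ` C) \<inter> unit_disk \<in> null_sets lebesgue"
      using C(2) null_sets_completion_subset by blast
    ultimately show ?thesis by blast
  qed
  obtain K where K: "K \<in> sets borel" "K \<subseteq> E" "cmod -` (E - K) \<inter> unit_disk \<in> null_sets lebesgue"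
    using core[OF m] by blast
  let ?E' = "{0<..<1} - E"
  have "cmod -` ?E' \<inter> unit_disk = (cmod -` {0<..<1} \<inter> unit_disk) - (cmod -` E \<inter> unit_disk)" by auto
  moreover have "cmod -` {0<..<1} \<inter> unit_disk \<in> sets lebesgue" by (rule cmod_vimage_lebesgue) auto
  ultimately have "cmod -` ?E' \<inter> unit_disk \<in> sets lebesgue" using m by auto
  then obtain L where L: "L \<in> sets borel" "L \<subseteq> ?E'" "cmod -` (?E' - L) \<inter> unit_disk \<in> null_sets lebesgue"
    using core by blast
  let ?G = "({0<..<1} - L) - K"
  have Gb: "?G \<in> sets borel" using K L by auto
  have "cmod -` ?G \<inter> unit_disk \<subseteq> (cmod -` (E - K) \<inter> unit_disk) \<union> (cmod -` (?E' - L) \<inter> unit_disk)" by auto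
  then have G0: "cmod -` ?G \<inter> unit_disk \<in> null_sets lebesgue"
    using K(3) L(3) by (meson null_sets.Un null_sets_completion_subset)
  then have "emeasure area_measure (cmod -` ?G \<inter> unit_disk) = 0" by (subst emeasure_area) auto
  moreover have "emeasure (distr area_measure borel cmod) ?G = emeasure area_measure (cmod -` ?G \<inter> unit_disk)"
    using Gb by (subst emeasure_distr[OF cmod_measurable_area_borel]) auto
  ultimately have "emeasure radial_measure ?G = 0" by (simp add: distr_cmod_borel)
  then have "?G \<in> null_sets radial_measure" using Gb by (auto simp: radial_measure_def)
  then have "AE r in lborel. r \<in> ?G \<longrightarrow> ennreal (2 * r) * indicator {0<..<1} r = 0"
    unfolding radial_measure_def by (subst (asm) null_sets_density_iff) auto
  then have "AE r in lborel. r \<notin> ?G"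
    by eventually_elim (auto split: split_indicator_asm)
  then have "?G \<in> null_sets lborel" using Gb by (subst (asm) AE_iff_null_sets[symmetric]) auto
  then have "E - K \<in> null_sets lebesgue" unfolding null_sets_completion_iff2
    using L(2) E by (intro bexI[of _ ?G]) auto
  moreover have "E = K \<union> (E - K)" using K by auto
  ultimately show ?thesis using K(1) by (metis null_setsD2 sets.Un sets_completionI_sets sets_lborel)
qed

section \<open>Moments of quasihomogeneous functions\<close>

lemma radial_measurable_iff:
  fixes \<phi> :: "real \<Rightarrow> complex"
  shows "(\<lambda>z. \<phi> (cmod z)) \<in> area_borel \<longleftrightarrow> \<phi> \<in> unit_borel"
proof
  assume L: "(\<lambda>z. \<phi> (cmod z)) \<in> area_borel"
  show "\<phi> \<in> unit_borel"
  proof (rule measurableI)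
    fix A :: "complex set" assume A: "A \<in> sets borel"
    let ?E = "\<phi> -` A \<inter> {0<..<1}"
    have "(\<lambda>z. \<phi> (cmod z)) -` A \<inter> unit_disk \<in> sets lebesgue"
      using measurable_sets[OF L A] by (simp add: sets_area sets_restrict_space_iff)
    moreover have "cmod -` {0<..<1} \<inter> unit_disk \<in> sets lebesgue" by (rule cmod_vimage_lebesgue) auto
    moreover have "cmod -` ?E \<inter> unit_disk = ((\<lambda>z. \<phi> (cmod z)) -` A \<inter> unit_disk) \<inter> (cmod -` {0<..<1} \<inter> unit_disk)" by auto
    ultimately have "?E \<in> sets lebesgue" by (intro lebesgue_of_cmod_vimage) auto
    then show "\<phi> -` A \<inter> space (lebesgue_on {0<..<1}) \<in> sets (lebesgue_on {0<..<1})"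
      by (simp add: sets_restrict_space_iff)
  qed auto
next
  assume R: "\<phi> \<in> unit_borel"
  show "(\<lambda>z. \<phi> (cmod z)) \<in> area_borel"
  proof (rule measurableI)
    fix A :: "complex set" assume A: "A \<in> sets borel"
    let ?E = "\<phi> -` A \<inter> {0<..<1}"
    have "?E \<in> sets lebesgue"
      using measurable_sets[OF R A] by (simp add: sets_restrict_space_iff)
    then have "cmod -` ?E \<inter> unit_disk \<in> sets lebesgue" by (rule cmod_vimage_lebesgue)
    moreover have "(\<lambda>z. \<phi> (cmod z)) -` A \<inter> unit_disk = (cmod -` ?E \<inter> unit_disk) \<union> (if \<phi> 0 \<in> A then {0} else {})"
      by auto
    moreover have "(if \<phi> 0 \<in> A then {0} else {}) \<in> sets (lebesgue :: complex measure)" by auto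
    ultimately have "(\<lambda>z. \<phi> (cmod z)) -` A \<inter> unit_disk \<in> sets lebesgue"
      by (simp only: sets.Un)
    then show "(\<lambda>z. \<phi> (cmod z)) -` A \<inter> space area_measure \<in> sets area_measure"
      by (simp add: sets_area sets_restrict_space_iff)
  qed auto
qed

text \<open>The origin is exceptional throughout: there the angle and the negative powers of the radius take
  default values.\<close>

lemma AE_area_nonzero: "AE z in area_measure. z \<noteq> 0"
  by (rule AE_area_of_lebesgue[OF AE_completion[OF AE_lborel_singleton]])

lemma radial_integral:
  fixes \<phi> :: "real \<Rightarrow> complex"
  assumes m: "\<phi> \<in> unit_borel"
  shows "integrable area_measure (\<lambda>z. \<phi> (cmod z)) \<longleftrightarrow> integrable (lebesgue_on {0<..<1}) (\<lambda>r. of_real r * \<phi> r)"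
    and "(LINT z|area_measure. \<phi> (cmod z)) = 2 * (LINT r|lebesgue_on {0<..<1}. of_real r * \<phi> r)"
proof -
  let ?f = "\<lambda>r. if r \<in> {0<..<1} then \<phi> r else 0"
  have mf: "?f \<in> borel_measurable lebesgue"
    using m borel_measurable_if_lebesgue_on[of "{0<..<1::real}" UNIV \<phi>] by (simp add: lebesgue_on_UNIV_eq)
  have ae: "AE z in area_measure. \<phi> (cmod z) = ?f (cmod z)"
    using AE_area_nonzero AE_space by eventually_elim auto
  have mph: "(\<lambda>z. \<phi> (cmod z)) \<in> area_borel" using m by (simp add: radial_measurable_iff)
  have mfc: "(\<lambda>z. ?f (cmod z)) \<in> area_borel"
    using measurable_compose[OF cmod_measurable_area mf] by simp
  \<comment> \<open>The density is made real-valued, as the transformation of Bochner integrals requires.\<close>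
  let ?d = "\<lambda>r::real. 2 * r * indicator {0<..<1} r"
  have md: "?d \<in> borel_measurable lebesgue" by (intro measurable_completion) measurable
  have dens: "density lebesgue (\<lambda>r. ennreal (2 * r) * indicator {0<..<1} r) = density lebesgue (\<lambda>r. ennreal (?d r))"
    by (rule arg_cong[where f="density lebesgue"]) (auto simp: fun_eq_iff indicator_def)
  have d0: "AE r in lebesgue. 0 \<le> ?d r" by (auto simp: indicator_def)
  have eq: "?d r *\<^sub>R ?f r = indicator {0<..<1} r *\<^sub>R (2 * (of_real r * \<phi> r))" for r
    by (auto simp: indicator_def scaleR_conv_of_real)
  have "integrable area_measure (\<lambda>z. \<phi> (cmod z)) \<longleftrightarrow> integrable area_measure (\<lambda>z. ?f (cmod z))"
    by (rule integrable_cong_AE[OF mph mfc ae])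
  also have "\<dots> \<longleftrightarrow> integrable (distr area_measure lebesgue cmod) ?f"
    by (rule integrable_distr_eq[OF cmod_measurable_area mf, symmetric])
  also have "\<dots> \<longleftrightarrow> integrable lebesgue (\<lambda>r. ?d r *\<^sub>R ?f r)"
    unfolding distr_cmod dens by (rule integrable_density[OF mf md d0])
  also have "\<dots> \<longleftrightarrow> integrable (lebesgue_on {0<..<1}) (\<lambda>r. 2 * (of_real r * \<phi> r))"
    unfolding eq by (subst integrable_restrict_space) auto
  also have "\<dots> \<longleftrightarrow> integrable (lebesgue_on {0<..<1}) (\<lambda>r. of_real r * \<phi> r)"
    using integrable_mult_right[of "1/2" "lebesgue_on {0<..<1}" "\<lambda>r. 2 * (of_real r * \<phi> r)"]
      integrable_mult_right[of 2 "lebesgue_on {0<..<1}" "\<lambda>r. of_real r * \<phi> r"] by auto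
  finally show "integrable area_measure (\<lambda>z. \<phi> (cmod z)) \<longleftrightarrow> integrable (lebesgue_on {0<..<1}) (\<lambda>r. of_real r * \<phi> r)" .
  have "(LINT z|area_measure. \<phi> (cmod z)) = (LINT z|area_measure. ?f (cmod z))"
    by (rule integral_cong_AE[OF mph mfc ae])
  also have "\<dots> = integral\<^sup>L (distr area_measure lebesgue cmod) ?f"
    by (rule integral_distr[OF cmod_measurable_area mf, symmetric])
  also have "\<dots> = (LINT r|lebesgue. ?d r *\<^sub>R ?f r)"
    unfolding distr_cmod dens by (rule integral_density[OF mf md d0])
  also have "\<dots> = (LINT r|lebesgue_on {0<..<1}. 2 * (of_real r * \<phi> r))"
    unfolding eq by (subst integral_restrict_space) auto
  finally show "(LINT z|area_measure. \<phi> (cmod z)) = 2 * (LINT r|lebesgue_on {0<..<1}. of_real r * \<phi> r)"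
    by simp
qed

lemma area_rotation:
  fixes f :: "complex \<Rightarrow> complex"
  assumes c: "cmod c = 1" and f: "integrable area_measure f"
  shows "(\<lambda>z. f (c * z)) \<in> area_borel"
    and "(LINT z|area_measure. f (c * z)) = (LINT z|area_measure. f z)"
proof -
  have nn: "AE z in lebesgue_on unit_disk. 0 \<le> 1 / pi" by auto
  have fm: "f \<in> borel_measurable (lebesgue_on unit_disk)"
    using f by (auto simp: borel_measurable_area[symmetric])
  let ?g = "\<lambda>z. if z \<in> unit_disk then f z else 0"
  have gm: "?g \<in> borel_measurable lebesgue"
    using fm borel_measurable_if_lebesgue_on[of unit_disk UNIV f] by (simp add: lebesgue_on_UNIV_eq)
  have gcm: "(\<lambda>z. ?g (c * z)) \<in> borel_measurable lebesgue"
    using measurable_compose[OF distr_lebesgue_rotation(1)[OF c] gm] .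
  have fcm: "(\<lambda>z. f (c * z)) \<in> borel_measurable (lebesgue_on unit_disk)"
  proof -
    have "(\<lambda>z. if z \<in> unit_disk then f (c * z) else 0) = (\<lambda>z. ?g (c * z))"
      using c by (auto simp: fun_eq_iff norm_mult)
    then show ?thesis using gcm borel_measurable_if_lebesgue_on[of unit_disk UNIV "\<lambda>z. f (c * z)"]
      by (simp add: lebesgue_on_UNIV_eq)
  qed
  have to_leb: "(LINT z|area_measure. h z) = (1/pi) *\<^sub>R (LINT z|lebesgue. indicator unit_disk z *\<^sub>R h z)"
    if "h \<in> borel_measurable (lebesgue_on unit_disk)" for h :: "complex \<Rightarrow> complex"
    unfolding area_measure_def using that
    by (subst integral_density) (auto simp: integral_restrict_space)
  have "(LINT z|lebesgue. indicator unit_disk z *\<^sub>R f z) = integral\<^sup>L lebesgue ?g"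
    by (rule Bochner_Integration.integral_cong) (auto simp: indicator_def)
  also have "\<dots> = integral\<^sup>L (distr lebesgue lebesgue (\<lambda>z. c * z)) ?g"
    by (simp add: distr_lebesgue_rotation(2)[OF c])
  also have "\<dots> = (LINT z|lebesgue. ?g (c * z))"
    by (rule integral_distr[OF distr_lebesgue_rotation(1)[OF c] gm])
  also have "\<dots> = (LINT z|lebesgue. indicator unit_disk z *\<^sub>R f (c * z))"
    by (rule Bochner_Integration.integral_cong) (use c in \<open>auto simp: indicator_def norm_mult\<close>)
  finally show "(LINT z|area_measure. f (c * z)) = (LINT z|area_measure. f z)"
    unfolding to_leb[OF fm] to_leb[OF fcm] by simp
  show "(\<lambda>z. f (c * z)) \<in> area_borel" using fcm by (simp add: borel_measurable_area)
qed

text \<open>The rotation by \<open>\<pi> / k\<close> changes the sign of \<open>f\<close> and preserves the integral.\<close>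

lemma integral_homogeneous_zero:
  fixes f :: "complex \<Rightarrow> complex" and k :: int
  assumes "k \<noteq> 0" and h: "\<And>t z. z \<noteq> 0 \<Longrightarrow> f (cis t * z) = cis (of_int k * t) * f z"
  shows "(LINT z|area_measure. f z) = 0"
proof (cases "integrable area_measure f")
  case True
  let ?c = "cis (pi / of_int k)"
  have neg: "f (?c * z) = - f z" if "z \<noteq> 0" for z
    using h[OF that, of "pi / of_int k"] \<open>k \<noteq> 0\<close> by (simp add: cis_pi)
  have "AE z in area_measure. f (?c * z) = - f z" using AE_area_nonzero by eventually_elim (rule neg)
  moreover have "(\<lambda>z. - f z) \<in> area_borel" using True by auto
  moreover have "(\<lambda>z. f (?c * z)) \<in> area_borel"
    using area_rotation(1)[OF _ True, of ?c] by auto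
  ultimately have "(LINT z|area_measure. f (?c * z)) = (LINT z|area_measure. - f z)"
    by (intro Bochner_Integration.integral_cong_AE) auto
  then show ?thesis using area_rotation(2)[OF _ True, of ?c] True by simp
qed (simp add: not_integrable_integral_eq)

text \<open>Integer powers of \<open>z / |z|\<close> written with natural exponents, which makes measurability and the
  behaviour under rotations accessible in spite of the discontinuity of \<open>Arg\<close>.\<close>

lemma cis_int_Arg: "cis (of_int m * Arg z) = (if z = 0 then 1 else if 0 \<le> m then sgn z ^ nat m else cnj (sgn z) ^ nat (- m))"
proof (cases "z = 0")
  case True then show ?thesis by (simp add: Arg_zero)
next
  case False
  then have s: "sgn z = cis (Arg z)" by (simp add: cis_Arg)
  have "cis (of_int m * Arg z) = cis (Arg z) ^ nat m" if "0 \<le> m"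
    unfolding Complex.DeMoivre using that by simp
  moreover have "cis (of_int m * Arg z) = cis (- Arg z) ^ nat (- m)" if "\<not> 0 \<le> m"
    unfolding Complex.DeMoivre using that by simp
  ultimately show ?thesis unfolding s cis_cnj using False by auto
qed

lemma measurable_cis_Arg: "(\<lambda>z. cis (of_int m * Arg z)) \<in> area_borel"
proof -
  have "(\<lambda>z. cis (of_int m * Arg z)) \<in> borel_measurable lborel"
    unfolding cis_int_Arg by (cases "0 \<le> m") (auto intro!: measurable_If borel_measurable_power borel_measurable_continuous_on[OF continuous_on_cnj[OF continuous_on_id]])
  then have "(\<lambda>z. cis (of_int m * Arg z)) \<in> borel_measurable lebesgue" by (rule measurable_completion)
  then show ?thesis by (simp add: borel_measurable_area measurable_restrict_space1)
qed

lemma cis_rotate_Arg: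
  assumes "z \<noteq> 0"
  shows "cis (of_int m * Arg (cis t * z)) = cis (of_int m * t) * cis (of_int m * Arg z)"
proof -
  have s: "sgn (cis t * z) = cis t * sgn z" using assms by (simp add: sgn_eq norm_mult)
  have nz: "cis t * z \<noteq> 0" using assms by simp
  have c: "cis t ^ nat m = cis (of_int m * t)" if "0 \<le> m"
    unfolding Complex.DeMoivre using that by simp
  have c': "cnj (cis t) ^ nat (- m) = cis (of_int m * t)" if "\<not> 0 \<le> m"
    unfolding cis_cnj Complex.DeMoivre using that by simp
  show ?thesis using assms nz c c' unfolding cis_int_Arg s
    by (auto simp: power_mult_distrib)
qed

lemma quasihom_measurable_iff:
  "quasihom m \<phi> \<in> area_borel \<longleftrightarrow> \<phi> \<in> unit_borel"
proof -
  have q: "quasihom m \<phi> = (\<lambda>z. \<phi> (cmod z) * cis (of_int m * Arg z))"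
    by (auto simp: quasihom_def fun_eq_iff)
  have r: "(\<lambda>z. \<phi> (cmod z)) = (\<lambda>z. quasihom m \<phi> z * cis (of_int (- m) * Arg z))"
    by (auto simp: quasihom_def fun_eq_iff cis_mult)
  show ?thesis unfolding radial_measurable_iff[symmetric]
  proof
    assume "quasihom m \<phi> \<in> area_borel"
    then show "(\<lambda>z. \<phi> (cmod z)) \<in> area_borel"
      unfolding r by (intro borel_measurable_times measurable_cis_Arg)
  next
    assume "(\<lambda>z. \<phi> (cmod z)) \<in> area_borel"
    then show "quasihom m \<phi> \<in> area_borel"
      unfolding q by (intro borel_measurable_times measurable_cis_Arg)
  qed
qed

abbreviation weighted_integrable :: "real \<Rightarrow> (complex \<Rightarrow> complex) \<Rightarrow> bool"
  where "weighted_integrable \<alpha> f \<equiv> integrable area_measure (\<lambda>z. complex_of_real (cmod z powr \<alpha>) * f z)"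

text \<open>The weight can be divided out except at the origin, a measurable set.\<close>

lemma weighted_integrable_measurable:
  assumes "weighted_integrable \<alpha> f"
  shows "f \<in> area_borel"
proof -
  have c: "(\<lambda>z. complex_of_real (cmod z powr (- \<alpha>))) \<in> area_borel" by measurable
  have "(\<lambda>z. complex_of_real (cmod z powr (- \<alpha>)) * (complex_of_real (cmod z powr \<alpha>) * f z)) \<in> area_borel"
    using assms by (intro borel_measurable_times[OF c]) auto
  then have "(\<lambda>z. if z \<in> {0} then f 0 else complex_of_real (cmod z powr (- \<alpha>)) * (complex_of_real (cmod z powr \<alpha>) * f z)) \<in> area_borel"
    by (intro measurable_If_set) (auto simp: sets_area sets_restrict_space_iff)
  also have "(\<lambda>z. if z \<in> {0} then f 0 else complex_of_real (cmod z powr (- \<alpha>)) * (complex_of_real (cmod z powr \<alpha>) * f z)) = f"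
    by (auto simp: fun_eq_iff powr_minus field_simps)
  finally show ?thesis .
qed

definition moment :: "(complex \<Rightarrow> complex) \<Rightarrow> nat \<Rightarrow> nat \<Rightarrow> complex" where
  "moment f p q = (LINT z|area_measure. f z * z ^ p * cnj z ^ q)"

text \<open>On the disk \<open>|z|\<^bsup>p + q\<^esup>\<close> is dominated by the weight. As \<open>\<alpha>\<close> is
  positive, so is \<open>p + q\<close>, and at the origin both sides vanish.\<close>

lemma moment_integrable:
  assumes "\<alpha> > 0" and i: "weighted_integrable \<alpha> f"
    and pq: "\<alpha> \<le> real (p + q)"
  shows "integrable area_measure (\<lambda>z. f z * z ^ p * cnj z ^ q)"
proof (rule Bochner_Integration.integrable_bound[OF i])
  have "(\<lambda>z. z ^ p * cnj z ^ q) \<in> area_borel"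
    by (rule continuous_measurable_area) (intro continuous_intros)
  from borel_measurable_times[OF weighted_integrable_measurable[OF i] this]
  show "(\<lambda>z. f z * z ^ p * cnj z ^ q) \<in> area_borel" by (simp add: mult.assoc)
  have le: "cmod (f z * z ^ p * cnj z ^ q) \<le> cmod (complex_of_real (cmod z powr \<alpha>) * f z)" if "z \<in> unit_disk" for z
  proof (cases "z = 0")
    case True
    have "p + q \<noteq> 0" using assms by auto
    then show ?thesis using True by (auto simp: power_0_left)
  next
    case False
    have "cmod z ^ (p + q) = cmod z powr real (p + q)" using False by (subst powr_realpow) auto
    also have "\<dots> \<le> cmod z powr \<alpha>" using that pq False by (intro powr_mono') auto
    finally have "cmod (f z) * cmod z ^ (p + q) \<le> cmod (f z) * cmod z powr \<alpha>" by (intro mult_left_mono) auto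
    then show ?thesis by (simp add: norm_mult norm_power power_add mult_ac)
  qed
  then show "AE z in area_measure. cmod (f z * z ^ p * cnj z ^ q) \<le> cmod (complex_of_real (cmod z powr \<alpha>) * f z)"
    by (intro AE_I2) (rule le, simp)
qed

lemma cis_power_product:
  "cis (of_int m * t) * (cis t ^ p * cnj (cis t) ^ q) = cis (of_int (m + int p - int q) * t)"
  unfolding cis_cnj Complex.DeMoivre cis_mult by (simp add: algebra_simps)

text \<open>The integrand is homogeneous of degree \<open>m + p - q\<close> under rotations, so only \<open>q = p + m\<close>
  survives. In that case it is radial, and the density \<open>2 r\<close> of the radius turns the integral into a
  Mellin transform.\<close>

lemma moment_quasihom:
  assumes "\<alpha> > 0" and i: "weighted_integrable \<alpha> (quasihom m \<phi>)"
    and pq: "\<alpha> \<le> real (p + q)"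
  shows "moment (quasihom m \<phi>) p q = (if int p + m = int q then 2 * mellin \<phi> (of_nat (p + q + 2)) else 0)"
proof (cases "int p + m = int q")
  case False
  have "(LINT z|area_measure. quasihom m \<phi> z * z ^ p * cnj z ^ q) = 0"
  proof (rule integral_homogeneous_zero[where k = "m + int p - int q"])
    fix t and z :: complex assume z: "z \<noteq> 0"
    note cis_power_product[of m t p q, symmetric]
    then show "quasihom m \<phi> (cis t * z) * (cis t * z) ^ p * cnj (cis t * z) ^ q =
       cis (of_int (m + int p - int q) * t) * (quasihom m \<phi> z * z ^ p * cnj z ^ q)"
      using cis_rotate_Arg[OF z, of m t] by (simp add: quasihom_def norm_mult power_mult_distrib mult_ac)
  qed (use False in auto)
  then show ?thesis using False by (simp add: moment_def)
next
  case True
  have m: "\<phi> \<in> unit_borel"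
    using weighted_integrable_measurable[OF i] by (simp add: quasihom_measurable_iff)
  let ?\<psi> = "\<lambda>r. \<phi> r * of_real r ^ (p + q)"
  have m': "?\<psi> \<in> unit_borel"
    by (intro borel_measurable_times m borel_measurable_power continuous_imp_measurable_on_sets_lebesgue continuous_intros) auto
  have e: "quasihom m \<phi> z * z ^ p * cnj z ^ q = ?\<psi> (cmod z)" if "z \<noteq> 0" for z
  proof -
    have z: "z = of_real (cmod z) * cis (Arg z)" by (metis rcis_cmod_Arg rcis_def)
    have "z ^ p * cnj z ^ q = of_real (cmod z) ^ (p + q) * (cis (Arg z) ^ p * cnj (cis (Arg z)) ^ q)"
      by (subst (1 2) z) (simp add: power_mult_distrib power_add)
    moreover note cis_power_product[of m "Arg z" p q]
    moreover have "m + int p - int q = 0" using True by simp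
    ultimately show ?thesis unfolding quasihom_def by (simp add: mult.assoc)
  qed
  have "moment (quasihom m \<phi>) p q = (LINT z|area_measure. ?\<psi> (cmod z))"
    unfolding moment_def
  proof (rule Bochner_Integration.integral_cong_AE)
    show "(\<lambda>z. quasihom m \<phi> z * z ^ p * cnj z ^ q) \<in> area_borel"
      using moment_integrable[OF assms] by auto
    show "(\<lambda>z. ?\<psi> (cmod z)) \<in> area_borel"
      using m' radial_measurable_iff[of ?\<psi>] by simp
    show "AE z in area_measure. quasihom m \<phi> z * z ^ p * cnj z ^ q = ?\<psi> (cmod z)"
      using AE_area_nonzero by eventually_elim (rule e)
  qed
  also have "\<dots> = 2 * (LINT r|lebesgue_on {0<..<1}. of_real r * ?\<psi> r)" by (rule radial_integral[OF m'])
  also have "(LINT r|lebesgue_on {0<..<1}. of_real r * ?\<psi> r) = mellin \<phi> (of_nat (p + q + 2))"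
    unfolding mellin_def
  proof (rule Bochner_Integration.integral_cong)
    fix r :: real assume r: "r \<in> space (lebesgue_on {0<..<1})"
    have "complex_of_real r powr (of_nat (p + q + 2) - 1) = of_real r powr of_nat (p + q + 1)"
      by (simp add: algebra_simps)
    also have "\<dots> = of_real r ^ (p + q + 1)" using r by (subst powr_nat') auto
    finally show "of_real r * ?\<psi> r = \<phi> r * of_real r powr (of_nat (p + q + 2) - 1)"
      by simp
  qed simp
  finally show ?thesis using True by simp
qed

lemma weighted_integrable_quasihom:
  assumes "integrable (lebesgue_on {0<..<1}) (\<lambda>r. complex_of_real (r powr \<alpha>) * \<omega> r)"
  shows "weighted_integrable \<alpha> (quasihom s \<omega>)"
proof -
  let ?f = "\<lambda>r. complex_of_real (r powr \<alpha>) * \<omega> r"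
  have m: "?f \<in> unit_borel" using assms by auto
  have "integrable (lebesgue_on {0<..<1}) (\<lambda>r. of_real r * ?f r)"
  proof (rule Bochner_Integration.integrable_bound[OF assms])
    show "(\<lambda>r. of_real r * ?f r) \<in> unit_borel"
      by (intro borel_measurable_times[OF _ m] continuous_imp_measurable_on_sets_lebesgue continuous_intros) auto
    show "AE r in lebesgue_on {0<..<1}. cmod (of_real r * ?f r) \<le> cmod (?f r)"
      using AE_space by eventually_elim (auto simp: norm_mult intro!: mult_left_le_one_le)
  qed
  then have i: "integrable area_measure (\<lambda>z. ?f (cmod z))" by (simp only: radial_integral(1)[OF m])
  have c: "(\<lambda>z. ?f (cmod z) * cis (of_int s * Arg z)) = (\<lambda>z. complex_of_real (cmod z powr \<alpha>) * quasihom s \<omega> z)"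
    by (auto simp: quasihom_def)
  show ?thesis unfolding c[symmetric]
  proof (rule Bochner_Integration.integrable_bound[OF i])
    show "(\<lambda>z. ?f (cmod z) * cis (of_int s * Arg z)) \<in> area_borel"
      using i by (intro borel_measurable_times measurable_cis_Arg borel_measurable_integrable)
  qed (auto simp: norm_mult)
qed

section \<open>Mellin transforms of powers and logarithms\<close>

text \<open>Radial functions that grow at most like a negative power of the radius. They form a vector space, they are
  nearly integrable, and their Mellin integrals converge in a half-plane, so the convolution of two
  polynomials may be assembled from pieces inside this class.\<close>

definition pow_bounded :: "(real \<Rightarrow> complex) \<Rightarrow> bool" where
  "pow_bounded \<omega> \<longleftrightarrow> \<omega> \<in> unit_borel \<and>
     (\<exists>C s. s > 0 \<and> (\<forall>r\<in>{0<..<1}. cmod (\<omega> r) \<le> C * r powr (- s)))"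

text \<open>The exponent in the definition depends on the function; finitely many functions share one.\<close>

lemma pow_bounded_uniform:
  assumes "finite I" "\<And>i. i \<in> I \<Longrightarrow> pow_bounded (\<omega> i)"
  shows "\<exists>s>0. \<forall>i\<in>I. \<exists>C. \<forall>r\<in>{0<..<1}. cmod (\<omega> i r) \<le> C * r powr (- s)"
  using assms
proof (induction I)
  case empty then show ?case by (intro exI[of _ 1]) auto
next
  case (insert i I)
  obtain s where s: "s > 0" "\<forall>i\<in>I. \<exists>C. \<forall>r\<in>{0<..<1}. cmod (\<omega> i r) \<le> C * r powr (- s)"
    using insert by auto
  obtain C' s' where s': "s' > 0" "\<forall>r\<in>{0<..<1}. cmod (\<omega> i r) \<le> C' * r powr (- s')"
    using insert.prems[of i] unfolding pow_bounded_def by auto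
  have mono: "\<exists>C. \<forall>r\<in>{0<..<1}. cmod (f r) \<le> C * r powr (- max s s')"
    if "t \<le> max s s'" "\<forall>r\<in>{0<..<1}. cmod (f r) \<le> C * r powr (- t)" for t C and f :: "real \<Rightarrow> complex"
  proof (rule exI, rule ballI)
    fix r :: real assume r: "r \<in> {0<..<1}"
    have "cmod (f r) \<le> C * r powr (- t)" using that r by auto
    also have "\<dots> \<le> \<bar>C\<bar> * r powr (- t)" by (intro mult_right_mono) auto
    also have "\<dots> \<le> \<bar>C\<bar> * r powr (- max s s')"
      using r that(1) by (intro mult_left_mono powr_mono') auto
    finally show "cmod (f r) \<le> \<bar>C\<bar> * r powr (- max s s')" .
  qed
  show ?case
  proof (rule exI[of _ "max s s'"], intro conjI ballI)
    fix j assume "j \<in> insert i I"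
    then show "\<exists>C. \<forall>r\<in>{0<..<1}. cmod (\<omega> j r) \<le> C * r powr - max s s'"
      using s(2) s'(2) mono[of s "\<omega> j"] mono[of s' "\<omega> j"] by fastforce
  qed (use s in auto)
qed

lemma pow_bounded_sum:
  assumes "finite I" "\<And>i. i \<in> I \<Longrightarrow> pow_bounded (\<omega> i)"
  shows "pow_bounded (\<lambda>r. \<Sum>i\<in>I. c i * \<omega> i r)"
proof -
  obtain s where s: "s > 0" "\<forall>i\<in>I. \<exists>C. \<forall>r\<in>{0<..<1}. cmod (\<omega> i r) \<le> C * r powr (- s)"
    using pow_bounded_uniform[of I \<omega>] assms by blast
  then obtain C where C: "\<And>i r. i \<in> I \<Longrightarrow> r \<in> {0<..<1} \<Longrightarrow> cmod (\<omega> i r) \<le> C i * r powr (- s)" by metis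
  show ?thesis unfolding pow_bounded_def
  proof (rule conjI[OF _ exI[of _ "\<Sum>i\<in>I. cmod (c i) * C i", OF exI[of _ s]]], goal_cases m b)
    case m
    show "(\<lambda>r. \<Sum>i\<in>I. c i * \<omega> i r) \<in> unit_borel"
      using assms by (intro borel_measurable_sum borel_measurable_times) (auto simp: pow_bounded_def)
  next
    case b
    have "cmod (\<Sum>i\<in>I. c i * \<omega> i r) \<le> (\<Sum>i\<in>I. cmod (c i) * C i) * r powr - s"
      if r: "r \<in> {0<..<1}" for r
    proof -
    have "cmod (\<Sum>i\<in>I. c i * \<omega> i r) \<le> (\<Sum>i\<in>I. cmod (c i * \<omega> i r))" by (rule norm_sum)
    also have "\<dots> \<le> (\<Sum>i\<in>I. cmod (c i) * (C i * r powr (- s)))"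
      unfolding norm_mult using C r by (intro sum_mono mult_left_mono) auto
    finally show ?thesis
      by (simp add: sum_distrib_right mult.assoc)
    qed
    then show ?case using s by auto
  qed
qed

lemma integrable_bounded_unit_interval:
  fixes f :: "real \<Rightarrow> complex"
  assumes "f \<in> unit_borel" "\<And>r. r \<in> {0<..<1} \<Longrightarrow> cmod (f r) \<le> C"
  shows "integrable (lebesgue_on {0<..<1}) f"
proof -
  interpret finite_measure "lebesgue_on {0<..<1::real}" by (rule finite_measure_lebesgue_on) auto
  show ?thesis by (rule integrable_const_bound[of _ C]) (use assms in \<open>auto intro!: AE_I2\<close>)
qed

lemma of_real_powr_measurable:
  "(\<lambda>r. complex_of_real r powr w) \<in> unit_borel"
  by (rule continuous_imp_measurable_on_sets_lebesgue)
    (auto intro!: continuous_intros simp: complex_nonpos_Reals_iff)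

lemma powr_measurable:
  "(\<lambda>r. complex_of_real (r powr w)) \<in> unit_borel"
  by (rule continuous_imp_measurable_on_sets_lebesgue) (auto intro!: continuous_intros)

lemma norm_of_real_powr: "r > 0 \<Longrightarrow> cmod (complex_of_real r powr w) = r powr (Re w)"
  by (simp add: norm_powr_real_powr)

lemma pow_bounded_nearly_integrable:
  assumes "pow_bounded \<omega>"
  shows "nearly_integrable_interval \<omega>"
proof -
  obtain C s where s: "s > 0" "\<forall>r\<in>{0<..<1}. cmod (\<omega> r) \<le> C * r powr (- s)"
    and m: "\<omega> \<in> unit_borel"
    using assms unfolding pow_bounded_def by auto
  have "integrable (lebesgue_on {0<..<1}) (\<lambda>r. complex_of_real (r powr s) * \<omega> r)"
  proof (rule integrable_bounded_unit_interval)
    show "(\<lambda>r. complex_of_real (r powr s) * \<omega> r) \<in> unit_borel"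
      by (intro borel_measurable_times m powr_measurable)
    fix r :: real assume r: "r \<in> {0<..<1}"
    have "cmod (complex_of_real (r powr s) * \<omega> r) \<le> r powr s * (C * r powr (- s))"
      unfolding norm_mult using r s by (intro mult_mono) auto
    also have "\<dots> = C" using r by (simp add: powr_minus)
    finally show "cmod (complex_of_real (r powr s) * \<omega> r) \<le> C" .
  qed
  then show ?thesis unfolding nearly_integrable_interval_def using s by auto
qed

lemma pow_bounded_nearly_integrable_disk:
  assumes "pow_bounded \<omega>"
  shows "nearly_integrable_disk (quasihom m \<omega>)"
  using pow_bounded_nearly_integrable[OF assms] weighted_integrable_quasihom
  unfolding nearly_integrable_interval_def nearly_integrable_disk_def by blast

lemma pow_bounded_mellin_integrable:
  assumes "pow_bounded \<omega>"
  shows "\<exists>a. \<forall>\<zeta>. Re \<zeta> > a \<longrightarrow> integrable (lebesgue_on {0<..<1}) (\<lambda>r. \<omega> r * complex_of_real r powr (\<zeta> - 1))"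
proof -
  obtain C s where s: "s > 0" "\<forall>r\<in>{0<..<1}. cmod (\<omega> r) \<le> C * r powr (- s)"
    and m: "\<omega> \<in> unit_borel"
    using assms unfolding pow_bounded_def by auto
  show ?thesis
  proof (intro exI allI impI)
    fix \<zeta> :: complex assume z: "Re \<zeta> > s + 1"
    show "integrable (lebesgue_on {0<..<1}) (\<lambda>r. \<omega> r * complex_of_real r powr (\<zeta> - 1))"
    proof (rule integrable_bounded_unit_interval[where C="\<bar>C\<bar>"])
      show "(\<lambda>r. \<omega> r * complex_of_real r powr (\<zeta> - 1)) \<in> unit_borel"
        by (intro borel_measurable_times m of_real_powr_measurable)
      fix r :: real assume r: "r \<in> {0<..<1}"
      have b: "cmod (\<omega> r) \<le> C * r powr (- s)" using r s by auto
      have "cmod (\<omega> r * complex_of_real r powr (\<zeta> - 1)) \<le> (C * r powr (- s)) * r powr (Re \<zeta> - 1)"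
        unfolding norm_mult using r order_trans[OF norm_ge_zero b]
        by (intro mult_mono b) (auto simp: norm_of_real_powr)
      also have "\<dots> = C * r powr (Re \<zeta> - 1 - s)" by (simp add: powr_add[symmetric])
      also have "\<dots> \<le> \<bar>C\<bar> * 1" using r z by (intro mult_mono) (auto intro!: powr_le1)
      finally show "cmod (\<omega> r * complex_of_real r powr (\<zeta> - 1)) \<le> \<bar>C\<bar>" by simp
    qed
  qed
qed

text \<open>The Mellin transform is prescribed on some right half-plane, which may shrink when functions are
  combined.\<close>

definition mellin_on_half_plane :: "(real \<Rightarrow> complex) \<Rightarrow> (complex \<Rightarrow> complex) \<Rightarrow> bool" where
  "mellin_on_half_plane \<omega> f \<longleftrightarrow> (\<exists>a. \<forall>\<zeta>. Re \<zeta> > a \<longrightarrow> mellin \<omega> \<zeta> = f \<zeta>)"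

lemma mellin_on_half_plane_sum:
  assumes "finite I" "\<And>i. i \<in> I \<Longrightarrow> pow_bounded (\<omega> i)" "\<And>i. i \<in> I \<Longrightarrow> mellin_on_half_plane (\<omega> i) (f i)"
  shows "mellin_on_half_plane (\<lambda>r. \<Sum>i\<in>I. c i * \<omega> i r) (\<lambda>\<zeta>. \<Sum>i\<in>I. c i * f i \<zeta>)"
proof -
  have "\<forall>i\<in>I. \<exists>a. \<forall>\<zeta>. Re \<zeta> > a \<longrightarrow> mellin (\<omega> i) \<zeta> = f i \<zeta> \<and>
     integrable (lebesgue_on {0<..<1}) (\<lambda>r. \<omega> i r * complex_of_real r powr (\<zeta> - 1))"
  proof
    fix i assume i: "i \<in> I"
    obtain a where a: "\<forall>\<zeta>. Re \<zeta> > a \<longrightarrow> mellin (\<omega> i) \<zeta> = f i \<zeta>"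
      using assms(3)[OF i] unfolding mellin_on_half_plane_def by blast
    obtain b where b: "\<forall>\<zeta>. Re \<zeta> > b \<longrightarrow> integrable (lebesgue_on {0<..<1}) (\<lambda>r. \<omega> i r * complex_of_real r powr (\<zeta> - 1))"
      using pow_bounded_mellin_integrable[OF assms(2)[OF i]] by blast
    show "\<exists>a. \<forall>\<zeta>. Re \<zeta> > a \<longrightarrow> mellin (\<omega> i) \<zeta> = f i \<zeta> \<and>
     integrable (lebesgue_on {0<..<1}) (\<lambda>r. \<omega> i r * complex_of_real r powr (\<zeta> - 1))"
      using a b by (intro exI[of _ "max a b"]) auto
  qed
  then obtain a where a: "\<forall>i\<in>I. \<forall>\<zeta>. Re \<zeta> > a i \<longrightarrow> mellin (\<omega> i) \<zeta> = f i \<zeta> \<and>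
     integrable (lebesgue_on {0<..<1}) (\<lambda>r. \<omega> i r * complex_of_real r powr (\<zeta> - 1))" by metis
  show ?thesis unfolding mellin_on_half_plane_def
  proof (intro exI allI impI)
    fix \<zeta> :: complex assume z: "Re \<zeta> > (\<Sum>i\<in>I. \<bar>a i\<bar>)"
    have zi: "Re \<zeta> > a i" if "i \<in> I" for i
    proof -
      have "a i \<le> \<bar>a i\<bar>" by simp
      also have "\<dots> \<le> (\<Sum>i\<in>I. \<bar>a i\<bar>)" using that assms(1) by (intro member_le_sum) auto
      finally show ?thesis using z by simp
    qed
    have "mellin (\<lambda>r. \<Sum>i\<in>I. c i * \<omega> i r) \<zeta> =
      (LINT r|lebesgue_on {0<..<1}. (\<Sum>i\<in>I. c i * (\<omega> i r * complex_of_real r powr (\<zeta> - 1))))"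
      unfolding mellin_def by (simp add: sum_distrib_right mult.assoc)
    also have "\<dots> = (\<Sum>i\<in>I. (LINT r|lebesgue_on {0<..<1}. c i * (\<omega> i r * complex_of_real r powr (\<zeta> - 1))))"
      using a zi by (intro Bochner_Integration.integral_sum integrable_mult_right) blast
    also have "\<dots> = (\<Sum>i\<in>I. c i * mellin (\<omega> i) \<zeta>)"
      by (simp add: mellin_def)
    also have "\<dots> = (\<Sum>i\<in>I. c i * f i \<zeta>)" using a zi by (intro sum.cong) auto
    finally show "mellin (\<lambda>r. \<Sum>i\<in>I. c i * \<omega> i r) \<zeta> = (\<Sum>i\<in>I. c i * f i \<zeta>)" .
  qed
qed

lemma mellin_cong:
  assumes "\<And>r. r \<in> {0<..<1} \<Longrightarrow> \<phi> r = \<psi> r"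
  shows "mellin \<phi> \<zeta> = mellin \<psi> \<zeta>"
  unfolding mellin_def by (rule Bochner_Integration.integral_cong) (use assms in auto)

text \<open>The antiderivative is differentiable only for positive arguments; the bound \<open>K * r\<close> supplies its
  continuity at the left end point.\<close>

lemma integral_unit_interval_FTC:
  fixes F f :: "real \<Rightarrow> complex"
  assumes F: "\<And>r. 0 < r \<Longrightarrow> (F has_vector_derivative f r) (at r)"
    and F0: "F 0 = 0" and Fb: "\<And>r. r \<in> {0<..<1} \<Longrightarrow> cmod (F r) \<le> K * r"
    and m: "f \<in> unit_borel"
    and fb: "\<And>r. r \<in> {0<..<1} \<Longrightarrow> cmod (f r) \<le> C"
  shows "(LINT r|lebesgue_on {0<..<1}. f r) = F 1"
proof -
  have "continuous_on {0..1} F" unfolding continuous_on_eq_continuous_within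
  proof
    fix x :: real assume x: "x \<in> {0..1}"
    show "continuous (at x within {0..1}) F"
    proof (cases "x = 0")
      case False
      then have "isCont F x" using x F[of x] by (intro has_vector_derivative_continuous) auto
      then show ?thesis by (rule continuous_at_imp_continuous_at_within)
    next
      case True
      have "((\<lambda>r. K * r) \<longlongrightarrow> K * 0) (at 0 within {0..1})" by (intro tendsto_intros)
      then have g: "((\<lambda>r. K * r) \<longlongrightarrow> 0) (at 0 within {0..1})" by simp
      have "(F \<longlongrightarrow> 0) (at 0 within {0..1})"
      proof (rule Lim_null_comparison[OF _ g])
        have "eventually (\<lambda>r. r \<in> {0..1} \<and> r \<noteq> 0 \<and> r < 1) (at (0::real) within {0..1})"
          by (auto simp: eventually_at dist_real_def intro!: exI[of _ 1])
        then show "eventually (\<lambda>r. cmod (F r) \<le> K * r) (at 0 within {0..1})"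
          by eventually_elim (auto intro!: Fb)
      qed
      then show ?thesis using True F0 by (simp add: continuous_within)
    qed
  qed
  then have "(f has_integral F 1 - F 0) {0..1}"
    by (intro fundamental_theorem_of_calculus_interior) (use F in auto)
  then have 1: "(f has_integral F 1) {0<..<1}"
    using F0 has_integral_open_interval[of f "F 1" 0 1] by (simp add: box_real)
  have "(f has_integral (LINT r|lebesgue_on {0<..<1}. f r)) {0<..<1}"
    by (rule has_integral_integral_lebesgue_on[OF integrable_bounded_unit_interval[OF m fb]]) auto
  then show ?thesis using 1 by (rule has_integral_unique)
qed

lemma has_vector_derivative_powr:
  "0 < r \<Longrightarrow> ((\<lambda>r. complex_of_real r powr (w + 1)) has_vector_derivative (w + 1) * complex_of_real r powr w) (at r)"
  by (rule has_vector_derivative_real_field)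
    (auto intro!: derivative_eq_intros simp: complex_nonpos_Reals_iff)

lemma abs_ln_le: "r \<in> {0<..<1} \<Longrightarrow> \<bar>ln r\<bar> \<le> r powr (- 1)" for r :: real
  using ln_le_minus_one[of "1 / r"] by (auto simp: ln_div powr_minus_divide abs_if field_simps)

lemma mellin_powr:
  fixes p :: real
  shows "mellin_on_half_plane (\<lambda>r. complex_of_real (r powr p)) (\<lambda>\<zeta>. 1 / (\<zeta> + of_real p))"
  unfolding mellin_on_half_plane_def
proof (intro exI allI impI)
  fix \<zeta> assume z: "Re \<zeta> > 2 - p"
  \<comment> \<open>On \<open>Re \<zeta> > 2 - p\<close> the exponent \<open>w\<close> has real part above 1, so integrand and antiderivative are bounded.\<close>
  define w where "w = \<zeta> + of_real p - 1"
  have w: "Re w > 1" "w + 1 = \<zeta> + of_real p" "w + 1 \<noteq> 0" using z by (auto simp: w_def complex_eq_iff)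
  have "mellin (\<lambda>r. complex_of_real (r powr p)) \<zeta> = (LINT r|lebesgue_on {0<..<1}. complex_of_real r powr w)"
    unfolding mellin_def w_def
    by (rule Bochner_Integration.integral_cong) (auto simp: powr_of_real[symmetric] powr_add[symmetric] algebra_simps)
  also have "\<dots> = complex_of_real 1 powr (w + 1) / (w + 1)"
  proof (rule integral_unit_interval_FTC[where K="1 / cmod (w+1)" and C=1])
    fix r :: real assume r: "0 < r"
    show "((\<lambda>r. complex_of_real r powr (w + 1) / (w + 1)) has_vector_derivative complex_of_real r powr w) (at r)"
      using has_vector_derivative_divide[OF has_vector_derivative_powr[OF r, of w], of "w + 1"] w by simp
  next
    fix r :: real assume r: "r \<in> {0<..<1}"
    have "r powr (Re w + 1) \<le> r powr 1" using r w by (intro powr_mono') auto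
    then show "cmod (complex_of_real r powr (w + 1) / (w + 1)) \<le> 1 / cmod (w+1) * r"
      using r by (simp add: norm_divide norm_of_real_powr divide_right_mono)
    show "cmod (complex_of_real r powr w) \<le> 1"
      using r w by (simp add: norm_of_real_powr powr_le1)
  qed (auto simp: of_real_powr_measurable)
  finally show "mellin (\<lambda>r. complex_of_real (r powr p)) \<zeta> = 1 / (\<zeta> + of_real p)"
    using w by simp
qed

lemma mellin_powr_ln:
  fixes p :: real
  shows "mellin_on_half_plane (\<lambda>r. complex_of_real (r powr p * ln r)) (\<lambda>\<zeta>. - 1 / (\<zeta> + of_real p)\<^sup>2)"
  unfolding mellin_on_half_plane_def
proof (intro exI allI impI)
  fix \<zeta> assume z: "Re \<zeta> > 2 - p"
  define w where "w = \<zeta> + of_real p - 1"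
  have w: "Re w > 1" "w + 1 = \<zeta> + of_real p" "w + 1 \<noteq> 0" using z by (auto simp: w_def complex_eq_iff)
  let ?F = "\<lambda>r. complex_of_real r powr (w + 1) / (w + 1) * of_real (ln r) - complex_of_real r powr (w + 1) / (w + 1)^2"
  have "mellin (\<lambda>r. complex_of_real (r powr p * ln r)) \<zeta> = (LINT r|lebesgue_on {0<..<1}. complex_of_real r powr w * of_real (ln r))"
    unfolding mellin_def w_def
    by (rule Bochner_Integration.integral_cong) (auto simp: powr_of_real[symmetric] powr_add[symmetric] algebra_simps)
  also have "\<dots> = ?F 1"
  proof (rule integral_unit_interval_FTC[where F="?F" and K="1 / cmod (w+1) + 1 / cmod (w+1)^2" and C=1])
    fix r :: real assume r: "0 < r"
    have l: "((\<lambda>r. complex_of_real (ln r)) has_vector_derivative of_real (1 / r)) (at r)"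
      using r by (auto intro!: derivative_eq_intros simp: has_real_derivative_iff_has_vector_derivative[symmetric])
    have p: "((\<lambda>r. complex_of_real r powr (w + 1) / c) has_vector_derivative (w + 1) * complex_of_real r powr w / c) (at r)" for c
      by (rule has_vector_derivative_divide[OF has_vector_derivative_powr[OF r, of w]])
    have pw: "complex_of_real r powr (w + 1) = complex_of_real r powr w * of_real r" using r by (simp add: powr_add)
    have e: "complex_of_real r powr (w + 1) / (w + 1) * of_real (1 / r)
        + (w + 1) * complex_of_real r powr w / (w + 1) * of_real (ln r)
        - (w + 1) * complex_of_real r powr w / (w + 1)^2 = complex_of_real r powr w * of_real (ln r)"
      using r w(3) unfolding pw by (simp add: power2_eq_square)
    show "(?F has_vector_derivative complex_of_real r powr w * of_real (ln r)) (at r)"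
      using has_vector_derivative_diff[OF has_vector_derivative_mult[OF p[of "w+1"] l] p[of "(w+1)^2"]]
      unfolding e .
  next
    fix r :: real assume r: "r \<in> {0<..<1}"
    have a: "r powr (Re w + 1) \<le> r powr 1" using r w by (intro powr_mono') auto
    have "r powr (Re w + 1) * \<bar>ln r\<bar> \<le> r powr (Re w + 1) * r powr (- 1)"
      using abs_ln_le[OF r] by (intro mult_left_mono) auto
    also have "\<dots> = r powr (Re w)" by (subst powr_add[symmetric]) simp
    also have "\<dots> \<le> r powr 1" using r w by (intro powr_mono') auto
    finally have b: "r powr (Re w + 1) * \<bar>ln r\<bar> \<le> r" using r by simp
    have "cmod (?F r) \<le> cmod (complex_of_real r powr (w + 1) / (w + 1) * of_real (ln r)) + cmod (complex_of_real r powr (w + 1) / (w + 1)^2)"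
      by (rule norm_triangle_ineq4)
    also have "\<dots> = r powr (Re w + 1) * \<bar>ln r\<bar> / cmod (w+1) + r powr (Re w + 1) / cmod (w+1)^2"
      using r by (simp add: norm_divide norm_mult norm_power norm_of_real_powr)
    also have "\<dots> \<le> r / cmod (w+1) + r / cmod (w+1)^2"
      using a b r by (intro add_mono divide_right_mono) auto
    finally show "cmod (?F r) \<le> (1 / cmod (w+1) + 1 / cmod (w+1)^2) * r" by (simp add: field_simps)
    have "r powr (Re w) * \<bar>ln r\<bar> \<le> r powr (Re w) * r powr (- 1)"
      using abs_ln_le[OF r] by (intro mult_left_mono) auto
    also have "\<dots> = r powr (Re w - 1)" by (subst powr_add[symmetric]) simp
    also have "\<dots> \<le> 1" using r w by (intro powr_le1) auto
    finally show "cmod (complex_of_real r powr w * of_real (ln r)) \<le> 1"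
      using r by (simp add: norm_mult norm_of_real_powr)
  next
    show "(\<lambda>r. complex_of_real r powr w * of_real (ln r)) \<in> unit_borel"
      by (intro borel_measurable_times of_real_powr_measurable continuous_imp_measurable_on_sets_lebesgue)
        (auto intro!: continuous_intros)
  qed auto
  finally show "mellin (\<lambda>r. complex_of_real (r powr p * ln r)) \<zeta> = - 1 / (\<zeta> + of_real p)\<^sup>2"
    using w by simp
qed

lemma pow_bounded_powr: "pow_bounded (\<lambda>r. complex_of_real (r powr p))"
proof -
  have "cmod (complex_of_real (r powr p)) \<le> 1 * r powr (- (\<bar>p\<bar> + 1))" if r: "r \<in> {0<..<1}" for r
  proof -
    have "r powr p \<le> r powr (- (\<bar>p\<bar> + 1))" using r by (intro powr_mono') auto
    then show ?thesis by simp
  qed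
  moreover have "\<bar>p\<bar> + 1 > 0" by simp
  ultimately show ?thesis unfolding pow_bounded_def using powr_measurable by blast
qed

lemma pow_bounded_powr_ln: "pow_bounded (\<lambda>r. complex_of_real (r powr p * ln r))"
proof -
  have "cmod (complex_of_real (r powr p * ln r)) \<le> 1 * r powr (- (\<bar>p\<bar> + 1))" if r: "r \<in> {0<..<1}" for r
  proof -
  have "r powr p * \<bar>ln r\<bar> \<le> r powr p * r powr (- 1)" using abs_ln_le[OF r] by (intro mult_left_mono) auto
  also have "\<dots> = r powr (p - 1)" by (subst powr_add[symmetric]) simp
  also have "\<dots> \<le> r powr (- (\<bar>p\<bar> + 1))" using r by (intro powr_mono') auto
  finally show ?thesis by (simp add: norm_mult)
  qed
  moreover have "\<bar>p\<bar> + 1 > 0" by simp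
  moreover have "(\<lambda>r. complex_of_real (r powr p * ln r)) \<in> unit_borel"
    unfolding of_real_mult
    by (intro borel_measurable_times powr_measurable continuous_imp_measurable_on_sets_lebesgue)
      (auto intro!: continuous_intros)
  ultimately show ?thesis unfolding pow_bounded_def by blast
qed

text \<open>Partial fractions: for \<open>p \<noteq> q\<close> a combination of \<open>r\<^sup>p\<close> and \<open>r\<^sup>q\<close>, and for \<open>p = q\<close> a
  combination of \<open>r\<^sup>p\<close> and \<open>r\<^sup>p ln r\<close>. These are the transforms that occur for a pair of
  monomials.\<close>

lemma exists_mellin_rational:
  fixes p q u :: real
  shows "\<exists>\<omega>. pow_bounded \<omega> \<and> mellin_on_half_plane \<omega> (\<lambda>\<zeta>. (\<zeta> + of_real u) / ((\<zeta> + of_real p) * (\<zeta> + of_real q)))"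
proof -
  have comb: "\<exists>\<omega>. pow_bounded \<omega> \<and> mellin_on_half_plane \<omega> h"
    if 1: "pow_bounded \<omega>1" "mellin_on_half_plane \<omega>1 f1" and 2: "pow_bounded \<omega>2" "mellin_on_half_plane \<omega>2 f2"
      and h: "\<And>\<zeta>. Re \<zeta> > max (- p) (- q) \<Longrightarrow> ca * f1 \<zeta> + cb * f2 \<zeta> = h \<zeta>" for \<omega>1 \<omega>2 f1 f2 ca cb h
  proof -
    \<comment> \<open>A linear combination of two terms is a sum over the two-element type.\<close>
    let ?w = "\<lambda>i::bool. if i then \<omega>1 else \<omega>2" and ?f = "\<lambda>i::bool. if i then f1 else f2" and ?c = "\<lambda>i. if i then ca else cb"
    have a: "pow_bounded (\<lambda>r. \<Sum>i\<in>UNIV. ?c i * ?w i r)" by (rule pow_bounded_sum) (use 1 2 in auto)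
    have "mellin_on_half_plane (\<lambda>r. \<Sum>i\<in>UNIV. ?c i * ?w i r) (\<lambda>\<zeta>. \<Sum>i\<in>UNIV. ?c i * ?f i \<zeta>)"
      by (rule mellin_on_half_plane_sum) (use 1 2 in auto)
    then obtain a where "\<And>\<zeta>. Re \<zeta> > a \<Longrightarrow> mellin (\<lambda>r. \<Sum>i\<in>UNIV. ?c i * ?w i r) \<zeta> = ca * f1 \<zeta> + cb * f2 \<zeta>"
      unfolding mellin_on_half_plane_def by (auto simp: UNIV_bool add.commute)
    then have "mellin_on_half_plane (\<lambda>r. \<Sum>i\<in>UNIV. ?c i * ?w i r) h"
      unfolding mellin_on_half_plane_def by (intro exI[of _ "max a (max (- p) (- q))"]) (auto simp: h)
    then show ?thesis using a by blast
  qed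
  have nz: "\<zeta> + of_real p \<noteq> 0" "\<zeta> + of_real q \<noteq> 0" if "Re \<zeta> > max (- p) (- q)" for \<zeta>
    using that by (auto simp: complex_eq_iff)
  show ?thesis
  proof (cases "p = q")
    case False
    then have pq: "complex_of_real q - of_real p \<noteq> 0" by (metis eq_iff_diff_eq_0 of_real_eq_iff)
    show ?thesis
    proof (rule comb[where ca = "of_real (u - p) / of_real (q - p)" and cb = "of_real (q - u) / of_real (q - p)",
          OF pow_bounded_powr mellin_powr pow_bounded_powr mellin_powr])
      fix \<zeta> assume "Re \<zeta> > max (- p) (- q)"
      note n = nz[OF this]
      show "of_real (u - p) / of_real (q - p) * (1 / (\<zeta> + of_real p)) + of_real (q - u) / of_real (q - p) * (1 / (\<zeta> + of_real q))
        = (\<zeta> + of_real u) / ((\<zeta> + of_real p) * (\<zeta> + of_real q))"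
        using n pq by (simp add: divide_simps) (simp add: algebra_simps)
    qed
  next
    case True
    show ?thesis
    proof (rule comb[where ca = 1 and cb = "- of_real (u - p)",
          OF pow_bounded_powr mellin_powr pow_bounded_powr_ln mellin_powr_ln])
      fix \<zeta> assume "Re \<zeta> > max (- p) (- q)"
      note n = nz[OF this]
      show "1 * (1 / (\<zeta> + of_real p)) + - of_real (u - p) * (- 1 / (\<zeta> + of_real p)^2)
        = (\<zeta> + of_real u) / ((\<zeta> + of_real p) * (\<zeta> + of_real q))"
      proof -
        have "\<zeta> + of_real u = (\<zeta> + of_real q) + of_real (u - q)" by simp
        then have "(\<zeta> + of_real u) / ((\<zeta> + of_real p) * (\<zeta> + of_real q)) =
            ((\<zeta> + of_real q) + of_real (u - q)) / ((\<zeta> + of_real q) * (\<zeta> + of_real q))"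
          using True by simp
        also have "\<dots> = 1 / (\<zeta> + of_real q) + of_real (u - q) / (\<zeta> + of_real q)^2"
          unfolding add_divide_distrib[of "\<zeta> + of_real q"] power2_eq_square using n(2) by simp
        finally have e: "(\<zeta> + of_real u) / ((\<zeta> + of_real p) * (\<zeta> + of_real q)) =
            1 / (\<zeta> + of_real q) + of_real (u - q) / (\<zeta> + of_real q)^2" .
        show ?thesis unfolding e unfolding True by (simp only: mult_1_left times_divide_eq_right minus_mult_minus mult_1_right)
      qed
    qed
  qed
qed

section \<open>Existence of the convolution of polynomials\<close>

lemma power_pow_bounded: "pow_bounded (\<lambda>r. complex_of_real r ^ n)"
  and mellin_power: "mellin_on_half_plane (\<lambda>r. complex_of_real r ^ n) (\<lambda>\<zeta>. 1 / (\<zeta> + of_nat n))"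
proof -
  have e: "complex_of_real r ^ n = complex_of_real (r powr real n)" if "r \<in> {0<..<1}" for r
    using that by (simp add: powr_realpow)
  have "(\<lambda>r. complex_of_real r ^ n) \<in> unit_borel"
    by (intro borel_measurable_power continuous_imp_measurable_on_sets_lebesgue) (auto intro!: continuous_intros)
  then show "pow_bounded (\<lambda>r. complex_of_real r ^ n)"
    using pow_bounded_powr[of "real n"] e unfolding pow_bounded_def by auto
  have "mellin (\<lambda>r. complex_of_real r ^ n) \<zeta> = mellin (\<lambda>r. complex_of_real (r powr real n)) \<zeta>" for \<zeta>
    by (rule mellin_cong) (rule e)
  then show "mellin_on_half_plane (\<lambda>r. complex_of_real r ^ n) (\<lambda>\<zeta>. 1 / (\<zeta> + of_nat n))"
    using mellin_powr[of "real n"] unfolding mellin_on_half_plane_def by simp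
qed

lemma monomial_polar: "z ^ k * cnj z ^ l = of_real (cmod z) ^ (k + l) * cis (of_int (int k - int l) * Arg z)"
proof -
  have z: "z = of_real (cmod z) * cis (Arg z)" by (metis rcis_cmod_Arg rcis_def)
  have "z ^ k * cnj z ^ l = of_real (cmod z) ^ (k + l) * (cis (Arg z) ^ k * cnj (cis (Arg z)) ^ l)"
    by (subst (1 2) z) (simp add: power_mult_distrib power_add)
  also have "cis (Arg z) ^ k * cnj (cis (Arg z)) ^ l = cis (of_int (int k - int l) * Arg z)"
    using cis_power_product[of 0 "Arg z" k l] by simp
  finally show ?thesis .
qed

lemma z_zbar_polynomial_homogeneous_parts:
  assumes "\<And>z. F z = (\<Sum>(k, l)\<in>{..d} \<times> {..d}. c k l * z ^ k * cnj z ^ l)"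
  shows "F z = (\<Sum>m\<in>{- int d..int d}. quasihom m (\<lambda>r. \<Sum>(k, l)\<in>{..d} \<times> {..d}.
     (if int k - int l = m then c k l else 0) * of_real r ^ (k + l)) z)"
proof -
  have "(\<Sum>m\<in>{- int d..int d}. quasihom m (\<lambda>r. \<Sum>(k, l)\<in>{..d} \<times> {..d}.
     (if int k - int l = m then c k l else 0) * of_real r ^ (k + l)) z)
   = (\<Sum>m\<in>{- int d..int d}. \<Sum>(k, l)\<in>{..d} \<times> {..d}. if int k - int l = m then c k l * z ^ k * cnj z ^ l else 0)"
    unfolding quasihom_def sum_distrib_right
    by (intro sum.cong refl) (auto simp: mult.assoc monomial_polar)
  also have "\<dots> = (\<Sum>(k, l)\<in>{..d} \<times> {..d}. \<Sum>m\<in>{- int d..int d}. if int k - int l = m then c k l * z ^ k * cnj z ^ l else 0)"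
    by (subst sum.swap) (simp add: case_prod_beta')
  also have "\<dots> = (\<Sum>(k, l)\<in>{..d} \<times> {..d}. c k l * z ^ k * cnj z ^ l)"
    by (intro sum.cong refl) auto
  finally show ?thesis using assms by simp
qed

text \<open>The parts of degree \<open>m\<close> and \<open>n\<close> have rational Mellin transforms that are sums of simple
  fractions. The required transform is bilinear in them, so it suffices to treat the monomials
  \<open>r\<^bsup>k + l\<^esup>\<close>, for which it is a quotient with two linear factors in the denominator.\<close>

lemma is_diamond_exists:
  assumes F: "z_zbar_polynomial F" and G: "z_zbar_polynomial G"
  shows "\<exists>k. is_diamond F G k"
proof -
  obtain d :: nat and c where "\<forall>z. F z = (\<Sum>k\<le>d. \<Sum>l\<le>d. c k l * z ^ k * cnj z ^ l)"
    using F unfolding z_zbar_polynomial_def by blast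
  then have F': "\<And>z. F z = (\<Sum>(k, l)\<in>{..d} \<times> {..d}. c k l * z ^ k * cnj z ^ l)"
    by (simp add: sum.cartesian_product)
  obtain d' :: nat and c' where "\<forall>z. G z = (\<Sum>k\<le>d'. \<Sum>l\<le>d'. c' k l * z ^ k * cnj z ^ l)"
    using G unfolding z_zbar_polynomial_def by blast
  then have G': "\<And>z. G z = (\<Sum>(k, l)\<in>{..d'} \<times> {..d'}. c' k l * z ^ k * cnj z ^ l)"
    by (simp add: sum.cartesian_product)
  define W where "W p q u = (SOME \<omega>. pow_bounded \<omega> \<and> mellin_on_half_plane \<omega> (\<lambda>\<zeta>. (\<zeta> + of_real u) / ((\<zeta> + of_real p) * (\<zeta> + of_real q))))" for p q u :: real
  have W: "pow_bounded (W p q u)" "mellin_on_half_plane (W p q u) (\<lambda>\<zeta>. (\<zeta> + of_real u) / ((\<zeta> + of_real p) * (\<zeta> + of_real q)))" for p q u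
    unfolding W_def using someI_ex[OF exists_mellin_rational[of u p q]] by auto
  let ?e = "\<lambda>ij :: (nat \<times> nat) \<times> nat \<times> nat. fst (fst ij) + snd (fst ij)"
    and ?e' = "\<lambda>ij :: (nat \<times> nat) \<times> nat \<times> nat. fst (snd ij) + snd (snd ij)"
  let ?I = "{..d} \<times> {..d}" and ?J = "{..d'} \<times> {..d'}"
  define a where "a m = (\<lambda>(k, l). if int k - int l = m then c k l else 0)" for m
  define b where "b m = (\<lambda>(k, l). if int k - int l = m then c' k l else 0)" for m
  define \<phi> where "\<phi> m r = (\<Sum>i\<in>?I. a m i * of_real r ^ (fst i + snd i))" for m and r :: real
  define \<psi> where "\<psi> m r = (\<Sum>i\<in>?J. b m i * of_real r ^ (fst i + snd i))" for m and r :: real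
  \<comment> \<open>The poles come from \<open>1 / (\<zeta> + n + k + l)\<close> and \<open>1 / (\<zeta> - m + k' + l')\<close>.\<close>
  define \<omega> where "\<omega> m n r = (\<Sum>ij\<in>?I \<times> ?J. (a m (fst ij) * b n (snd ij)) *
     W (of_int n + real (?e ij)) (real (?e' ij) - of_int m) (of_int n - of_int m) r)" for m n r
  have Fd: "F z = (\<Sum>m\<in>{- int d..int d}. quasihom m (\<phi> m) z)" for z
    using z_zbar_polynomial_homogeneous_parts[OF F', of z] by (simp add: \<phi>_def[abs_def] a_def case_prod_beta')
  have Gd: "G z = (\<Sum>m\<in>{- int d'..int d'}. quasihom m (\<psi> m) z)" for z
    using z_zbar_polynomial_homogeneous_parts[OF G', of z] by (simp add: \<psi>_def[abs_def] b_def case_prod_beta')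
  have pb: "pow_bounded (\<phi> m)" "pow_bounded (\<psi> m)" "pow_bounded (\<omega> m n)" for m n
    unfolding \<phi>_def[abs_def] \<psi>_def[abs_def] \<omega>_def[abs_def]
    by (intro pow_bounded_sum power_pow_bounded W; simp)+
  have qc: "quasihom_conv m (\<phi> m) n (\<psi> n) (\<omega> m n)" for m n
    unfolding quasihom_conv_def
  proof (intro conjI pow_bounded_nearly_integrable_disk pow_bounded_nearly_integrable pb)
    have "mellin_on_half_plane (\<phi> m) (\<lambda>\<zeta>. \<Sum>i\<in>?I. a m i * (1 / (\<zeta> + of_nat (fst i + snd i))))"
      unfolding \<phi>_def[abs_def] by (intro mellin_on_half_plane_sum power_pow_bounded mellin_power) auto
    then obtain A1 where A1: "\<And>\<zeta>. Re \<zeta> > A1 \<Longrightarrow> mellin (\<phi> m) \<zeta> = (\<Sum>i\<in>?I. a m i * (1 / (\<zeta> + of_nat (fst i + snd i))))"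
      unfolding mellin_on_half_plane_def by blast
    have "mellin_on_half_plane (\<psi> n) (\<lambda>\<zeta>. \<Sum>i\<in>?J. b n i * (1 / (\<zeta> + of_nat (fst i + snd i))))"
      unfolding \<psi>_def[abs_def] by (intro mellin_on_half_plane_sum power_pow_bounded mellin_power) auto
    then obtain A2 where A2: "\<And>\<zeta>. Re \<zeta> > A2 \<Longrightarrow> mellin (\<psi> n) \<zeta> = (\<Sum>i\<in>?J. b n i * (1 / (\<zeta> + of_nat (fst i + snd i))))"
      unfolding mellin_on_half_plane_def by blast
    let ?p = "\<lambda>ij. of_int n + real (?e ij)" and ?q = "\<lambda>ij. real (?e' ij) - of_int m"
    have "mellin_on_half_plane (\<omega> m n) (\<lambda>\<zeta>. \<Sum>ij\<in>?I \<times> ?J. (a m (fst ij) * b n (snd ij)) *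
       ((\<zeta> + of_real (of_int n - of_int m)) / ((\<zeta> + of_real (?p ij)) * (\<zeta> + of_real (?q ij)))))"
      unfolding \<omega>_def[abs_def] by (intro mellin_on_half_plane_sum W) auto
    then obtain A3 where A3: "\<And>\<zeta>. Re \<zeta> > A3 \<Longrightarrow> mellin (\<omega> m n) \<zeta> = (\<Sum>ij\<in>?I \<times> ?J. (a m (fst ij) * b n (snd ij)) *
       ((\<zeta> + of_real (of_int n - of_int m)) / ((\<zeta> + of_real (?p ij)) * (\<zeta> + of_real (?q ij)))))"
      unfolding mellin_on_half_plane_def by blast
    show "\<exists>A. \<forall>\<zeta>. A < Re \<zeta> \<longrightarrow> mellin (\<omega> m n) \<zeta> =
       (\<zeta> - of_int m + of_int n) * mellin (\<phi> m) (\<zeta> + of_int n) * mellin (\<psi> n) (\<zeta> - of_int m)"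
    proof (rule exI[of _ "max A3 (max (A1 - of_int n) (A2 + of_int m))"], intro allI impI)
      fix \<zeta> assume z: "max A3 (max (A1 - of_int n) (A2 + of_int m)) < Re \<zeta>"
      have sp: "(\<Sum>i\<in>?I. f i) * (\<Sum>j\<in>?J. g j) = (\<Sum>ij\<in>?I \<times> ?J. f (fst ij) * g (snd ij))"
        for f g :: "nat \<times> nat \<Rightarrow> complex"
        by (simp only: sum_product sum.cartesian_product case_prod_beta')
      have "(\<zeta> - of_int m + of_int n) * mellin (\<phi> m) (\<zeta> + of_int n) * mellin (\<psi> n) (\<zeta> - of_int m)
        = (\<zeta> - of_int m + of_int n) * ((\<Sum>i\<in>?I. a m i * (1 / (\<zeta> + of_int n + of_nat (fst i + snd i)))) *
          (\<Sum>j\<in>?J. b n j * (1 / (\<zeta> - of_int m + of_nat (fst j + snd j)))))"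
        using z by (subst A1, simp, subst A2, simp, simp only: mult.assoc)
      also have "\<dots> = (\<Sum>ij\<in>?I \<times> ?J. (\<zeta> - of_int m + of_int n) *
           ((a m (fst ij) * (1 / (\<zeta> + of_int n + of_nat (?e ij)))) *
          (b n (snd ij) * (1 / (\<zeta> - of_int m + of_nat (?e' ij))))))"
        by (subst sp, rule sum_distrib_left)
      also have "\<dots> = mellin (\<omega> m n) \<zeta>"
      proof (subst A3)
        show "Re \<zeta> > A3" using z by simp
        have "(\<zeta> - of_int m + of_int n) *
           ((a m (fst ij) * (1 / (\<zeta> + of_int n + of_nat (?e ij)))) *
          (b n (snd ij) * (1 / (\<zeta> - of_int m + of_nat (?e' ij))))) =
         (a m (fst ij) * b n (snd ij)) *
       ((\<zeta> + of_real (of_int n - of_int m)) / ((\<zeta> + of_real (?p ij)) * (\<zeta> + of_real (?q ij))))" for ij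
        proof -
          have 1: "\<zeta> + of_real (?p ij) = \<zeta> + of_int n + of_nat (?e ij)" by simp
          have 2: "\<zeta> + of_real (?q ij) = \<zeta> - of_int m + of_nat (?e' ij)" by simp
          have 3: "\<zeta> + of_real (of_int n - of_int m) = \<zeta> - of_int m + of_int n" by simp
          show ?thesis unfolding 1 2 3
            by (simp only: divide_inverse inverse_mult_distrib mult_1_left mult_ac)
        qed
        then show "(\<Sum>ij\<in>?I \<times> ?J. (\<zeta> - of_int m + of_int n) *
           ((a m (fst ij) * (1 / (\<zeta> + of_int n + of_nat (?e ij)))) *
          (b n (snd ij) * (1 / (\<zeta> - of_int m + of_nat (?e' ij)))))) =
          (\<Sum>ij\<in>?I \<times> ?J. (a m (fst ij) * b n (snd ij)) *
       ((\<zeta> + of_real (of_int n - of_int m)) / ((\<zeta> + of_real (?p ij)) * (\<zeta> + of_real (?q ij)))))"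
          by (intro sum.cong refl)
      qed
      finally show "mellin (\<omega> m n) \<zeta> =
       (\<zeta> - of_int m + of_int n) * mellin (\<phi> m) (\<zeta> + of_int n) * mellin (\<psi> n) (\<zeta> - of_int m)" ..
    qed
  qed
  show ?thesis unfolding is_diamond_def
    apply (rule exI[of _ "\<lambda>z. \<Sum>m\<in>{- int d..int d}. \<Sum>n\<in>{- int d'..int d'}. quasihom (m + n) (\<omega> m n) z"])
    apply (rule exI[of _ "{- int d..int d}"], rule exI[of _ "{- int d'..int d'}"], rule exI[of _ \<phi>], rule exI[of _ \<psi>], rule exI[of _ \<omega>])
    using Fd Gd qc pb pow_bounded_nearly_integrable_disk by auto
qed

lemma is_diamond_diamond:
  assumes "z_zbar_polynomial F" "z_zbar_polynomial G"
  shows "is_diamond F G (F \<diamondop> G)"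
  unfolding diamond_def using is_diamond_exists[OF assms] by (rule someI_ex)

section \<open>Moments of a convolution\<close>

lemma moment_sum:
  assumes "\<And>i. i \<in> I \<Longrightarrow> integrable area_measure (\<lambda>z. f i z * z ^ p * cnj z ^ q)"
  shows "moment (\<lambda>z. \<Sum>i\<in>I. f i z) p q = (\<Sum>i\<in>I. moment (f i) p q)"
  unfolding moment_def sum_distrib_right
  by (rule Bochner_Integration.integral_sum) (rule assms)

lemma AE_eq_measurable_area:
  fixes f g :: "complex \<Rightarrow> complex"
  assumes ae: "AE z in area_measure. f z = g z" and g: "g \<in> area_borel"
  shows "f \<in> area_borel"
proof -
  let ?f = "\<lambda>z. if z \<in> unit_disk then f z else 0" and ?g = "\<lambda>z. if z \<in> unit_disk then g z else 0"
  have "?g \<in> borel_measurable lebesgue"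
    using g borel_measurable_if_lebesgue_on[of unit_disk UNIV g] by (simp add: lebesgue_on_UNIV_eq borel_measurable_area)
  moreover have "AE z in lebesgue. z \<in> unit_disk \<longrightarrow> f z = g z"
    using ae unfolding AE_area_iff by (subst (asm) AE_restrict_space_iff) auto
  then have "AE z in lebesgue. ?g z = ?f z" by eventually_elim auto
  ultimately have "?f \<in> borel_measurable lebesgue" by (rule borel_measurable_AE)
  then show ?thesis
    using borel_measurable_if_lebesgue_on[of unit_disk UNIV f] by (simp add: lebesgue_on_UNIV_eq borel_measurable_area)
qed

lemma weighted_integrable_mono:
  assumes i: "weighted_integrable \<alpha> f" and "\<alpha> \<le> \<beta>"
  shows "weighted_integrable \<beta> f"
proof (rule Bochner_Integration.integrable_bound[OF i])
  have "(\<lambda>z. complex_of_real (cmod z powr \<beta>)) \<in> area_borel" by measurable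
  then show "(\<lambda>z. complex_of_real (cmod z powr \<beta>) * f z) \<in> area_borel"
    using weighted_integrable_measurable[OF i] by (rule borel_measurable_times)
  have le: "cmod z powr \<beta> \<le> cmod z powr \<alpha>" if "z \<in> unit_disk" for z :: complex
    using that assms(2) by (cases "z = 0") (auto intro!: powr_mono')
  show "AE z in area_measure. cmod (complex_of_real (cmod z powr \<beta>) * f z) \<le> cmod (complex_of_real (cmod z powr \<alpha>) * f z)"
    by (intro AE_I2) (auto simp: norm_mult intro!: mult_right_mono le)
qed

text \<open>Integrability improves when the weight exponent grows, so the maximum works.\<close>

lemma nearly_integrable_disk_common_exponent:
  assumes "finite I" "\<And>i. i \<in> I \<Longrightarrow> nearly_integrable_disk (f i)"
  shows "\<exists>\<alpha>>0. \<forall>i\<in>I. weighted_integrable \<alpha> (f i)"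
  using assms
proof (induction I)
  case empty then show ?case by (intro exI[of _ 1]) auto
next
  case (insert i I)
  then obtain \<alpha> where \<alpha>: "\<alpha> > 0" "\<forall>i\<in>I. weighted_integrable \<alpha> (f i)" by auto
  obtain \<beta> where \<beta>: "\<beta> > 0" "weighted_integrable \<beta> (f i)"
    using insert.prems[of i] unfolding nearly_integrable_disk_def by auto
  show ?case
    by (rule exI[of _ "max \<alpha> \<beta>"]) (use \<alpha> \<beta> in \<open>auto intro: weighted_integrable_mono\<close>)
qed

text \<open>The degrees are given by a function on the index set because in a convolution different pairs of
  degrees may have the same sum.\<close>

lemma moment_quasihom_sum:
  assumes fin: "finite M" and ae: "AE z in area_measure. f z = (\<Sum>m\<in>M. quasihom (d m) (\<phi> m) z)"
    and "\<alpha> > 0"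
    and i: "\<And>m. m \<in> M \<Longrightarrow> weighted_integrable \<alpha> (quasihom (d m) (\<phi> m))"
  shows "weighted_integrable \<alpha> f"
    and "\<alpha> \<le> real (p + q) \<Longrightarrow> moment f p q = (\<Sum>m\<in>M. if int p + d m = int q then 2 * mellin (\<phi> m) (of_nat (p + q + 2)) else 0)"
proof -
  let ?s = "\<lambda>z. \<Sum>m\<in>M. quasihom (d m) (\<phi> m) z"
  have sm: "?s \<in> area_borel"
    using i by (intro borel_measurable_sum weighted_integrable_measurable)
  have fm: "f \<in> area_borel" by (rule AE_eq_measurable_area[OF ae sm])
  have w: "(\<lambda>z. complex_of_real (cmod z powr \<alpha>)) \<in> area_borel" by measurable
  have "weighted_integrable \<alpha> ?s"
    unfolding sum_distrib_left using i by (rule Bochner_Integration.integrable_sum)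
  then show "weighted_integrable \<alpha> f"
    by (rule integrable_cong_AE_imp) (use ae in \<open>auto intro!: borel_measurable_times w fm\<close>)
  assume pq: "\<alpha> \<le> real (p + q)"
  have pw: "(\<lambda>z. z ^ p) \<in> area_borel" "(\<lambda>z. cnj z ^ q) \<in> area_borel"
    by (rule continuous_measurable_area, intro continuous_intros)+
  have "moment f p q = moment ?s p q" unfolding moment_def
    by (rule Bochner_Integration.integral_cong_AE) (use ae in \<open>auto intro!: borel_measurable_times pw fm sm\<close>)
  also have "\<dots> = (\<Sum>m\<in>M. moment (quasihom (d m) (\<phi> m)) p q)"
    by (rule moment_sum) (rule moment_integrable[OF \<open>\<alpha> > 0\<close> i pq])
  also have "\<dots> = (\<Sum>m\<in>M. if int p + d m = int q then 2 * mellin (\<phi> m) (of_nat (p + q + 2)) else 0)"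
    by (intro sum.cong refl moment_quasihom[OF \<open>\<alpha> > 0\<close> i pq])
  finally show "moment f p q = (\<Sum>m\<in>M. if int p + d m = int q then 2 * mellin (\<phi> m) (of_nat (p + q + 2)) else 0)" .
qed

lemma sum_shift_collapse:
  fixes h :: "nat \<Rightarrow> complex"
  assumes "0 \<le> int p + n" "int p + n \<le> int L"
  shows "(\<Sum>l\<le>L. if int p + n = int l then h l else 0) = h (nat (int p + n))"
proof -
  have "(\<Sum>l\<le>L. if int p + n = int l then h l else 0) = (\<Sum>l\<le>L. if l = nat (int p + n) then h l else 0)"
    by (intro sum.cong refl) (use assms in auto)
  also have "\<dots> = h (nat (int p + n))" using assms by simp
  finally show ?thesis .
qed

text \<open>The moments of a convolution are those of a product of operators. Only \<open>l = p + n = q - m\<close>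
  contributes for a given pair of degrees. There the factor \<open>\<zeta> - m + n\<close> of the defining identity at
  \<open>\<zeta> = p + q + 2\<close> equals \<open>2 (l + 1)\<close>, and its two arguments \<open>\<zeta> + n\<close> and \<open>\<zeta> - m\<close> are
  \<open>l + q + 2\<close> and \<open>p + l + 2\<close>, those of the moments of \<open>f\<close> and \<open>g\<close>. The cut-off
  \<open>p + c\<close> is arbitrary beyond the range of the degrees \<open>n\<close>. The index \<open>q\<close> is unrestricted, which the
  finite rank conclusion needs.\<close>

lemma is_diamond_moments:
  assumes "is_diamond f g k"
  shows "\<exists>\<alpha>>0. weighted_integrable \<alpha> k"
    and "\<exists>P c0. \<forall>p\<ge>P. \<forall>q. \<forall>c\<ge>c0. moment k p q = (\<Sum>l\<le>p + c. of_nat (l + 1) * moment g p l * moment f l q)"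
proof -
  obtain M N \<phi> \<psi> \<omega> where fin: "finite M" "finite N"
    and f: "AE z in area_measure. f z = (\<Sum>m\<in>M. quasihom m (\<phi> m) z)"
    and g: "AE z in area_measure. g z = (\<Sum>n\<in>N. quasihom n (\<psi> n) z)"
    and nf: "\<forall>m\<in>M. nearly_integrable_disk (quasihom m (\<phi> m))"
    and ng: "\<forall>n\<in>N. nearly_integrable_disk (quasihom n (\<psi> n))"
    and qc: "\<forall>m\<in>M. \<forall>n\<in>N. quasihom_conv m (\<phi> m) n (\<psi> n) (\<omega> m n)"
    and k0: "AE z in area_measure. k z = (\<Sum>m\<in>M. \<Sum>n\<in>N. quasihom (m + n) (\<omega> m n) z)"
    using assms unfolding is_diamond_def by (elim exE conjE) (rule that; assumption)
  have k: "AE z in area_measure. k z = (\<Sum>mn\<in>M \<times> N. quasihom (fst mn + snd mn) (\<omega> (fst mn) (snd mn)) z)"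
    using k0 by (simp add: sum.cartesian_product case_prod_beta')
  have nk: "nearly_integrable_disk (quasihom (fst mn + snd mn) (\<omega> (fst mn) (snd mn)))" if "mn \<in> M \<times> N" for mn
  proof -
    have "nearly_integrable_interval (\<omega> (fst mn) (snd mn))" using qc that unfolding quasihom_conv_def by auto
    then show ?thesis using weighted_integrable_quasihom
      unfolding nearly_integrable_interval_def nearly_integrable_disk_def by blast
  qed
  obtain \<alpha>f where \<alpha>f: "\<alpha>f > 0" "\<And>m. m \<in> M \<Longrightarrow> weighted_integrable \<alpha>f (quasihom m (\<phi> m))"
    using nearly_integrable_disk_common_exponent[OF fin(1), of "\<lambda>m. quasihom m (\<phi> m)"] nf by blast
  obtain \<alpha>g where \<alpha>g: "\<alpha>g > 0" "\<And>m. m \<in> N \<Longrightarrow> weighted_integrable \<alpha>g (quasihom m (\<psi> m))"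
    using nearly_integrable_disk_common_exponent[OF fin(2), of "\<lambda>m. quasihom m (\<psi> m)"] ng by blast
  obtain \<alpha>k where \<alpha>k: "\<alpha>k > 0" "\<And>mn. mn \<in> M \<times> N \<Longrightarrow> weighted_integrable \<alpha>k (quasihom (fst mn + snd mn) (\<omega> (fst mn) (snd mn)))"
    using nearly_integrable_disk_common_exponent[OF finite_cartesian_product[OF fin], of "\<lambda>mn. quasihom (fst mn + snd mn) (\<omega> (fst mn) (snd mn))"] nk by blast
  show "\<exists>\<alpha>>0. weighted_integrable \<alpha> k"
    using moment_quasihom_sum(1)[OF finite_cartesian_product[OF fin] k \<alpha>k] \<alpha>k(1) by blast
  have "\<forall>mn\<in>M \<times> N. \<exists>a. \<forall>\<zeta>. Re \<zeta> > a \<longrightarrow> mellin (\<omega> (fst mn) (snd mn)) \<zeta> =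
     (\<zeta> - of_int (fst mn) + of_int (snd mn)) * mellin (\<phi> (fst mn)) (\<zeta> + of_int (snd mn)) * mellin (\<psi> (snd mn)) (\<zeta> - of_int (fst mn))"
    using qc unfolding quasihom_conv_def by auto
  then obtain a where a: "\<And>mn \<zeta>. mn \<in> M \<times> N \<Longrightarrow> Re \<zeta> > a mn \<Longrightarrow> mellin (\<omega> (fst mn) (snd mn)) \<zeta> =
     (\<zeta> - of_int (fst mn) + of_int (snd mn)) * mellin (\<phi> (fst mn)) (\<zeta> + of_int (snd mn)) * mellin (\<psi> (snd mn)) (\<zeta> - of_int (fst mn))"
    by metis
  define A where "A = (\<Sum>mn\<in>M \<times> N. \<bar>a mn\<bar>)"
  have A: "a mn \<le> A" if "mn \<in> M \<times> N" for mn
  proof -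
    have "a mn \<le> \<bar>a mn\<bar>" by simp
    also have "\<dots> \<le> A" unfolding A_def using that fin by (intro member_le_sum) auto
    finally show ?thesis .
  qed
  \<comment> \<open>A common bound for the degrees \<open>n\<close>.\<close>
  define c0 where "c0 = nat (\<Sum>n\<in>N. \<bar>n\<bar>)"
  have c0: "\<bar>n\<bar> \<le> int c0" if "n \<in> N" for n
  proof -
    have "\<bar>n\<bar> \<le> (\<Sum>n\<in>N. \<bar>n\<bar>)" using that fin by (intro member_le_sum) auto
    then show ?thesis by (simp add: c0_def)
  qed
  \<comment> \<open>Beyond \<open>P\<close> all moments involved converge, the Mellin identity applies, and \<open>p + n\<close> is a natural number.\<close>
  define P where "P = nat \<lceil>\<alpha>f\<rceil> + nat \<lceil>\<alpha>g\<rceil> + nat \<lceil>\<alpha>k\<rceil> + nat \<lceil>A\<rceil> + c0"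
  have Pge: "\<alpha>f \<le> real p - real c0" "\<alpha>g \<le> real p" "\<alpha>k \<le> real p" "A \<le> real p" if "p \<ge> P" for p
    using that unfolding P_def by linarith+
  have "moment k p q = (\<Sum>l\<le>p + c. of_nat (l + 1) * moment g p l * moment f l q)"
    if p: "p \<ge> P" and c: "c \<ge> c0" for p q c
  proof -
    have k': "moment k p q = (\<Sum>mn\<in>M \<times> N. if int p + (fst mn + snd mn) = int q then 2 * mellin (\<omega> (fst mn) (snd mn)) (of_nat (p + q + 2)) else 0)"
      by (rule moment_quasihom_sum(2)[OF finite_cartesian_product[OF fin] k \<alpha>k]) (use Pge[OF p] in auto)
    have g': "moment g p l = (\<Sum>n\<in>N. if int p + n = int l then 2 * mellin (\<psi> n) (of_nat (p + l + 2)) else 0)" for l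
      by (rule moment_quasihom_sum(2)[OF fin(2) g \<alpha>g]) (use Pge[OF p] in auto)
    have f': "moment f l q = (\<Sum>m\<in>M. if int l + m = int q then 2 * mellin (\<phi> m) (of_nat (l + q + 2)) else 0)"
      if "int l \<ge> int p - int c0" for l
    proof (rule moment_quasihom_sum(2)[OF fin(1) f \<alpha>f])
      have "real l \<ge> real p - real c0" using that by linarith
      then show "\<alpha>f \<le> real (l + q)" using Pge[OF p] by simp
    qed
    define T where "T m n l = of_nat (l + 1) * (2 * mellin (\<psi> n) (of_nat (p + l + 2))) *
        (if int l + m = int q then 2 * mellin (\<phi> m) (of_nat (l + q + 2)) else 0)" for m n l
    have "of_nat (l + 1) * moment g p l * moment f l q = (\<Sum>mn\<in>M \<times> N. if int p + snd mn = int l then T (fst mn) (snd mn) l else 0)" for l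
    proof (cases "int l \<ge> int p - int c0")
      case True
      have "moment g p l * moment f l q =
        (\<Sum>m\<in>M. \<Sum>n\<in>N. (if int p + n = int l then 2 * mellin (\<psi> n) (of_nat (p + l + 2)) else 0) *
           (if int l + m = int q then 2 * mellin (\<phi> m) (of_nat (l + q + 2)) else 0))"
        unfolding g' f'[OF True] sum_product by (rule sum.swap)
      then have "of_nat (l + 1) * moment g p l * moment f l q =
        (\<Sum>m\<in>M. \<Sum>n\<in>N. of_nat (l + 1) * ((if int p + n = int l then 2 * mellin (\<psi> n) (of_nat (p + l + 2)) else 0) *
           (if int l + m = int q then 2 * mellin (\<phi> m) (of_nat (l + q + 2)) else 0)))"
        by (simp only: mult.assoc sum_distrib_left)
      also have "\<dots> = (\<Sum>m\<in>M. \<Sum>n\<in>N. if int p + n = int l then T m n l else 0)"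
        by (intro sum.cong refl) (simp add: T_def)
      finally show ?thesis by (simp add: sum.cartesian_product case_prod_beta')
    next
      case False
      have "int p + n \<noteq> int l" if "n \<in> N" for n using c0[OF that] False by linarith
      then show ?thesis unfolding g' by (auto intro!: sum.neutral)
    qed
    then have "(\<Sum>l\<le>p + c. of_nat (l + 1) * moment g p l * moment f l q) =
       (\<Sum>l\<le>p + c. \<Sum>mn\<in>M \<times> N. if int p + snd mn = int l then T (fst mn) (snd mn) l else 0)"
      by (intro sum.cong refl)
    also have "\<dots> = (\<Sum>mn\<in>M \<times> N. \<Sum>l\<le>p + c. if int p + snd mn = int l then T (fst mn) (snd mn) l else 0)"
      by (rule sum.swap)
    also have "\<dots> = (\<Sum>mn\<in>M \<times> N. T (fst mn) (snd mn) (nat (int p + snd mn)))"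
    proof (intro sum.cong refl sum_shift_collapse)
      fix mn assume "mn \<in> M \<times> N"
      then have "\<bar>snd mn\<bar> \<le> int c0" using c0 by auto
      then show "0 \<le> int p + snd mn" "int p + snd mn \<le> int (p + c)" using p c unfolding P_def by linarith+
    qed
    also have "\<dots> = moment k p q" unfolding k'
    proof (intro sum.cong refl)
      fix mn assume mn: "mn \<in> M \<times> N"
      obtain m n where [simp]: "mn = (m, n)" by (cases mn)
      define l where "l = nat (int p + n)"
      have "\<bar>n\<bar> \<le> int c0" using c0 mn by auto
      then have l: "int l = int p + n" unfolding l_def using p unfolding P_def by linarith
      show "T (fst mn) (snd mn) (nat (int p + snd mn)) = (if int p + (fst mn + snd mn) = int q then 2 * mellin (\<omega> (fst mn) (snd mn)) (of_nat (p + q + 2)) else 0)"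
      proof (cases "int p + (m + n) = int q")
        case True
        then have q: "int l + m = int q" using l by simp
        have lc: "complex_of_int n = of_nat l - of_nat p" using l by (metis add_diff_cancel_left' of_int_diff of_int_of_nat_eq)
        have mc: "complex_of_int m = of_nat q - of_nat l" using q by (metis add_diff_cancel_left' of_int_diff of_int_of_nat_eq)
        have "A \<le> real p" using Pge[OF p] by simp
        then have "Re (of_nat (p + q + 2)) > a mn" using A[OF mn] by simp
        from a[OF mn this] have "mellin (\<omega> m n) (of_nat (p + q + 2)) = (of_nat (p + q + 2) - of_int m + of_int n)
            * mellin (\<phi> m) (of_nat (p + q + 2) + of_int n) * mellin (\<psi> n) (of_nat (p + q + 2) - of_int m)" by simp
        also have "of_nat (p + q + 2) - of_int m + of_int n = (2 * of_nat (l + 1) :: complex)" by (simp add: lc mc)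
        also have "of_nat (p + q + 2) + of_int n = (of_nat (l + q + 2) :: complex)" by (simp add: lc)
        also have "of_nat (p + q + 2) - of_int m = (of_nat (p + l + 2) :: complex)" by (simp add: mc)
        finally have "2 * mellin (\<omega> m n) (of_nat (p + q + 2)) = of_nat (l + 1) * (2 * mellin (\<psi> n) (of_nat (p + l + 2))) *
           (2 * mellin (\<phi> m) (of_nat (l + q + 2)))" by (simp only: mult_ac)
        then show ?thesis using True q by (simp add: T_def l_def[symmetric])
      next
        case False
        then have "int l + m \<noteq> int q" using l by simp
        then show ?thesis using False by (simp add: T_def l_def[symmetric])
      qed
    qed
    finally show ?thesis ..
  qed
  then show "\<exists>P c0. \<forall>p\<ge>P. \<forall>q. \<forall>c\<ge>c0. moment k p q = (\<Sum>l\<le>p + c. of_nat (l + 1) * moment g p l * moment f l q)"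
    by blast
qed

section \<open>Uniqueness in the moment problem\<close>

lemma bounded_mult_integrable:
  fixes v h :: "complex \<Rightarrow> complex"
  assumes v: "integrable area_measure v" and h: "h \<in> area_borel" and b: "\<And>z. z \<in> unit_disk \<Longrightarrow> cmod (h z) \<le> C"
  shows "integrable area_measure (\<lambda>z. h z * v z)"
proof (rule Bochner_Integration.integrable_bound)
  show "integrable area_measure (\<lambda>z. complex_of_real C * v z)" using v by simp
  show "(\<lambda>z. h z * v z) \<in> area_borel" using v h by auto
  have "cmod (h z * v z) \<le> cmod (complex_of_real C * v z)" if "z \<in> unit_disk" for z
    unfolding norm_mult using b[OF that] by (intro mult_right_mono) auto
  then show "AE z in area_measure. cmod (h z * v z) \<le> cmod (complex_of_real C * v z)" by (intro AE_I2) simp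
qed

lemma monomial_integrable:
  assumes "integrable area_measure v"
  shows "integrable area_measure (\<lambda>z. v z * z ^ p * cnj z ^ q)"
proof -
  have "integrable area_measure (\<lambda>z. (z ^ p * cnj z ^ q) * v z)"
    by (rule bounded_mult_integrable[OF assms continuous_measurable_area, where C=1])
      (auto intro!: continuous_intros simp: norm_mult norm_power mult_le_one power_le_one)
  then show ?thesis by (simp add: mult_ac)
qed

lemma continuous_bounded_on_disk:
  fixes f :: "complex \<Rightarrow> 'b :: real_normed_vector"
  assumes "continuous_on UNIV f"
  shows "\<exists>C. \<forall>z\<in>unit_disk. norm (f z) \<le> C"
proof -
  have "bounded (f ` cball 0 1)"
    by (intro compact_imp_bounded compact_continuous_image continuous_on_subset[OF assms]) auto
  then obtain C where "\<forall>x\<in>f ` cball 0 1. norm x \<le> C" unfolding bounded_iff by blast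
  then show ?thesis by (intro exI[of _ C]) auto
qed

definition zero_moments :: "(complex \<Rightarrow> complex) \<Rightarrow> bool" where
  "zero_moments v \<longleftrightarrow> integrable area_measure v \<and> (\<forall>p q. moment v p q = 0)"

lemma zero_moments_add: "zero_moments v \<Longrightarrow> zero_moments w \<Longrightarrow> zero_moments (\<lambda>z. v z + w z)"
  unfolding zero_moments_def moment_def
  by (simp add: distrib_right Bochner_Integration.integral_add monomial_integrable)

lemma zero_moments_cmult: "zero_moments v \<Longrightarrow> zero_moments (\<lambda>z. c * v z)"
  unfolding zero_moments_def moment_def by (simp add: mult.assoc)

lemma zero_moments_shift:
  assumes "zero_moments v"
  shows "zero_moments (\<lambda>z. z * v z)" "zero_moments (\<lambda>z. cnj z * v z)"
proof -
  have i: "integrable area_measure v" and 0: "moment v p q = 0" for p q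
    using assms unfolding zero_moments_def by auto
  have "moment (\<lambda>z. z * v z) p q = moment v (Suc p) q" "moment (\<lambda>z. cnj z * v z) p q = moment v p (Suc q)" for p q
    unfolding moment_def by (simp_all add: mult_ac)
  then show "zero_moments (\<lambda>z. z * v z)" "zero_moments (\<lambda>z. cnj z * v z)"
    using 0 monomial_integrable[OF i, of 1 0] monomial_integrable[OF i, of 0 1]
    unfolding zero_moments_def by (auto simp: mult_ac)
qed

text \<open>Vanishing moments are preserved by multiplication with \<open>z\<close> and with \<open>cnj z\<close>, hence with
  every polynomial in the real coordinates, since a real-linear form is \<open>a z + b cnj z\<close>.\<close>

lemma zero_moments_polynomial_mult:
  assumes "real_polynomial_function g" "zero_moments v"
  shows "zero_moments (\<lambda>z. complex_of_real (g z) * v z)"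
  using assms
proof (induction arbitrary: v rule: real_polynomial_function.induct)
  case (linear h)
  define a where "a = (of_real (h 1) - \<i> * of_real (h \<i>)) / 2"
  define b where "b = (of_real (h 1) + \<i> * of_real (h \<i>)) / 2"
  have "complex_of_real (h z) = a * z + b * cnj z" for z
  proof -
    have "z = Re z *\<^sub>R 1 + Im z *\<^sub>R \<i>" by (simp add: complex_eq_iff)
    then have "h z = h (Re z *\<^sub>R 1 + Im z *\<^sub>R \<i>)" by (rule arg_cong)
    also have "\<dots> = Re z * h 1 + Im z * h \<i>"
      using linear.hyps by (simp add: linear_simps)
    finally show ?thesis by (simp add: a_def b_def complex_eq_iff field_simps)
  qed
  then have "(\<lambda>z. complex_of_real (h z) * v z) = (\<lambda>z. a * (z * v z) + b * (cnj z * v z))"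
    by (simp add: algebra_simps)
  then show ?case using linear.prems by (auto intro!: zero_moments_add zero_moments_cmult zero_moments_shift)
next
  case (const c)
  then show ?case by (rule zero_moments_cmult)
next
  case (add f g)
  have "(\<lambda>z. complex_of_real (f z + g z) * v z) = (\<lambda>z. complex_of_real (f z) * v z + complex_of_real (g z) * v z)"
    by (simp add: algebra_simps)
  then show ?case using add by (auto intro!: zero_moments_add)
next
  case (mult f g)
  have "(\<lambda>z. complex_of_real (f z * g z) * v z) = (\<lambda>z. complex_of_real (f z) * (complex_of_real (g z) * v z))"
    by (simp add: algebra_simps)
  then show ?case using mult by auto
qed

text \<open>Stone--Weierstrass: polynomials approximate \<open>\<phi>\<close> uniformly on the closed disk, and
  \<open>v\<close> is integrable.\<close>

lemma zero_moments_continuous_real: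
  fixes \<phi> :: "complex \<Rightarrow> real"
  assumes Z: "zero_moments v" and \<phi>: "continuous_on UNIV \<phi>"
  shows "(LINT z|area_measure. complex_of_real (\<phi> z) * v z) = 0"
proof -
  have iv: "integrable area_measure v" using Z by (simp add: zero_moments_def)
  obtain C where C: "\<forall>z\<in>unit_disk. norm (\<phi> z) \<le> C" using continuous_bounded_on_disk[OF \<phi>] by blast
  have i\<phi>: "integrable area_measure (\<lambda>z. complex_of_real (\<phi> z) * v z)"
    by (rule bounded_mult_integrable[OF iv continuous_measurable_area, where C=C])
      (use C in \<open>auto intro!: continuous_intros \<phi>\<close>)
  let ?I = "LINT z|area_measure. complex_of_real (\<phi> z) * v z" and ?K = "LINT z|area_measure. cmod (v z)"
  have K: "?K \<ge> 0" by simp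
  have "cmod ?I \<le> e" if "e > 0" for e
  proof -
    define d where "d = e / (?K + 1)"
    have K1: "?K + 1 > 0" using K by linarith
    have d0: "d > 0" unfolding d_def by (rule divide_pos_pos[OF that K1])
    have "d * ?K \<le> d * (?K + 1)" using d0 by (intro mult_left_mono) auto
    also have "\<dots> = e" unfolding d_def by (rule nonzero_eq_divide_eq[THEN iffD1, OF _ refl]) (use K1 in linarith)
    finally have d: "d > 0" "d * ?K \<le> e" using d0 by auto
    obtain g where g: "real_polynomial_function g" "\<And>x. x \<in> cball 0 1 \<Longrightarrow> \<bar>\<phi> x - g x\<bar> < d"
      using Stone_Weierstrass_real_polynomial_function[OF compact_cball continuous_on_subset[OF \<phi>] d(1), of 0 1] by blast
    have "zero_moments (\<lambda>z. complex_of_real (g z) * v z)" by (rule zero_moments_polynomial_mult[OF g(1) Z])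
    then have ig: "integrable area_measure (\<lambda>z. complex_of_real (g z) * v z)"
      and "moment (\<lambda>z. complex_of_real (g z) * v z) 0 0 = 0" unfolding zero_moments_def by auto
    then have "?I = (LINT z|area_measure. complex_of_real (\<phi> z) * v z - complex_of_real (g z) * v z)"
      using i\<phi> by (simp add: moment_def)
    also have "cmod \<dots> \<le> (LINT z|area_measure. d * cmod (v z))"
    proof (rule order_trans[OF integral_norm_bound integral_mono_AE])
      have "cmod (complex_of_real (\<phi> z) * v z - complex_of_real (g z) * v z) \<le> d * cmod (v z)" if "z \<in> unit_disk" for z
      proof -
        have "complex_of_real (\<phi> z) * v z - complex_of_real (g z) * v z = complex_of_real (\<phi> z - g z) * v z"
          by (simp add: algebra_simps)
        then show ?thesis using g(2)[of z] that by (simp add: norm_mult mult_right_mono del: of_real_diff)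
      qed
      then show "AE z in area_measure. cmod (complex_of_real (\<phi> z) * v z - complex_of_real (g z) * v z) \<le> d * cmod (v z)"
        by (intro AE_I2) simp
    qed (use ig i\<phi> iv in auto)
    also have "\<dots> = d * ?K" by simp
    finally show ?thesis using d by simp
  qed
  then have "cmod ?I \<le> 0" by (metis field_le_epsilon add_0)
  then show ?thesis by simp
qed

lemma zero_moments_continuous:
  assumes Z: "zero_moments v" and h: "continuous_on UNIV h"
  shows "(LINT z|area_measure. h z * v z) = 0"
proof -
  have iv: "integrable area_measure v" using Z by (simp add: zero_moments_def)
  have c: "continuous_on UNIV (\<lambda>z. Re (h z))" "continuous_on UNIV (\<lambda>z. Im (h z))"
    using h by (auto intro: continuous_intros)
  have i: "integrable area_measure (\<lambda>z. complex_of_real (f z) * v z)" if fc: "continuous_on UNIV f" for f :: "complex \<Rightarrow> real"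
  proof -
    obtain C where "\<forall>z\<in>unit_disk. norm (f z) \<le> C" using continuous_bounded_on_disk[OF fc] by blast
    then show ?thesis by (intro bounded_mult_integrable[OF iv continuous_measurable_area, where C=C])
      (auto intro!: continuous_intros fc)
  qed
  have "(LINT z|area_measure. h z * v z) =
     (LINT z|area_measure. complex_of_real (Re (h z)) * v z + \<i> * (complex_of_real (Im (h z)) * v z))"
    by (rule Bochner_Integration.integral_cong) (auto simp: complex_eq_iff)
  also have "\<dots> = 0"
    using i[OF c(1)] i[OF c(2)] zero_moments_continuous_real[OF Z c(1)] zero_moments_continuous_real[OF Z c(2)] by simp
  finally show ?thesis .
qed

text \<open>Testing \<open>u\<close> against the conjugate of its sign would give the integral of \<open>|u|\<close>. The sign is
  an almost everywhere limit of continuous functions, which may be truncated to modulus at most one,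
  and dominated convergence carries the vanishing over from continuous test functions.\<close>

lemma zero_moments_AE_zero:
  assumes Z: "zero_moments u"
  shows "AE z in area_measure. u z = 0"
proof -
  have iu: "integrable area_measure u" using Z by (simp add: zero_moments_def)
  let ?s = "\<lambda>z. cnj (sgn (u z))"
  have "u \<in> borel_measurable (lebesgue_on unit_disk)" using iu by (auto simp: borel_measurable_area[symmetric])
  then have "?s \<in> borel_measurable (lebesgue_on unit_disk)"
    by (intro borel_measurable_continuous_on[where f=cnj]) (auto intro!: continuous_intros)
  then have "?s measurable_on unit_disk" by (subst measurable_on_iff_borel_measurable) auto
  then obtain N h where N: "negligible N" and h: "\<And>n. continuous_on UNIV (h n)"
    and lim: "\<And>z. z \<notin> N \<Longrightarrow> (\<lambda>n. h n z) \<longlonglongrightarrow> (if z \<in> unit_disk then ?s z else 0)"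
    unfolding measurable_on_def by blast
  \<comment> \<open>The truncation is a retraction onto the closed unit disk, so it fixes the limit.\<close>
  define k where "k n z = h n z / of_real (max 1 (cmod (h n z)))" for n :: nat and z
  have kc: "continuous_on UNIV (k n)" for n
    unfolding k_def by (intro continuous_intros h) (auto simp: max_def)
  have kb: "cmod (k n z) \<le> 1" for n z
    unfolding k_def by (simp add: norm_divide divide_le_eq max_def)
  have klim: "(\<lambda>n. k n z * u z) \<longlonglongrightarrow> ?s z * u z" if "z \<notin> N" "z \<in> unit_disk" for z
  proof -
    have l: "(\<lambda>n. h n z) \<longlonglongrightarrow> ?s z" using lim[OF that(1)] that(2) by simp
    have "cmod (?s z) \<le> 1" by (simp add: norm_sgn)
    then have m: "complex_of_real (max 1 (cmod (?s z))) = 1" by (simp add: max_def)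
    have "(\<lambda>n. k n z) \<longlonglongrightarrow> ?s z / of_real (max 1 (cmod (?s z)))"
      unfolding k_def by (intro tendsto_intros l) (simp add: m)
    then show ?thesis unfolding m by (intro tendsto_intros) simp
  qed
  have aeN: "AE z in area_measure. z \<notin> N"
    using N by (intro AE_area_of_lebesgue) (simp add: AE_not_in negligible_iff_null_sets)
  have sm: "?s \<in> area_borel"
    using \<open>?s \<in> borel_measurable (lebesgue_on unit_disk)\<close> by (simp add: borel_measurable_area)
  have "(\<lambda>n. LINT z|area_measure. k n z * u z) \<longlonglongrightarrow> (LINT z|area_measure. ?s z * u z)"
  proof (rule integral_dominated_convergence[where w="\<lambda>z. cmod (u z)"])
    show "(\<lambda>z. ?s z * u z) \<in> area_borel" using sm iu by auto
    show "(\<lambda>z. k n z * u z) \<in> area_borel" for n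
      using continuous_measurable_area[OF kc] iu by auto
    show "integrable area_measure (\<lambda>z. cmod (u z))" using iu by simp
    show "AE z in area_measure. (\<lambda>n. k n z * u z) \<longlonglongrightarrow> ?s z * u z"
      using aeN AE_space by eventually_elim (use klim in simp)
    show "AE z in area_measure. cmod (k n z * u z) \<le> cmod (u z)" for n
      by (intro AE_I2) (simp add: norm_mult mult_left_le_one_le kb)
  qed
  then have "(LINT z|area_measure. ?s z * u z) = 0"
    using zero_moments_continuous[OF Z kc] by (simp add: LIMSEQ_const_iff)
  moreover have e: "?s z * u z = complex_of_real (cmod (u z))" for z
    by (simp add: sgn_eq complex_norm_square[symmetric] power2_eq_square mult.commute)
  ultimately have "complex_of_real (LINT z|area_measure. cmod (u z)) = 0"
    by (simp only: e integral_complex_of_real)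
  then have "(LINT z|area_measure. cmod (u z)) = 0" by simp
  then have "AE z in area_measure. cmod (u z) = 0"
    using iu by (subst (asm) integral_nonneg_eq_0_iff_AE) auto
  then show ?thesis by simp
qed

section \<open>Oscillatory integrals in the mean\<close>

lemma power_average_tendsto_0:
  fixes x :: complex
  assumes x: "cmod x = 1" "x \<noteq> 1"
  shows "(\<lambda>T. (\<Sum>n<T. x ^ n) / of_nat T) \<longlonglongrightarrow> 0"
proof (rule Lim_null_comparison)
  show "eventually (\<lambda>T. cmod ((\<Sum>n<T. x ^ n) / of_nat T) \<le> (2 / cmod (x - 1)) * inverse (real T)) sequentially"
  proof (rule always_eventually, rule allI)
    fix T
    have "cmod (\<Sum>n<T. x ^ n) = cmod (x ^ T - 1) / cmod (x - 1)"
      using x by (simp add: geometric_sum norm_divide)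
    also have "\<dots> \<le> 2 / cmod (x - 1)"
      using norm_triangle_ineq4[of "x ^ T" 1] x by (intro divide_right_mono) (auto simp: norm_power)
    finally have "cmod (\<Sum>n<T. x ^ n) * inverse (real T) \<le> (2 / cmod (x - 1)) * inverse (real T)"
      by (intro mult_right_mono) auto
    moreover have "cmod ((\<Sum>n<T. x ^ n) / of_nat T) = cmod (\<Sum>n<T. x ^ n) * inverse (real T)"
      by (simp only: divide_inverse norm_mult norm_inverse norm_of_nat)
    ultimately show "cmod ((\<Sum>n<T. x ^ n) / of_nat T) \<le> (2 / cmod (x - 1)) * inverse (real T)"
      by (rule ord_eq_le_trans[rotated])
  qed
  show "(\<lambda>T. (2 / cmod (x - 1)) * inverse (real T)) \<longlonglongrightarrow> 0"
    by (rule tendsto_mult_right_zero) (rule lim_inverse_n)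
qed

text \<open>The unimodular kernel \<open>exp (s z) * cnj (exp (- s z))\<close> at \<open>s = 1\<close>. On the unit disk
  \<open>2 * Im z\<close> ranges over an interval of length \<open>4 < 2 \<pi>\<close>, so its values determine
  \<open>Im z\<close>.\<close>

definition osc :: "complex \<Rightarrow> complex" where "osc z = cis (2 * Im z)"

lemma norm_osc [simp]: "cmod (osc z) = 1" by (simp add: osc_def)

lemma osc_measurable: "osc \<in> area_borel"
  unfolding osc_def[abs_def] by (rule continuous_measurable_area) (intro continuous_intros)

lemma osc_eq:
  assumes "z \<in> unit_disk" "w \<in> unit_disk" "osc w * cnj (osc z) = 1"
  shows "Im w = Im z"
proof -
  have "cis (2 * (Im w - Im z)) = 1" using assms(3) by (simp add: osc_def cis_cnj cis_mult algebra_simps)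
  then have c: "cos (2 * (Im w - Im z)) = 1" by (simp add: complex_eq_iff)
  then obtain n :: int where n: "2 * (Im w - Im z) = of_int n * 2 * pi" using cos_one_2pi_int by blast
  have "\<bar>Im w\<bar> < 1" "\<bar>Im z\<bar> < 1" using assms abs_Im_le_cmod[of w] abs_Im_le_cmod[of z] by auto
  then have "\<bar>Im w - Im z\<bar> < 2" by linarith
  then have "\<bar>of_int n * pi\<bar> < 2" using n by (simp add: algebra_simps)
  then have "\<bar>real_of_int n\<bar> * pi < 2" by (simp add: abs_mult)
  then have "\<bar>real_of_int n\<bar> * pi < 1 * pi" using pi_gt3 by linarith
  then have "\<bar>real_of_int n\<bar> < 1" using mult_less_cancel_right_pos[OF pi_gt_zero] by blast
  then have "n = 0" by linarith
  then show ?thesis using n by simp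
qed

lemma AE_Im_neq: "AE w in area_measure. Im w \<noteq> y"
proof -
  have "negligible {w :: complex. \<i> \<bullet> w = y}" by (rule negligible_hyperplane) simp
  then have "{w :: complex. Im w = y} \<in> null_sets lebesgue" by (simp add: negligible_iff_null_sets)
  then have "AE w in lebesgue. w \<notin> {w :: complex. Im w = y}" by (rule AE_not_in)
  then show ?thesis using AE_area_of_lebesgue by simp
qed

text \<open>A Riemann--Lebesgue lemma in the mean, in the spirit of Wiener's theorem on the atoms of a
  measure. With the coefficients \<open>c n\<close>, the average of \<open>|c n|\<^sup>2\<close> is the integral of \<open>Q T * v\<close>.
  The value \<open>Q T z\<close> is itself an integral over \<open>w\<close> of geometric averages of
  \<open>osc z * cnj (osc w)\<close>, which tend to zero unless \<open>Im w = Im z\<close>, a null set of \<open>w\<close>. Two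
  applications of dominated convergence finish the argument.\<close>

lemma osc_average:
  assumes v: "integrable area_measure v"
  shows "(\<lambda>T. (\<Sum>n<T. (cmod (LINT z|area_measure. osc z ^ n * v z))\<^sup>2) / real T) \<longlonglongrightarrow> 0"
proof -
  let ?k = "\<lambda>T z w. (\<Sum>n<T. (osc z * cnj (osc w)) ^ n) / of_nat T :: complex"
  define c where "c n = (LINT z|area_measure. osc z ^ n * v z)" for n :: nat
  define Q where "Q T z = (\<Sum>n<T. osc z ^ n * cnj (c n)) / of_nat T" for T :: nat and z
  have oi: "integrable area_measure (\<lambda>w. osc w ^ n * v w)" for n
    by (rule bounded_mult_integrable[OF v borel_measurable_power[OF osc_measurable], where C=1]) (simp add: norm_power)
  have vc: "integrable area_measure (\<lambda>w. cnj (v w))" using v by simp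
  have Qm: "Q T \<in> area_borel" for T
    unfolding Q_def[abs_def]
    by (intro borel_measurable_divide borel_measurable_sum borel_measurable_times borel_measurable_power osc_measurable) auto
  have Qv: "(LINT z|area_measure. Q T z * v z) = complex_of_real ((\<Sum>n<T. (cmod (c n))\<^sup>2) / real T)" for T
  proof -
    have "(LINT z|area_measure. Q T z * v z) = (LINT z|area_measure. (\<Sum>n<T. cnj (c n) / of_nat T * (osc z ^ n * v z)))"
      unfolding Q_def sum_divide_distrib sum_distrib_right
      by (intro Bochner_Integration.integral_cong sum.cong refl) (simp add: mult_ac)
    also have "\<dots> = (\<Sum>n<T. cnj (c n) / of_nat T * c n)"
      unfolding c_def by (subst Bochner_Integration.integral_sum) (auto intro!: oi integrable_mult_right)
    also have "\<dots> = (\<Sum>n<T. complex_of_real ((cmod (c n))\<^sup>2 / real T))"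
      unfolding of_real_divide of_real_of_nat_eq complex_norm_square by (simp add: mult.commute)
    also have "\<dots> = complex_of_real ((\<Sum>n<T. (cmod (c n))\<^sup>2) / real T)" by (simp add: sum_divide_distrib)
    finally show ?thesis .
  qed
  have Qint: "Q T z = (LINT w|area_measure. (?k T z w) * cnj (v w))" for T z
  proof -
    have "(LINT w|area_measure. (?k T z w) * cnj (v w)) =
       (LINT w|area_measure. (\<Sum>n<T. (osc z ^ n / of_nat T) * cnj (osc w ^ n * v w)))"
      unfolding sum_divide_distrib sum_distrib_right
      by (intro Bochner_Integration.integral_cong sum.cong refl) (simp add: power_mult_distrib mult_ac)
    also have "\<dots> = (\<Sum>n<T. (osc z ^ n / of_nat T) * cnj (c n))"
      unfolding c_def using oi
      by (subst Bochner_Integration.integral_sum) (auto simp flip: integral_cnj simp del: complex_cnj_mult complex_cnj_power)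
    also have "\<dots> = Q T z" unfolding Q_def by (simp add: sum_divide_distrib)
    finally show ?thesis ..
  qed
  have kb: "cmod (?k T z w) \<le> 1" for T z w
  proof -
    have "cmod (\<Sum>n<T. (osc z * cnj (osc w)) ^ n) \<le> (\<Sum>n<T. 1)"
      by (rule order_trans[OF norm_sum sum_mono]) (simp add: norm_power norm_mult)
    then show ?thesis by (simp add: norm_divide divide_le_eq)
  qed
  have Qlim: "(\<lambda>T. Q T z) \<longlonglongrightarrow> 0" if z: "z \<in> unit_disk" for z
  proof -
    have "(\<lambda>T. LINT w|area_measure. (?k T z w) * cnj (v w)) \<longlonglongrightarrow> (LINT w|area_measure. 0)"
    proof (rule integral_dominated_convergence[where w="\<lambda>w. cmod (v w)"])
      show "integrable area_measure (\<lambda>w. cmod (v w))" using v by simp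
      show "(\<lambda>w. (?k T z w) * cnj (v w)) \<in> area_borel" for T
        using vc by (intro borel_measurable_times borel_measurable_divide borel_measurable_sum borel_measurable_power
            borel_measurable_continuous_on[OF _ osc_measurable, of cnj] borel_measurable_integrable) (auto intro!: continuous_intros)
      have lim0: "(\<lambda>T. (?k T z w) * cnj (v w)) \<longlonglongrightarrow> 0"
        if "w \<in> unit_disk" "Im w \<noteq> Im z" for w
      proof (rule tendsto_mult_left_zero[OF power_average_tendsto_0])
        show "osc z * cnj (osc w) \<noteq> 1" using osc_eq[OF that(1) z] that by metis
      qed (simp add: norm_mult)
      show "AE w in area_measure. (\<lambda>T. (?k T z w) * cnj (v w)) \<longlonglongrightarrow> 0"
        using AE_Im_neq[of "Im z"] AE_space[of area_measure] by eventually_elim (rule lim0, auto)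
      show "AE w in area_measure. cmod ((?k T z w) * cnj (v w)) \<le> cmod (v w)" for T
      proof (intro AE_I2)
        fix w
        show "cmod ((?k T z w) * cnj (v w)) \<le> cmod (v w)"
          unfolding norm_mult complex_mod_cnj by (intro mult_left_le_one_le kb) auto
      qed
    qed simp
    then show ?thesis unfolding Qint by simp
  qed
  let ?K = "LINT w|area_measure. cmod (v w)"
  have Qb: "cmod (Q T z) \<le> ?K" for T z
    unfolding Qint
  proof (rule order_trans[OF integral_norm_bound integral_mono_AE'])
    show "integrable area_measure (\<lambda>w. cmod (v w))" using v by simp
    show "AE w in area_measure. cmod ((?k T z w) * cnj (v w)) \<le> cmod (v w)"
    proof (intro AE_I2)
      fix w
      show "cmod ((?k T z w) * cnj (v w)) \<le> cmod (v w)"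
        unfolding norm_mult complex_mod_cnj by (intro mult_left_le_one_le kb) auto
    qed
  qed auto
  have "(\<lambda>T. LINT z|area_measure. Q T z * v z) \<longlonglongrightarrow> (LINT z|area_measure. 0)"
  proof (rule integral_dominated_convergence[where w="\<lambda>z. ?K * cmod (v z)"])
    show "integrable area_measure (\<lambda>z. ?K * cmod (v z))" using v by simp
    show "(\<lambda>z. Q T z * v z) \<in> area_borel" for T using Qm v by auto
    show "AE z in area_measure. (\<lambda>T. Q T z * v z) \<longlonglongrightarrow> 0"
      by (intro AE_I2 tendsto_mult_left_zero Qlim) simp
    show "AE z in area_measure. cmod (Q T z * v z) \<le> ?K * cmod (v z)" for T
      by (intro AE_I2) (simp add: norm_mult mult_right_mono Qb)
  qed simp
  then have "(\<lambda>T. complex_of_real ((\<Sum>n<T. (cmod (c n))\<^sup>2) / real T)) \<longlonglongrightarrow> of_real 0" unfolding Qv by simp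
  then show ?thesis unfolding tendsto_of_real_iff c_def .
qed

text \<open>Otherwise the sum over \<open>S\<close> of the squared coefficients, and with it its averages, would stay
  above \<open>e\<^sup>2\<close>.\<close>

lemma osc_simultaneously_small:
  assumes fin: "finite S" and v: "\<And>i. i \<in> S \<Longrightarrow> integrable area_measure (v i)" and "e > 0"
  shows "\<exists>n. \<forall>i\<in>S. cmod (LINT z|area_measure. osc z ^ n * v i z) < e"
proof (rule ccontr)
  assume neg: "\<not> ?thesis"
  let ?c = "\<lambda>i n. cmod (LINT z|area_measure. osc z ^ n * v i z)"
  have ge: "e\<^sup>2 \<le> (\<Sum>i\<in>S. (?c i n)\<^sup>2)" for n
  proof -
    obtain i where i: "i \<in> S" "\<not> ?c i n < e" using neg by blast
    have "e\<^sup>2 \<le> (?c i n)\<^sup>2" using i \<open>e > 0\<close> by (intro power_mono) auto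
    also have "\<dots> \<le> (\<Sum>i\<in>S. (?c i n)\<^sup>2)" by (rule member_le_sum[OF i(1)]) (auto simp: fin)
    finally show ?thesis .
  qed
  have "(\<lambda>T. \<Sum>i\<in>S. (\<Sum>n<T. (?c i n)\<^sup>2) / real T) \<longlonglongrightarrow> (\<Sum>i\<in>S. 0)"
    by (intro tendsto_sum osc_average v)
  then have lim: "(\<lambda>T. \<Sum>i\<in>S. (\<Sum>n<T. (?c i n)\<^sup>2) / real T) \<longlonglongrightarrow> 0" by simp
  have "e\<^sup>2 \<le> (\<Sum>i\<in>S. (\<Sum>n<T. (?c i n)\<^sup>2) / real T)" if "T > 0" for T
  proof -
    have "real T * e\<^sup>2 = (\<Sum>n<T. e\<^sup>2)" by simp
    also have "\<dots> \<le> (\<Sum>n<T. \<Sum>i\<in>S. (?c i n)\<^sup>2)" by (intro sum_mono ge)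
    also have "\<dots> = (\<Sum>i\<in>S. \<Sum>n<T. (?c i n)\<^sup>2)" by (rule sum.swap)
    finally show ?thesis using that by (simp add: sum_divide_distrib[symmetric] field_simps)
  qed
  then have "e\<^sup>2 \<le> 0"
    by (intro LIMSEQ_le_const[OF lim]) (auto intro!: exI[of _ 1])
  then show False using \<open>e > 0\<close> by simp
qed

section \<open>Determinants of functions of two indices\<close>

text \<open>The size of the matrices is found in the course of a proof, so they are represented by functions on
  pairs of natural numbers, of which only the leading \<open>n \<times> n\<close> block matters.\<close>

definition index_det :: "nat \<Rightarrow> (nat \<Rightarrow> nat \<Rightarrow> complex) \<Rightarrow> complex" where
  "index_det n A = Determinant.det (Matrix.mat n n (\<lambda>(i, j). A i j))"

lemma index_det_permutations: "index_det n A = (\<Sum>p | p permutes {0..<n}. signof p * (\<Prod>i=0..<n. A i (p i)))"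
proof -
  have "index_det n A = (\<Sum>p | p permutes {0..<n}. signof p * (\<Prod>i=0..<n. Matrix.mat n n (\<lambda>(i, j). A i j) $$ (i, p i)))"
    unfolding index_det_def by (subst det_def'[of _ n]) auto
  also have "\<dots> = (\<Sum>p | p permutes {0..<n}. signof p * (\<Prod>i=0..<n. A i (p i)))"
    by (intro sum.cong arg_cong2[where f="(*)"] prod.cong refl) (auto simp: permutes_in_image[of _ "{0..<n}", simplified])
  finally show ?thesis .
qed

lemma index_det_cong: "(\<And>i j. i < n \<Longrightarrow> j < n \<Longrightarrow> A i j = B i j) \<Longrightarrow> index_det n A = index_det n B"
  unfolding index_det_def by (intro arg_cong[where f=Determinant.det] eq_matI) auto

lemma index_det_0: "index_det 0 A = 1"
  by (simp add: index_det_permutations)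

lemma index_det_mult: "index_det n (\<lambda>i j. \<Sum>k<n. A i k * B k j) = index_det n A * index_det n B"
proof -
  have "Matrix.mat n n (\<lambda>(i, j). \<Sum>k<n. A i k * B k j) = Matrix.mat n n (\<lambda>(i, j). A i j) * Matrix.mat n n (\<lambda>(i, j). B i j)"
    by (rule eq_matI) (auto simp: scalar_prod_def atLeast0LessThan)
  then show ?thesis unfolding index_det_def by (simp add: det_mult[of _ n])
qed

lemma index_det_eq_0_iff:
  "index_det n A = 0 \<longleftrightarrow> (\<exists>w. (\<exists>i<n. w i \<noteq> 0) \<and> (\<forall>j<n. (\<Sum>i<n. w i * A i j) = 0))"
proof -
  let ?A = "Matrix.mat n n (\<lambda>(i, j). A i j)"
  have "index_det n A = 0 \<longleftrightarrow> Determinant.det (transpose_mat ?A) = 0"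
    unfolding index_det_def by (subst det_transpose[of ?A n]) auto
  also have "\<dots> \<longleftrightarrow> (\<exists>v. v \<in> carrier_vec n \<and> v \<noteq> 0\<^sub>v n \<and> transpose_mat ?A *\<^sub>v v = 0\<^sub>v n)"
    by (rule det_0_iff_vec_prod_zero) auto
  also have "\<dots> \<longleftrightarrow> (\<exists>w. (\<exists>i<n. w i \<noteq> 0) \<and> (\<forall>j<n. (\<Sum>i<n. w i * A i j) = 0))"
  proof
    assume "\<exists>v. v \<in> carrier_vec n \<and> v \<noteq> 0\<^sub>v n \<and> transpose_mat ?A *\<^sub>v v = 0\<^sub>v n"
    then obtain v where v: "v \<in> carrier_vec n" "v \<noteq> 0\<^sub>v n" "transpose_mat ?A *\<^sub>v v = 0\<^sub>v n" by blast
    have "\<exists>i<n. vec_index v i \<noteq> 0"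
    proof (rule ccontr)
      assume "\<not> ?thesis"
      then have "v = 0\<^sub>v n" using v(1) by (intro eq_vecI) auto
      then show False using v(2) by simp
    qed
    moreover have "(\<Sum>i<n. vec_index v i * A i j) = 0" if "j < n" for j
    proof -
      have "0 = vec_index (transpose_mat ?A *\<^sub>v v) j" using v(3) that by simp
      also have "\<dots> = (\<Sum>i<n. A i j * vec_index v i)"
        using that v(1) by (simp add: scalar_prod_def atLeast0LessThan)
      finally show ?thesis by (simp add: mult.commute)
    qed
    ultimately show "\<exists>w. (\<exists>i<n. w i \<noteq> 0) \<and> (\<forall>j<n. (\<Sum>i<n. w i * A i j) = 0)" by blast
  next
    assume "\<exists>w. (\<exists>i<n. w i \<noteq> 0) \<and> (\<forall>j<n. (\<Sum>i<n. w i * A i j) = 0)"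
    then obtain w i where w: "i < n" "w i \<noteq> 0" "\<forall>j<n. (\<Sum>i<n. w i * A i j) = 0" by blast
    show "\<exists>v. v \<in> carrier_vec n \<and> v \<noteq> 0\<^sub>v n \<and> transpose_mat ?A *\<^sub>v v = 0\<^sub>v n"
    proof (intro exI[of _ "Matrix.vec n w"] conjI)
      show "Matrix.vec n w \<noteq> 0\<^sub>v n"
      proof
        assume "Matrix.vec n w = 0\<^sub>v n"
        then have "vec_index (Matrix.vec n w) i = vec_index (0\<^sub>v n) i" by simp
        then show False using w by simp
      qed
      show "transpose_mat ?A *\<^sub>v Matrix.vec n w = 0\<^sub>v n"
        by (rule eq_vecI) (use w(3) in \<open>auto simp: scalar_prod_def atLeast0LessThan mult.commute\<close>)
    qed simp
  qed
  finally show ?thesis .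
qed

lemma index_det_inverse:
  assumes "index_det n A \<noteq> 0"
  shows "\<exists>B. (\<forall>i<n. \<forall>j<n. (\<Sum>k<n. A i k * B k j) = (if i = j then 1 else 0)) \<and> index_det n A * index_det n B = 1"
proof -
  let ?A = "Matrix.mat n n (\<lambda>(i, j). A i j)"
  define B where "B i j = adj_mat ?A $$ (i, j) / index_det n A" for i j
  have adj: "adj_mat ?A \<in> carrier_mat n n" "?A * adj_mat ?A = Determinant.det ?A \<cdot>\<^sub>m 1\<^sub>m n"
    using adj_mat[of ?A n] by auto
  have id: "(\<Sum>k<n. A i k * B k j) = (if i = j then 1 else 0)" if ij: "i < n" "j < n" for i j
  proof -
    have "(?A * adj_mat ?A) $$ (i, j) = (\<Sum>k<n. A i k * adj_mat ?A $$ (k, j))"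
      using ij adj(1) by (simp add: scalar_prod_def atLeast0LessThan)
    moreover have "(?A * adj_mat ?A) $$ (i, j) = (if i = j then index_det n A else 0)"
      unfolding adj(2) index_det_def using ij by simp
    ultimately have "(\<Sum>k<n. A i k * adj_mat ?A $$ (k, j)) = (if i = j then index_det n A else 0)" by simp
    moreover have "(\<Sum>k<n. A i k * B k j) = (\<Sum>k<n. A i k * adj_mat ?A $$ (k, j)) / index_det n A"
      by (simp add: B_def sum_divide_distrib)
    ultimately show ?thesis using assms by simp
  qed
  have "index_det n A * index_det n B = index_det n (\<lambda>i j. if i = j then 1 else 0)"
    unfolding index_det_mult[symmetric] by (rule index_det_cong) (rule id)
  also have "\<dots> = Determinant.det (1\<^sub>m n)"
    unfolding index_det_def by (intro arg_cong[where f=Determinant.det] eq_matI) auto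
  finally have "index_det n A * index_det n B = 1" by simp
  then show ?thesis using id by (intro exI[of _ B]) simp
qed

lemma norm_index_det_le:
  assumes "\<And>i j. i < n \<Longrightarrow> j < n \<Longrightarrow> cmod (A i j) \<le> K"
  shows "cmod (index_det n A) \<le> fact n * K ^ n"
proof -
  have "cmod (index_det n A) \<le> (\<Sum>p | p permutes {0..<n}. K ^ n)"
    unfolding index_det_permutations
  proof (rule order_trans[OF norm_sum sum_mono])
    fix p assume "p \<in> {p. p permutes {0..<n}}"
    then have p: "p i < n" if "i < n" for i using that permutes_in_image[of p "{0..<n}" i] by auto
    have "cmod (signof p :: complex) = 1" by (simp add: sign_def)
    then have "cmod (signof p * (\<Prod>i=0..<n. A i (p i))) = (\<Prod>i=0..<n. cmod (A i (p i)))"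
      by (simp add: norm_mult prod_norm)
    also have "\<dots> \<le> (\<Prod>i=0..<n. K)" using p assms by (intro prod_mono) auto
    finally show "cmod (signof p * (\<Prod>i=0..<n. A i (p i))) \<le> K ^ n" by simp
  qed
  also have "\<dots> = fact n * K ^ n" using card_permutations[of "{0..<n}" n] by simp
  finally show ?thesis .
qed

lemma holomorphic_index_det:
  assumes "\<And>i j. i < n \<Longrightarrow> j < n \<Longrightarrow> (\<lambda>s. A s i j) holomorphic_on S"
  shows "(\<lambda>s. index_det n (A s)) holomorphic_on S"
  unfolding index_det_permutations
proof (intro holomorphic_on_sum holomorphic_on_mult holomorphic_on_const holomorphic_on_prod)
  fix p i assume "p \<in> {p. p permutes {0..<n}}" "i \<in> {0..<n}"
  then have "p i < n" "i < n" using permutes_in_image[of p "{0..<n}" i] by auto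
  then show "(\<lambda>s. A s i (p i)) holomorphic_on S" using assms by blast
qed

lemma cnj_index_det: "cnj (index_det n A) = index_det n (\<lambda>i j. cnj (A i j))"
proof -
  have "cnj (signof p) = signof p" for p :: "nat \<Rightarrow> nat" by (simp add: sign_def)
  then show ?thesis unfolding index_det_permutations by simp
qed

section \<open>Moment matrices of finite rank\<close>

text \<open>A matrix of finite rank is recovered from the rows and the columns that meet in an invertible
  submatrix of maximal size. The assumption bounds the size of nonzero minors. Bordering a maximal
  one by row \<open>k\<close> and column \<open>l\<close> gives a singular matrix, and a linear relation between its rows
  involves the new row, which expresses \<open>a k l\<close> through the others.\<close>

lemma skeleton_decomposition:
  fixes a :: "nat \<Rightarrow> nat \<Rightarrow> complex"
  assumes dep: "\<And>I :: nat \<Rightarrow> nat. \<exists>\<beta>. (\<exists>i<n. \<beta> i \<noteq> 0) \<and> (\<forall>l. (\<Sum>i<n. \<beta> i * a (I i) l) = 0)"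
  shows "\<exists>r I J B. index_det r (\<lambda>i j. a (I i) (J j)) \<noteq> 0 \<and> index_det r (\<lambda>i j. a (I i) (J j)) * index_det r B = 1 \<and>
    (\<forall>k l. a k l = (\<Sum>j<r. \<Sum>i<r. a k (J j) * B j i * a (I i) l))"
proof -
  let ?R = "{r. \<exists>I J. index_det r (\<lambda>i j. a (I i) (J j)) \<noteq> 0}"
  have "r < n" if "r \<in> ?R" for r
  proof (rule ccontr)
    assume "\<not> r < n"
    then have le: "n \<le> r" by simp
    obtain I J where IJ: "index_det r (\<lambda>i j. a (I i) (J j)) \<noteq> 0" using \<open>r \<in> ?R\<close> by blast
    obtain \<beta> where b: "\<exists>i<n. \<beta> i \<noteq> 0" "\<forall>l. (\<Sum>i<n. \<beta> i * a (I i) l) = 0" using dep[of I] by blast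
    let ?w = "\<lambda>i. if i < n then \<beta> i else 0"
    have "(\<Sum>i<r. ?w i * a (I i) l) = (\<Sum>i<n. \<beta> i * a (I i) l)" for l
      by (rule sum.mono_neutral_cong_right) (use le in auto)
    then have "\<exists>w. (\<exists>i<r. w i \<noteq> 0) \<and> (\<forall>j<r. (\<Sum>i<r. w i * a (I i) (J j)) = 0)"
      using b le by (intro exI[of _ ?w]) (auto intro: less_le_trans)
    then show False using IJ index_det_eq_0_iff[of r "\<lambda>i j. a (I i) (J j)"] by blast
  qed
  then have "?R \<subseteq> {..<n}" by auto
  then have finR: "finite ?R" by (rule finite_subset) simp
  have "0 \<in> ?R" by (simp add: index_det_0)
  define r where "r = Max ?R"
  have rR: "r \<in> ?R" unfolding r_def using finR \<open>0 \<in> ?R\<close> by (intro Max_in) auto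
  then obtain I J where IJ: "index_det r (\<lambda>i j. a (I i) (J j)) \<noteq> 0" by blast
  obtain B where B: "\<And>i j. i < r \<Longrightarrow> j < r \<Longrightarrow> (\<Sum>k<r. a (I i) (J k) * B k j) = (if i = j then 1 else 0)"
    "index_det r (\<lambda>i j. a (I i) (J j)) * index_det r B = 1" using index_det_inverse[OF IJ] by blast
  have "a k l = (\<Sum>j<r. \<Sum>i<r. a k (J j) * B j i * a (I i) l)" for k l
  proof -
    let ?I = "I(r := k)" and ?J = "J(r := l)"
    have "Suc r \<notin> ?R" using Max_ge[OF finR, of "Suc r"] unfolding r_def[symmetric] by auto
    then have "index_det (Suc r) (\<lambda>i j. a (?I i) (?J j)) = 0" by blast
    then obtain w where w: "\<exists>i<Suc r. w i \<noteq> 0" "\<forall>j<Suc r. (\<Sum>i<Suc r. w i * a (?I i) (?J j)) = 0"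
      unfolding index_det_eq_0_iff by blast
    have cj: "(\<Sum>i<r. w i * a (I i) (J j)) + w r * a k (J j) = 0" if "j < r" for j
      using w(2)[rule_format, of j] that by simp
    have cl: "(\<Sum>i<r. w i * a (I i) l) + w r * a k l = 0"
      using w(2)[rule_format, of r] by simp
    \<comment> \<open>Otherwise the relation would be one between the rows of the invertible submatrix.\<close>
    have wr: "w r \<noteq> 0"
    proof
      assume "w r = 0"
      then have "\<exists>w. (\<exists>i<r. w i \<noteq> 0) \<and> (\<forall>j<r. (\<Sum>i<r. w i * a (I i) (J j)) = 0)"
        using w(1) cj by (intro exI[of _ w]) (auto simp: less_Suc_eq)
      then show False using IJ index_det_eq_0_iff[of r "\<lambda>i j. a (I i) (J j)"] by blast
    qed
    let ?x = "\<lambda>j. \<Sum>i<r. B j i * a (I i) l"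
    have Ax: "(\<Sum>j<r. a (I i) (J j) * ?x j) = a (I i) l" if "i < r" for i
    proof -
      have "(\<Sum>j<r. a (I i) (J j) * ?x j) = (\<Sum>j<r. \<Sum>m<r. a (I i) (J j) * B j m * a (I m) l)"
        by (simp add: sum_distrib_left mult.assoc)
      also have "\<dots> = (\<Sum>m<r. \<Sum>j<r. a (I i) (J j) * B j m * a (I m) l)" by (rule sum.swap)
      also have "\<dots> = (\<Sum>m<r. (if i = m then 1 else 0) * a (I m) l)"
        using B(1)[OF that] by (simp add: sum_distrib_right[symmetric])
      also have "\<dots> = a (I i) l" using that by (simp add: if_distrib[where f="\<lambda>x. x * _"] cong: if_cong)
      finally show ?thesis .
    qed
    have "w r * (\<Sum>j<r. a k (J j) * ?x j) = (\<Sum>j<r. (w r * a k (J j)) * ?x j)"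
      by (simp add: sum_distrib_left mult.assoc)
    also have "\<dots> = (\<Sum>j<r. - (\<Sum>i<r. w i * a (I i) (J j)) * ?x j)"
      using cj by (intro sum.cong refl arg_cong2[where f="(*)"]) (auto simp: eq_neg_iff_add_eq_0 add.commute)
    also have "\<dots> = - (\<Sum>j<r. \<Sum>i<r. w i * (a (I i) (J j) * ?x j))"
      by (simp add: sum_negf sum_distrib_right mult.assoc)
    also have "(\<Sum>j<r. \<Sum>i<r. w i * (a (I i) (J j) * ?x j)) = (\<Sum>i<r. \<Sum>j<r. w i * (a (I i) (J j) * ?x j))"
      by (rule sum.swap)
    also have "\<dots> = (\<Sum>i<r. w i * a (I i) l)"
      using Ax by (simp add: sum_distrib_left[symmetric])
    also have "- \<dots> = w r * a k l" by (rule minus_unique[OF cl])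
    finally have "(\<Sum>j<r. a k (J j) * ?x j) = a k l" using wr by simp
    then show ?thesis by (simp add: sum_distrib_left mult.assoc)
  qed
  then show ?thesis using IJ B(2) by blast
qed

lemma dominated_series_integral:
  fixes f :: "nat \<Rightarrow> complex \<Rightarrow> complex" and v :: "complex \<Rightarrow> complex"
  assumes v: "integrable area_measure v" and fi: "\<And>n. integrable area_measure (f n)"
    and le: "\<And>n z. z \<in> unit_disk \<Longrightarrow> cmod (f n z) \<le> cmod (v z) * c n" and c: "summable c"
  shows "(\<lambda>n. LINT z|area_measure. f n z) sums (LINT z|area_measure. (\<Sum>n. f n z))"
proof (rule sums_integral[OF fi])
  show "AE z in area_measure. summable (\<lambda>n. norm (f n z))"
    by (intro AE_I2 summable_comparison_test'[OF summable_mult[OF c]]) (use le in simp)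
  show "summable (\<lambda>n. LINT z|area_measure. norm (f n z))"
  proof (rule summable_comparison_test'[OF summable_mult[OF c]])
    fix n
    have "(LINT z|area_measure. norm (f n z)) \<le> (LINT z|area_measure. cmod (v z) * c n)"
      by (rule integral_mono_AE) (use fi v le in \<open>auto intro!: AE_I2 integrable_norm integrable_mult_left\<close>)
    then show "norm (LINT z|area_measure. norm (f n z)) \<le> (LINT z|area_measure. cmod (v z)) * c n"
      by simp
  qed
qed

text \<open>Termwise integration of the exponential series; the series of integrals of absolute values
  converges because \<open>h\<close> is bounded by one.\<close>

lemma exp_moment_sums:
  assumes v: "integrable area_measure v" and h: "continuous_on UNIV h" and hb: "\<And>z. z \<in> unit_disk \<Longrightarrow> cmod (h z) \<le> 1"
  shows "(\<lambda>n. s ^ n / fact n * (LINT z|area_measure. v z * h z ^ n)) sums (LINT z|area_measure. v z * exp (s * h z))"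
proof -
  let ?f = "\<lambda>n z. v z * ((s * h z) ^ n / fact n)"
  have hm: "h \<in> area_borel" by (rule continuous_measurable_area[OF h])
  have fi: "integrable area_measure (?f n)" for n
  proof -
    have "integrable area_measure (\<lambda>z. ((s * h z) ^ n / fact n) * v z)"
    proof (rule bounded_mult_integrable[OF v])
      show "(\<lambda>z. (s * h z) ^ n / fact n) \<in> area_borel" using hm by measurable
      fix z :: complex assume "z \<in> unit_disk"
      then have "cmod s ^ n * cmod (h z) ^ n \<le> cmod s ^ n * 1" using hb by (intro mult_left_mono power_le_one) auto
      then show "cmod ((s * h z) ^ n / fact n) \<le> cmod s ^ n / fact n"
        by (simp add: norm_divide norm_power norm_mult power_mult_distrib divide_right_mono)
    qed
    then show ?thesis by (simp add: mult.commute)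
  qed
  have nle: "cmod (?f n z) \<le> cmod (v z) * (cmod s ^ n / fact n)" if "z \<in> unit_disk" for n z
  proof -
    have "cmod s ^ n * cmod (h z) ^ n \<le> cmod s ^ n * 1" using hb[OF that] by (intro mult_left_mono power_le_one) auto
    then show ?thesis
      by (simp add: norm_divide norm_power norm_mult power_mult_distrib divide_right_mono mult_left_mono)
  qed
  have sm: "summable (\<lambda>n. cmod s ^ n / fact n)"
    using summable_exp[of "cmod s"] by (simp add: divide_inverse mult.commute)
  have e: "(\<Sum>n. ?f n z) = v z * exp (s * h z)" for z
    using exp_converges[of "s * h z"]
    by (intro sums_unique[symmetric] sums_mult) (simp add: scaleR_conv_of_real divide_inverse mult.commute)
  have "(\<lambda>n. LINT z|area_measure. ?f n z) sums (LINT z|area_measure. (\<Sum>n. ?f n z))"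
    by (rule dominated_series_integral[OF v fi nle sm])
  also have "(\<lambda>n. LINT z|area_measure. ?f n z) = (\<lambda>n. s ^ n / fact n * (LINT z|area_measure. v z * h z ^ n))"
    by (simp add: power_mult_distrib flip: integral_mult_right_zero) (simp add: mult_ac)
  finally show ?thesis by (simp only: e)
qed

lemma entire_of_sums:
  assumes "\<And>s. (\<lambda>n. c n * s ^ n) sums f s"
  shows "f holomorphic_on UNIV"
proof -
  have "f holomorphic_on ball 0 (cmod s + 1)" for s
    by (rule power_series_holomorphic[of 0 _ c f]) (use assms in simp)
  then have "f field_differentiable at s" for s
    using holomorphic_on_imp_differentiable_at[of f "ball 0 (cmod s + 1)" s] by simp
  then show ?thesis by (simp add: holomorphic_on_open field_differentiable_def)
qed

text \<open>The moment matrix has the skeleton decomposition with an invertible \<open>r \<times> r\<close> submatrix \<open>A\<close>. Summing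
  it against exponential series in the row index gives \<open>F\<close>, in the column index \<open>G\<close>, and in both
  \<open>M\<close>, so that \<open>M s = F s * B * G s\<close> with \<open>B = A\<inverse>\<close>. Both \<open>det (F s)\<close> and the
  conjugate of \<open>det (G s)\<close> are entire, and the modulus of their product is the bounded
  function \<open>|det (M s)| |det A|\<close>. By Liouville's theorem \<open>|det (M s)|\<close> does not depend on \<open>s\<close>,
  while the entries of \<open>M n\<close> are simultaneously small for suitable natural numbers \<open>n\<close>.\<close>

theorem finite_rank_moments_zero:
  assumes u: "integrable area_measure u"
    and dep: "\<And>I :: nat \<Rightarrow> nat. \<exists>\<beta>. (\<exists>i<n. \<beta> i \<noteq> 0) \<and> (\<forall>l. (\<Sum>i<n. \<beta> i * moment u (I i) l) = 0)"
  shows "moment u k l = 0"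
proof -
  obtain r I J B where A0: "index_det r (\<lambda>i j. moment u (I i) (J j)) \<noteq> 0"
    and AB: "index_det r (\<lambda>i j. moment u (I i) (J j)) * index_det r B = 1"
    and skel: "\<And>k l. moment u k l = (\<Sum>j<r. \<Sum>i<r. moment u k (J j) * B j i * moment u (I i) l)"
    using skeleton_decomposition[of n "moment u"] dep by blast
  define A where "A i j = moment u (I i) (J j)" for i j
  have A0: "index_det r A \<noteq> 0" and AB: "index_det r A * index_det r B = 1" using A0 AB unfolding A_def[abs_def] by auto
  have mono: "integrable area_measure (\<lambda>z. u z * z ^ p * cnj z ^ q)" for p q by (rule monomial_integrable[OF u])
  have expb: "integrable area_measure (\<lambda>z. v z * exp (s * z))" if "integrable area_measure v" for v s
  proof -
    have "integrable area_measure (\<lambda>z. exp (s * z) * v z)"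
    proof (rule bounded_mult_integrable[OF that continuous_measurable_area])
      fix z :: complex assume "z \<in> unit_disk"
      then have "cmod s * cmod z \<le> cmod s * 1" by (intro mult_left_mono) auto
      then have "Re (s * z) \<le> cmod s" using complex_Re_le_cmod[of "s * z"] by (simp add: norm_mult)
      then show "cmod (exp (s * z)) \<le> exp (cmod s)" by simp
    qed (intro continuous_intros)
    then show ?thesis by (simp add: mult.commute)
  qed
  define F where "F s i l = (LINT z|area_measure. (u z * z ^ I i * cnj z ^ l) * exp (s * z))" for s i l
  define G where "G s i l = (LINT z|area_measure. (u z * z ^ i * cnj z ^ l) * exp (- cnj s * cnj z))" for s i l
  define M where "M s i j = (LINT z|area_measure. (u z * z ^ I i * cnj z ^ J j * exp (s * z)) * exp (- cnj s * cnj z))" for s i j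
  have Fs: "(\<lambda>n. s ^ n / fact n * moment u (I i + n) l) sums F s i l" for s i l
  proof -
    have "(\<lambda>n. s ^ n / fact n * (LINT z|area_measure. (u z * z ^ I i * cnj z ^ l) * z ^ n)) sums F s i l"
      unfolding F_def by (rule exp_moment_sums[OF mono]) (auto intro!: continuous_intros)
    moreover have "(LINT z|area_measure. (u z * z ^ I i * cnj z ^ l) * z ^ n) = moment u (I i + n) l" for n
      unfolding moment_def by (simp add: power_add mult_ac)
    ultimately show ?thesis by simp
  qed
  have Gs: "(\<lambda>n. (- cnj s) ^ n / fact n * moment u i (l + n)) sums G s i l" for s i l
  proof -
    have "(\<lambda>n. (- cnj s) ^ n / fact n * (LINT z|area_measure. (u z * z ^ i * cnj z ^ l) * cnj z ^ n)) sums G s i l"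
      unfolding G_def by (rule exp_moment_sums[OF mono]) (auto intro!: continuous_intros)
    moreover have "(LINT z|area_measure. (u z * z ^ i * cnj z ^ l) * cnj z ^ n) = moment u i (l + n)" for n
      unfolding moment_def by (simp add: power_add mult_ac)
    ultimately show ?thesis by simp
  qed
  have Ms: "(\<lambda>n. (- cnj s) ^ n / fact n * F s i (J j + n)) sums M s i j" for s i j
  proof -
    have "(\<lambda>n. (- cnj s) ^ n / fact n * (LINT z|area_measure. (u z * z ^ I i * cnj z ^ J j * exp (s * z)) * cnj z ^ n)) sums M s i j"
      unfolding M_def by (rule exp_moment_sums[OF expb[OF mono]]) (auto intro!: continuous_intros)
    moreover have "(LINT z|area_measure. (u z * z ^ I i * cnj z ^ J j * exp (s * z)) * cnj z ^ n) = F s i (J j + n)" for n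
      unfolding F_def by (simp add: power_add mult_ac)
    ultimately show ?thesis by simp
  qed
  \<comment> \<open>The decomposition of the moments, summed against \<open>s\<^sup>n / n!\<close> in the row index.\<close>
  have Fskel: "F s i l = (\<Sum>j<r. \<Sum>m<r. F s i (J j) * B j m * moment u (I m) l)" for s i l
  proof -
    have "(\<lambda>n. \<Sum>j<r. \<Sum>m<r. (s ^ n / fact n * moment u (I i + n) (J j)) * (B j m * moment u (I m) l))
       sums (\<Sum>j<r. \<Sum>m<r. F s i (J j) * (B j m * moment u (I m) l))"
      by (intro sums_sum sums_mult2 Fs)
    moreover have "(\<lambda>n. \<Sum>j<r. \<Sum>m<r. (s ^ n / fact n * moment u (I i + n) (J j)) * (B j m * moment u (I m) l))
       = (\<lambda>n. s ^ n / fact n * moment u (I i + n) l)"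
      by (subst (2) skel) (simp add: sum_distrib_left mult.assoc)
    ultimately show ?thesis using Fs[of s i l] sums_unique2 by (fastforce simp: mult.assoc)
  qed
  \<comment> \<open>The same for the columns, with the parameter \<open>- cnj s\<close>.\<close>
  have Mskel: "M s i j = (\<Sum>m<r. (\<Sum>q<r. F s i (J q) * B q m) * G s (I m) (J j))" for s i j
  proof -
    have "(\<lambda>n. \<Sum>q<r. \<Sum>m<r. (F s i (J q) * B q m) * ((- cnj s) ^ n / fact n * moment u (I m) (J j + n)))
       sums (\<Sum>q<r. \<Sum>m<r. (F s i (J q) * B q m) * G s (I m) (J j))"
      by (intro sums_sum sums_mult Gs)
    moreover have "(\<lambda>n. \<Sum>q<r. \<Sum>m<r. (F s i (J q) * B q m) * ((- cnj s) ^ n / fact n * moment u (I m) (J j + n)))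
       = (\<lambda>n. (- cnj s) ^ n / fact n * F s i (J j + n))"
      by (subst (2) Fskel) (simp add: sum_distrib_left mult_ac)
    ultimately have "M s i j = (\<Sum>q<r. \<Sum>m<r. (F s i (J q) * B q m) * G s (I m) (J j))"
      using Ms[of s i j] sums_unique2 by fastforce
    also have "\<dots> = (\<Sum>m<r. \<Sum>q<r. (F s i (J q) * B q m) * G s (I m) (J j))" by (rule sum.swap)
    finally show ?thesis by (simp add: sum_distrib_right)
  qed
  define f where "f s = index_det r (\<lambda>i j. F s i (J j))" for s
  define g where "g s = cnj (index_det r (\<lambda>i j. G s (I i) (J j)))" for s
  have dM: "index_det r (M s) * index_det r A = f s * cnj (g s)" for s
  proof -
    have "index_det r (M s) = index_det r (\<lambda>i m. \<Sum>q<r. F s i (J q) * B q m) * cnj (g s)"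
      unfolding Mskel[abs_def] g_def by (subst index_det_mult) simp
    also have "index_det r (\<lambda>i m. \<Sum>q<r. F s i (J q) * B q m) = f s * index_det r B" unfolding f_def by (rule index_det_mult)
    finally show ?thesis using AB by (simp add: mult_ac)
  qed
  let ?K = "LINT z|area_measure. cmod (u z)"
  have expn: "cmod (exp (s * z) * exp (- cnj s * cnj z)) = 1" for s z
  proof -
    have "exp (s * z) * exp (- cnj s * cnj z) = exp (s * z - cnj (s * z))" by (simp add: exp_add[symmetric])
    also have "cmod \<dots> = 1" by simp
    finally show ?thesis .
  qed
  have Mb: "cmod (M s i j) \<le> ?K" for s i j
    unfolding M_def
  proof (rule order_trans[OF integral_norm_bound integral_mono_AE'])
    have "cmod (u z * z ^ I i * cnj z ^ J j * exp (s * z) * exp (- cnj s * cnj z)) \<le> cmod (u z)" if "z \<in> unit_disk" for z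
    proof -
      have "cmod (u z * z ^ I i * cnj z ^ J j * exp (s * z) * exp (- cnj s * cnj z)) =
        cmod (u z) * (cmod z ^ I i * cmod z ^ J j) * cmod (exp (s * z) * exp (- cnj s * cnj z))"
        by (simp only: norm_mult norm_power complex_mod_cnj mult.assoc)
      also have "\<dots> = cmod (u z) * (cmod z ^ I i * cmod z ^ J j)" unfolding expn by simp
      also have "\<dots> \<le> cmod (u z) * 1" using that by (intro mult_left_mono mult_le_one power_le_one) auto
      finally show ?thesis by simp
    qed
    then show "AE z in area_measure. cmod (u z * z ^ I i * cnj z ^ J j * exp (s * z) * exp (- cnj s * cnj z)) \<le> cmod (u z)"
      by (intro AE_I2) simp
  qed (use u in auto)
  have holf: "f holomorphic_on UNIV"
    unfolding f_def
  proof (rule holomorphic_index_det)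
    fix i j
    show "(\<lambda>s. F s i (J j)) holomorphic_on UNIV"
      by (rule entire_of_sums[where c="\<lambda>n. moment u (I i + n) (J j) / fact n"]) (use Fs in \<open>simp add: mult_ac\<close>)
  qed
  have holg: "g holomorphic_on UNIV"
    unfolding g_def cnj_index_det
  proof (rule holomorphic_index_det)
    fix i j
    show "(\<lambda>s. cnj (G s (I i) (J j))) holomorphic_on UNIV"
    proof (rule entire_of_sums[where c="\<lambda>n. (-1) ^ n * cnj (moment u (I i) (J j + n)) / fact n"])
      fix s
      have "(\<lambda>n. cnj ((- cnj s) ^ n / fact n * moment u (I i) (J j + n))) sums cnj (G s (I i) (J j))"
        by (subst sums_cnj) (rule Gs)
      moreover have "cnj ((- cnj s) ^ n / fact n * moment u (I i) (J j + n)) = (-1) ^ n * cnj (moment u (I i) (J j + n)) / fact n * s ^ n" for n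
        by (simp add: power_minus[of s])
      ultimately show "(\<lambda>n. (-1) ^ n * cnj (moment u (I i) (J j + n)) / fact n * s ^ n) sums cnj (G s (I i) (J j))"
        by (simp only:)
    qed
  qed
  have nfg: "cmod (f s * g s) = cmod (index_det r (M s)) * cmod (index_det r A)" for s
    by (metis complex_mod_cnj dM norm_mult)
  have "bounded (range (\<lambda>s. f s * g s))"
    unfolding bounded_iff using norm_index_det_le[of r "M _" ?K] Mb
    by (intro exI[of _ "fact r * ?K ^ r * cmod (index_det r A)"]) (auto simp: nfg intro!: mult_right_mono)
  then have "(\<lambda>s. f s * g s) constant_on UNIV"
    using holf holg by (intro Liouville_theorem holomorphic_on_mult)
  then have const: "f s * g s = f 0 * g 0" for s unfolding constant_on_def by auto
  have F0: "F 0 i l = moment u (I i) l" "G 0 i l = moment u i l" for i l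
    unfolding F_def G_def moment_def by simp_all
  have "f 0 * g 0 = index_det r A * cnj (index_det r A)" unfolding f_def g_def F0 A_def[abs_def] ..
  then have MA: "cmod (index_det r (M s)) = cmod (index_det r A)" for s
    using nfg[of s] const[of s] A0 by (simp add: norm_mult)
  have "r = 0"
  proof (rule ccontr)
    assume "r \<noteq> 0"
    \<comment> \<open>Small enough for \<open>r! e\<^sup>r < |det A|\<close> when \<open>r \<ge> 1\<close>.\<close>
    define e where "e = min 1 (cmod (index_det r A) / (2 * fact r))"
    have e: "e > 0" "e \<le> 1" "fact r * e < cmod (index_det r A)"
    proof -
      show "e > 0" "e \<le> 1" using A0 by (auto simp: e_def)
      have "fact r * e \<le> fact r * (cmod (index_det r A) / (2 * fact r))" by (intro mult_left_mono) (auto simp: e_def)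
      also have "\<dots> = cmod (index_det r A) / 2" by simp
      also have "\<dots> < cmod (index_det r A)" using A0 by simp
      finally show "fact r * e < cmod (index_det r A)" .
    qed
    obtain n where n: "\<forall>ij\<in>{..<r} \<times> {..<r}. cmod (LINT z|area_measure. osc z ^ n * (u z * z ^ I (fst ij) * cnj z ^ J (snd ij))) < e"
      using osc_simultaneously_small[of "{..<r} \<times> {..<r}" "\<lambda>ij z. u z * z ^ I (fst ij) * cnj z ^ J (snd ij)" e] mono e by auto
    have osc: "exp (of_nat n * z) * exp (- cnj (of_nat n) * cnj z) = osc z ^ n" for z
    proof -
      have "exp (of_nat n * z) * exp (- cnj (of_nat n) * cnj z) = exp (of_nat n * (z - cnj z))"
        by (simp add: exp_add[symmetric] algebra_simps)
      also have "z - cnj z = \<i> * of_real (2 * Im z)" by (simp add: complex_eq_iff)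
      also have "exp (of_nat n * \<dots>) = osc z ^ n" unfolding osc_def cis_conv_exp by (simp add: exp_of_nat_mult)
      finally show ?thesis .
    qed
    have "cmod (M (of_nat n) i j) \<le> e" if "i < r" "j < r" for i j
    proof -
      have "M (of_nat n) i j = (LINT z|area_measure. osc z ^ n * (u z * z ^ I i * cnj z ^ J j))"
        unfolding M_def mult.assoc osc by (simp add: mult_ac)
      then show ?thesis using n that by (auto intro: less_imp_le)
    qed
    then have "cmod (index_det r (M (of_nat n))) \<le> fact r * e ^ r" by (rule norm_index_det_le)
    also have "\<dots> \<le> fact r * e ^ 1" using e \<open>r \<noteq> 0\<close> by (intro mult_left_mono power_decreasing) auto
    also have "\<dots> < cmod (index_det r A)" using e by simp
    finally show False using MA by simp
  qed
  then show ?thesis using skel[of k l] by simp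
qed

section \<open>Toeplitz operators as power series of moments\<close>

text \<open>The kernel is expanded by the derivative of the geometric series. For fixed \<open>z\<close> it is bounded
  by \<open>1 / (1 - |z|)\<^sup>2\<close>, and its series converges absolutely and uniformly in \<open>w\<close>, which
  justifies termwise integration.\<close>

lemma bergman_kernel_expansion:
  assumes v: "integrable area_measure v" and z: "z \<in> unit_disk"
  shows "integrable area_measure (\<lambda>w. v w / (1 - cnj w * z)\<^sup>2)"
    and "(\<lambda>q. of_nat (q + 1) * (LINT w|area_measure. v w * cnj w ^ q) * z ^ q) sums (LINT w|area_measure. v w / (1 - cnj w * z)\<^sup>2)"
proof -
  have z1: "cmod z < 1" using z by simp
  have cz: "cmod (cnj w * z) \<le> cmod z" if "w \<in> unit_disk" for w
    using that by (simp add: norm_mult mult_left_le_one_le)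
  have bd: "1 - cmod z \<le> cmod (1 - cnj w * z)" if "w \<in> unit_disk" for w
    using norm_triangle_ineq2[of 1 "cnj w * z"] cz[OF that] by simp
  have cm: "(\<lambda>w. cnj w) \<in> area_borel"
    by (rule continuous_measurable_area) (intro continuous_intros)
  have "integrable area_measure (\<lambda>w. (1 / (1 - cnj w * z)\<^sup>2) * v w)"
  proof (rule bounded_mult_integrable[OF v])
    show "(\<lambda>w. 1 / (1 - cnj w * z)\<^sup>2) \<in> area_borel"
      using cm by measurable
    fix w :: complex assume w: "w \<in> unit_disk"
    have "(1 - cmod z)\<^sup>2 \<le> (cmod (1 - cnj w * z))\<^sup>2" using bd[OF w] z1 by (intro power_mono) auto
    then show "cmod (1 / (1 - cnj w * z)\<^sup>2) \<le> 1 / (1 - cmod z)\<^sup>2"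
      using z1 unfolding norm_divide norm_power norm_one by (intro divide_left_mono mult_pos_pos) (auto intro: less_le_trans)
  qed
  then show "integrable area_measure (\<lambda>w. v w / (1 - cnj w * z)\<^sup>2)" by simp
  let ?f = "\<lambda>q w. v w * (of_nat (Suc q) * (cnj w * z) ^ q)"
  have fi: "integrable area_measure (?f q)" for q
  proof -
    have "integrable area_measure (\<lambda>w. (of_nat (Suc q) * z ^ q) * (v w * w ^ 0 * cnj w ^ q))"
      by (intro integrable_mult_right monomial_integrable v)
    then show ?thesis by (simp add: power_mult_distrib mult_ac)
  qed
  have nle: "norm (?f q w) \<le> cmod (v w) * (real (Suc q) * cmod z ^ q)" if "w \<in> unit_disk" for q w
  proof -
    have "cmod (cnj w * z) ^ q \<le> cmod z ^ q" by (intro power_mono cz that) auto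
    then have "cmod (v w) * (real (Suc q) * cmod (cnj w * z) ^ q) \<le> cmod (v w) * (real (Suc q) * cmod z ^ q)"
      by (intro mult_left_mono) auto
    then show ?thesis by (simp only: norm_mult norm_power norm_of_nat)
  qed
  have sm: "summable (\<lambda>q. real (Suc q) * cmod z ^ q)"
    using geometric_deriv_sums[of "cmod z"] z1 by (auto intro: sums_summable)
  have "(\<lambda>q. LINT w|area_measure. ?f q w) sums (LINT w|area_measure. (\<Sum>q. ?f q w))"
    by (rule dominated_series_integral[OF v fi nle sm])
  moreover have "(LINT w|area_measure. (\<Sum>q. ?f q w)) = (LINT w|area_measure. v w / (1 - cnj w * z)\<^sup>2)"
  proof (rule Bochner_Integration.integral_cong)
    fix w assume "w \<in> space area_measure"
    then have "cmod (cnj w * z) < 1" using cz[of w] z1 by simp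
    from sums_mult[OF geometric_deriv_sums[OF this], of "v w"]
    have "(\<lambda>q. ?f q w) sums (v w * (1 / (1 - cnj w * z)\<^sup>2))" .
    then show "(\<Sum>q. ?f q w) = v w / (1 - cnj w * z)\<^sup>2" by (simp add: sums_iff)
  qed simp
  moreover have "(LINT w|area_measure. ?f q w) = of_nat (q + 1) * (LINT w|area_measure. v w * cnj w ^ q) * z ^ q" for q
  proof -
    have "(LINT w|area_measure. ?f q w) = (LINT w|area_measure. (of_nat (q + 1) * z ^ q) * (v w * cnj w ^ q))"
      by (intro Bochner_Integration.integral_cong refl) (simp add: power_mult_distrib mult_ac)
    also have "\<dots> = (of_nat (q + 1) * z ^ q) * (LINT w|area_measure. v w * cnj w ^ q)"
      by (rule integral_mult_right_zero)
    finally show ?thesis by (simp only: mult_ac)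
  qed
  ultimately show "(\<lambda>q. of_nat (q + 1) * (LINT w|area_measure. v w * cnj w ^ q) * z ^ q) sums (LINT w|area_measure. v w / (1 - cnj w * z)\<^sup>2)"
    by simp
qed

lemma toeplitz_monomial_sums:
  assumes f: "integrable area_measure f" and z: "z \<in> unit_disk"
  shows "(\<lambda>q. of_nat (q + 1) * moment f p q * z ^ q) sums toeplitz f (\<lambda>w. w ^ p) z"
  using bergman_kernel_expansion(2)[OF monomial_integrable[OF f, of p 0] z] z
  by (simp add: toeplitz_def moment_def)

text \<open>Toeplitz operators return functions that are zero outside the disk, so their values on polynomials
  are polynomials only on the disk.\<close>

definition disk_poly :: "(complex \<Rightarrow> complex) \<Rightarrow> bool" where
  "disk_poly h \<longleftrightarrow> (\<exists>q. \<forall>w\<in>unit_disk. h w = poly q w)"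

lemma disk_poly_power: "disk_poly (\<lambda>w. w ^ n)"
  unfolding disk_poly_def by (rule exI[of _ "monom 1 n"]) (simp add: poly_monom)

lemma disk_poly_sum:
  assumes "\<And>i. i \<in> I \<Longrightarrow> disk_poly (h i)" and e: "\<And>w. w \<in> unit_disk \<Longrightarrow> H w = (\<Sum>i\<in>I. c i * h i w)"
  shows "disk_poly H"
proof -
  obtain q where q: "\<And>i w. i \<in> I \<Longrightarrow> w \<in> unit_disk \<Longrightarrow> h i w = poly (q i) w"
    using assms(1) unfolding disk_poly_def by metis
  show ?thesis unfolding disk_poly_def
    by (rule exI[of _ "\<Sum>i\<in>I. Polynomial.smult (c i) (q i)"]) (simp add: e q poly_sum)
qed

lemma toeplitz_integrable:
  assumes f: "integrable area_measure f" and h: "disk_poly h" and z: "z \<in> unit_disk"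
  shows "integrable area_measure (\<lambda>w. f w * h w / (1 - cnj w * z)\<^sup>2)"
proof -
  obtain q where q: "\<And>w. w \<in> unit_disk \<Longrightarrow> h w = poly q w" using h unfolding disk_poly_def by blast
  obtain C where C: "\<forall>w\<in>unit_disk. norm (poly q w) \<le> C"
    using continuous_bounded_on_disk[of "poly q"] continuous_on_poly[OF continuous_on_id, of UNIV q] by auto
  have "integrable area_measure (\<lambda>w. poly q w * f w)"
    by (rule bounded_mult_integrable[OF f continuous_measurable_area, where C=C])
      (use C in \<open>auto intro!: continuous_intros\<close>)
  then have "integrable area_measure (\<lambda>w. f w * poly q w / (1 - cnj w * z)\<^sup>2)"
    by (intro bergman_kernel_expansion(1) z) (simp add: mult.commute)
  then show ?thesis
    by (rule Bochner_Integration.integrable_cong[OF refl, THEN iffD1, rotated]) (simp add: q)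
qed

lemma toeplitz_sum:
  assumes f: "integrable area_measure f" and fin: "finite I" and h: "\<And>i. i \<in> I \<Longrightarrow> disk_poly (h i)"
    and e: "\<And>w. w \<in> unit_disk \<Longrightarrow> H w = (\<Sum>i\<in>I. c i * h i w)"
  shows "toeplitz f H z = (\<Sum>i\<in>I. c i * toeplitz f (h i) z)"
proof (cases "z \<in> unit_disk")
  case True
  have "toeplitz f H z = (LINT w|area_measure. f w * H w / (1 - cnj w * z)\<^sup>2)" using True by (simp add: toeplitz_def)
  also have "\<dots> = (LINT w|area_measure. (\<Sum>i\<in>I. c i * (f w * h i w / (1 - cnj w * z)\<^sup>2)))"
  proof (intro Bochner_Integration.integral_cong refl)
    fix w assume "w \<in> space area_measure"
    then have w: "w \<in> unit_disk" by simp
    show "f w * H w / (1 - cnj w * z)\<^sup>2 = (\<Sum>i\<in>I. c i * (f w * h i w / (1 - cnj w * z)\<^sup>2))"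
      unfolding e[OF w] by (simp add: sum_distrib_left sum_divide_distrib mult_ac)
  qed
  also have "\<dots> = (\<Sum>i\<in>I. (LINT w|area_measure. c i * (f w * h i w / (1 - cnj w * z)\<^sup>2)))"
    by (intro Bochner_Integration.integral_sum integrable_mult_right toeplitz_integrable f h True)
  also have "\<dots> = (\<Sum>i\<in>I. c i * toeplitz f (h i) z)"
    using True by (simp only: toeplitz_def if_True integral_mult_right_zero)
  finally show ?thesis .
qed (simp add: toeplitz_def)

lemma z_zbar_polynomial_continuous:
  assumes "z_zbar_polynomial F"
  shows "continuous_on UNIV F"
proof -
  obtain d c where "\<forall>z. F z = (\<Sum>k\<le>d. \<Sum>l\<le>d. c k l * z ^ k * cnj z ^ l)"
    using assms unfolding z_zbar_polynomial_def by blast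
  then have "F = (\<lambda>z. \<Sum>k\<le>d. \<Sum>l\<le>d. c k l * z ^ k * cnj z ^ l)" by auto
  then show ?thesis by (auto intro!: continuous_intros)
qed

lemma continuous_integrable_area:
  fixes F :: "complex \<Rightarrow> complex"
  assumes "continuous_on UNIV F"
  shows "integrable area_measure F"
proof -
  obtain C where C: "\<forall>z\<in>unit_disk. norm (F z) \<le> C" using continuous_bounded_on_disk[OF assms] by blast
  show ?thesis
  proof (rule area.integrable_const_bound)
    show "AE z in area_measure. cmod (F z) \<le> C" using C by (intro AE_I2) auto
    show "F \<in> area_borel" by (rule continuous_measurable_area[OF assms])
  qed
qed

lemma z_zbar_polynomial_moment_band:
  assumes "z_zbar_polynomial F"
  shows "\<exists>d. \<forall>p q. q > p + d \<longrightarrow> moment F p q = 0"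
proof -
  obtain d c where F: "\<And>z. F z = (\<Sum>k\<le>d. \<Sum>l\<le>d. c k l * z ^ k * cnj z ^ l)"
    using assms unfolding z_zbar_polynomial_def by blast
  have "moment F p q = 0" if "q > p + d" for p q
  proof -
    have mi: "integrable area_measure (\<lambda>z. c k l * z ^ k * cnj z ^ l * z ^ p * cnj z ^ q)" for k l
      by (rule continuous_integrable_area) (intro continuous_intros)
    have m0: "moment (\<lambda>z. c k l * z ^ k * cnj z ^ l) p q = 0" if "k \<le> d" for k l
    proof -
      have eq: "c k l * z ^ k * cnj z ^ l * z ^ p * cnj z ^ q = c k l * (z ^ (k + p) * cnj z ^ (l + q))" for z
        by (simp add: power_add mult_ac)
      have "(LINT z|area_measure. z ^ (k + p) * cnj z ^ (l + q)) = 0"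
      proof (rule integral_homogeneous_zero[where k = "int (k + p) - int (l + q)"])
        fix t and z :: complex
        show "(cis t * z) ^ (k + p) * cnj (cis t * z) ^ (l + q) = cis (of_int (int (k + p) - int (l + q)) * t) * (z ^ (k + p) * cnj z ^ (l + q))"
          using cis_power_product[of 0 t "k + p" "l + q"] by (simp add: power_mult_distrib mult_ac)
      qed (use that \<open>q > p + d\<close> in auto)
      then show ?thesis unfolding moment_def eq by simp
    qed
    have "moment F p q = (\<Sum>k\<le>d. moment (\<lambda>z. \<Sum>l\<le>d. c k l * z ^ k * cnj z ^ l) p q)"
      unfolding F[abs_def] by (rule moment_sum) (auto simp: sum_distrib_right intro!: integrable_sum mi)
    also have "\<dots> = (\<Sum>k\<le>d. \<Sum>l\<le>d. moment (\<lambda>z. c k l * z ^ k * cnj z ^ l) p q)"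
      by (intro sum.cong refl moment_sum mi)
    also have "\<dots> = 0" using m0 by (intro sum.neutral) auto
    finally show ?thesis .
  qed
  then show ?thesis by blast
qed

lemma toeplitz_polynomial_monomial:
  assumes G: "z_zbar_polynomial G" and d: "\<And>p q. q > p + d \<Longrightarrow> moment G p q = 0" and z: "z \<in> unit_disk"
  shows "toeplitz G (\<lambda>w. w ^ p) z = (\<Sum>l\<le>p + d. (of_nat (l + 1) * moment G p l) * z ^ l)"
proof (rule sums_unique2)
  show "(\<lambda>q. of_nat (q + 1) * moment G p q * z ^ q) sums toeplitz G (\<lambda>w. w ^ p) z"
    by (rule toeplitz_monomial_sums[OF continuous_integrable_area[OF z_zbar_polynomial_continuous[OF G]] z])
  show "(\<lambda>q. of_nat (q + 1) * moment G p q * z ^ q) sums (\<Sum>l\<le>p + d. (of_nat (l + 1) * moment G p l) * z ^ l)"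
    by (rule sums_finite) (use d in auto)
qed

lemma disk_poly_toeplitz:
  assumes G: "z_zbar_polynomial G"
  shows "disk_poly (toeplitz G (\<lambda>w. w ^ p))"
proof -
  obtain d where d: "\<And>p q. q > p + d \<Longrightarrow> moment G p q = 0" using z_zbar_polynomial_moment_band[OF G] by blast
  show ?thesis
    by (rule disk_poly_sum[OF _ toeplitz_polynomial_monomial[OF G d]]) (auto intro: disk_poly_power)
qed

text \<open>The image of a monomial under \<open>T\<^sub>G\<close> is a polynomial because the moments of \<open>G\<close> live on a band;
  applying \<open>T\<^sub>F\<close> to it term by term produces the matrix product that describes the moments of the
  convolution.\<close>

lemma toeplitz_product_sums:
  assumes F: "z_zbar_polynomial F" and G: "z_zbar_polynomial G"
  shows "\<exists>P. \<forall>p\<ge>P. \<forall>z\<in>unit_disk. (\<lambda>q. of_nat (q + 1) * moment (F \<diamondop> G) p q * z ^ q) sums toeplitz F (toeplitz G (\<lambda>w. w ^ p)) z"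
proof -
  have iF: "integrable area_measure F" by (rule continuous_integrable_area[OF z_zbar_polynomial_continuous[OF F]])
  obtain d where d: "\<And>p q. q > p + d \<Longrightarrow> moment G p q = 0" using z_zbar_polynomial_moment_band[OF G] by blast
  obtain P c0 where P: "\<And>p q c. p \<ge> P \<Longrightarrow> c \<ge> c0 \<Longrightarrow> moment (F \<diamondop> G) p q = (\<Sum>l\<le>p + c. of_nat (l + 1) * moment G p l * moment F l q)"
    using is_diamond_moments(2)[OF is_diamond_diamond[OF F G]] by blast
  have "(\<lambda>q. of_nat (q + 1) * moment (F \<diamondop> G) p q * z ^ q) sums toeplitz F (toeplitz G (\<lambda>w. w ^ p)) z"
    if p: "p \<ge> P" and z: "z \<in> unit_disk" for p z
  proof -
    let ?d = "max d c0"
    have d': "\<And>p q. q > p + ?d \<Longrightarrow> moment G p q = 0" using d by auto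
    have "toeplitz F (toeplitz G (\<lambda>w. w ^ p)) z = (\<Sum>l\<le>p + ?d. (of_nat (l + 1) * moment G p l) * toeplitz F (\<lambda>w. w ^ l) z)"
      by (rule toeplitz_sum[OF iF _ disk_poly_power toeplitz_polynomial_monomial[OF G d']]) auto
    moreover have "(\<lambda>q. \<Sum>l\<le>p + ?d. (of_nat (l + 1) * moment G p l) * (of_nat (q + 1) * moment F l q * z ^ q)) sums
       (\<Sum>l\<le>p + ?d. (of_nat (l + 1) * moment G p l) * toeplitz F (\<lambda>w. w ^ l) z)"
      by (intro sums_sum sums_mult toeplitz_monomial_sums iF z)
    moreover have "(\<Sum>l\<le>p + ?d. (of_nat (l + 1) * moment G p l) * (of_nat (q + 1) * moment F l q * z ^ q))
       = of_nat (q + 1) * moment (F \<diamondop> G) p q * z ^ q" for q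
      by (subst P[OF p, of ?d]) (auto simp: sum_distrib_left sum_distrib_right mult_ac)
    ultimately show ?thesis by simp
  qed
  then show ?thesis by blast
qed

section \<open>Linear relations between power series\<close>

lemma sum_fun_apply: "(\<Sum>i\<in>I. f i) z = (\<Sum>i\<in>I. f i z)" for f :: "'a \<Rightarrow> complex \<Rightarrow> complex"
  by (induction I rule: infinite_finite_induct) auto

text \<open>The coordinates with respect to \<open>B\<close> form a matrix with one more row than columns. Padded by a
  zero column it is a singular square matrix, and the relation between its rows is the desired one.\<close>

lemma linearly_dependent_in_span:
  fixes f :: "nat \<Rightarrow> complex \<Rightarrow> complex"
  assumes B: "finite B" and f: "\<And>i. f i \<in> cfun.span B"
  shows "\<exists>\<beta>. (\<exists>i<Suc (card B). \<beta> i \<noteq> 0) \<and> (\<forall>z. (\<Sum>i<Suc (card B). \<beta> i * f i z) = 0)"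
proof -
  have "\<exists>\<alpha>. f i = (\<Sum>b\<in>B. (\<lambda>z. \<alpha> b * b z))" for i
    using f[of i] unfolding cfun.span_finite[OF B] by blast
  then obtain \<alpha> where "\<And>i. f i = (\<Sum>b\<in>B. (\<lambda>z. \<alpha> i b * b z))" by metis
  then have \<alpha>: "f i z = (\<Sum>b\<in>B. \<alpha> i b * b z)" for i z by (simp add: sum_fun_apply)
  obtain b where b: "bij_betw b {..<card B} B" using ex_bij_betw_nat_finite[OF B] by (auto simp: atLeast0LessThan)
  let ?n = "Suc (card B)"
  define X where "X i j = (if j < card B then \<alpha> i (b j) else 0)" for i j
  have "index_det ?n X = 0" unfolding index_det_permutations
  proof (rule sum.neutral, rule ballI)
    fix p assume "p \<in> {p. p permutes {0..<?n}}"
    then have p: "p permutes {0..<?n}" by simp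
    then obtain i where i: "i < ?n" "p i = card B"
      using permutes_surj[OF p] permutes_in_image[OF p] by (metis atLeastLessThan_iff le0 lessI surjD)
    then have "(\<Prod>i=0..<?n. X i (p i)) = 0" by (intro prod_zero) (auto simp: X_def intro!: bexI[of _ i])
    then show "signof p * (\<Prod>i=0..<?n. X i (p i)) = 0" by simp
  qed
  then obtain w where w: "\<exists>i<?n. w i \<noteq> 0" "\<forall>j<?n. (\<Sum>i<?n. w i * X i j) = 0"
    unfolding index_det_eq_0_iff by blast
  have col: "(\<Sum>i<?n. w i * \<alpha> i c) = 0" if "c \<in> B" for c
  proof -
    have "c \<in> b ` {..<card B}" using b that by (simp add: bij_betw_def)
    then obtain j where j: "j < card B" "c = b j" by blast
    have "(\<Sum>i<?n. w i * X i j) = 0" using w(2) j by simp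
    then show ?thesis using j by (simp add: X_def)
  qed
  have "(\<Sum>i<?n. w i * f i z) = 0" for z
  proof -
    have "(\<Sum>i<?n. w i * f i z) = (\<Sum>i<?n. \<Sum>c\<in>B. w i * \<alpha> i c * c z)"
      by (simp only: \<alpha> sum_distrib_left mult.assoc)
    also have "\<dots> = (\<Sum>c\<in>B. \<Sum>i<?n. w i * \<alpha> i c * c z)" by (rule sum.swap)
    also have "\<dots> = (\<Sum>c\<in>B. (\<Sum>i<?n. w i * \<alpha> i c) * c z)" by (simp only: sum_distrib_right)
    also have "\<dots> = 0" using col by (intro sum.neutral) auto
    finally show ?thesis .
  qed
  then show ?thesis using w(1) by blast
qed

lemma powser_zero_coeffs:
  fixes c :: "nat \<Rightarrow> complex"
  assumes s: "\<And>z. z \<in> unit_disk \<Longrightarrow> (\<lambda>q. c q * z ^ q) sums 0"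
  shows "c q = 0"
proof (rule ccontr)
  assume nz: "c q \<noteq> 0"
  show False
  proof (cases "q = 0")
    case True
    have "(\<lambda>q. c q * 0 ^ q) sums c 0" by (rule powser_sums_zero)
    then have "c 0 = 0" using s[of 0] sums_unique2 by fastforce
    then show False using nz True by simp
  next
    case False
    obtain t where t: "0 < t" "\<And>z::complex. z \<in> cball 0 t - {0} \<Longrightarrow> (0::complex) \<noteq> 0"
      by (rule powser_0_nonzero[of 1 0 c "\<lambda>_. 0" q]) (use s nz False in auto)
    show False using t(2)[of "of_real t"] t(1) by simp
  qed
qed

section \<open>The finite rank criterion\<close>

theorem theoremA:
  fixes N :: nat and F G :: "nat \<Rightarrow> complex \<Rightarrow> complex"
  assumes "N \<ge> 1"
    and "\<And>j. j \<in> {1..N} \<Longrightarrow> z_zbar_polynomial (F j)"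
    and "\<And>j. j \<in> {1..N} \<Longrightarrow> z_zbar_polynomial (G j)"
  shows "(\<exists>H. integrable area_measure H \<and>
            finite_rank (\<lambda>h z. (\<Sum>j=1..N. toeplitz (F j) (toeplitz (G j) h) z) - toeplitz H h z))
         \<longleftrightarrow> integrable area_measure (\<lambda>z. \<Sum>j=1..N. (F j \<diamondop> G j) z)"
proof -
  note FG = assms(2,3)
  let ?J = "{1..N}" and ?T = "\<lambda>j p z. toeplitz (F j) (toeplitz (G j) (\<lambda>w. w ^ p)) z"
  define D where "D z = (\<Sum>j\<in>?J. (F j \<diamondop> G j) z)" for z
  define S where "S H h z = (\<Sum>j\<in>?J. toeplitz (F j) (toeplitz (G j) h) z) - toeplitz H h z" for H h z
  have iF: "integrable area_measure (F j)" "integrable area_measure (G j)" if "j \<in> ?J" for j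
    using FG[OF that] by (auto intro: continuous_integrable_area z_zbar_polynomial_continuous)
  have "nearly_integrable_disk (F j \<diamondop> G j)" if "j \<in> ?J" for j
    using is_diamond_moments(1)[OF is_diamond_diamond[OF FG[OF that]]] unfolding nearly_integrable_disk_def by blast
  then obtain \<alpha> where \<alpha>: "\<alpha> > 0"
    and i\<alpha>: "\<And>j. j \<in> ?J \<Longrightarrow> weighted_integrable \<alpha> (F j \<diamondop> G j)"
    using nearly_integrable_disk_common_exponent[of ?J "\<lambda>j. F j \<diamondop> G j"] by auto
  have D\<alpha>: "weighted_integrable \<alpha> D"
    unfolding D_def sum_distrib_left by (rule Bochner_Integration.integrable_sum) (rule i\<alpha>)
  have "\<forall>j\<in>?J. \<exists>P. \<forall>p\<ge>P. \<forall>z\<in>unit_disk. (\<lambda>q. of_nat (q + 1) * moment (F j \<diamondop> G j) p q * z ^ q) sums ?T j p z"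
    using toeplitz_product_sums[OF FG] by blast
  from bchoice[OF this] obtain P where P: "\<And>j p z. j \<in> ?J \<Longrightarrow> p \<ge> P j \<Longrightarrow> z \<in> unit_disk \<Longrightarrow>
     (\<lambda>q. of_nat (q + 1) * moment (F j \<diamondop> G j) p q * z ^ q) sums ?T j p z"
    by blast
  \<comment> \<open>From \<open>m\<close> on, the moments of \<open>D\<close> converge and every product of operators has its power series.\<close>
  define m where "m = nat \<lceil>\<alpha>\<rceil> + (\<Sum>j\<in>?J. P j)"
  have m\<alpha>: "\<alpha> \<le> real m" unfolding m_def by linarith
  have mP: "P j \<le> m" if "j \<in> ?J" for j
    using member_le_sum[of j ?J P] that unfolding m_def by auto
  have Dmoment: "moment D p q = (\<Sum>j\<in>?J. moment (F j \<diamondop> G j) p q)" if "p \<ge> m" for p q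
    unfolding D_def[abs_def] using that m\<alpha> by (intro moment_sum moment_integrable[OF \<alpha> i\<alpha>]) auto
  have Dsums: "(\<lambda>q. of_nat (q + 1) * moment D p q * z ^ q) sums (\<Sum>j\<in>?J. ?T j p z)"
    if "p \<ge> m" "z \<in> unit_disk" for p z
  proof -
    have "(\<lambda>q. \<Sum>j\<in>?J. of_nat (q + 1) * moment (F j \<diamondop> G j) p q * z ^ q) sums (\<Sum>j\<in>?J. ?T j p z)"
      using mP that by (intro sums_sum P) (auto intro: order_trans)
    then show ?thesis unfolding Dmoment[OF that(1)] by (simp add: sum_distrib_left sum_distrib_right)
  qed
  have Ssums: "(\<lambda>q. of_nat (q + 1) * (moment D p q - moment H p q) * z ^ q) sums S H (\<lambda>w. w ^ p) z"
    if H: "integrable area_measure H" and "p \<ge> m" "z \<in> unit_disk" for H p z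
    using sums_diff[OF Dsums[OF that(2,3)] toeplitz_monomial_sums[OF H that(3), of p]]
    unfolding S_def by (simp add: algebra_simps)
  have Slin: "S H (poly h) z = (\<Sum>i\<le>degree h. coeff h i * S H (\<lambda>w. w ^ i) z)"
    if H: "integrable area_measure H" for H h z
  proof -
    have "toeplitz (F j) (toeplitz (G j) (poly h)) z = (\<Sum>i\<le>degree h. coeff h i * ?T j i z)"
      if j: "j \<in> ?J" for j
    proof (rule toeplitz_sum[OF iF(1)[OF j]])
      show "disk_poly (toeplitz (G j) (\<lambda>w. w ^ i))" for i by (rule disk_poly_toeplitz[OF FG(2)[OF j]])
      show "toeplitz (G j) (poly h) w = (\<Sum>i\<le>degree h. coeff h i * toeplitz (G j) (\<lambda>w. w ^ i) w)" for w
        by (rule toeplitz_sum[OF iF(2)[OF j]]) (auto simp: poly_altdef intro: disk_poly_power)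
    qed simp
    then have "(\<Sum>j\<in>?J. toeplitz (F j) (toeplitz (G j) (poly h)) z) =
      (\<Sum>j\<in>?J. \<Sum>i\<le>degree h. coeff h i * ?T j i z)" by (rule sum.cong[OF refl])
    also have "\<dots> = (\<Sum>i\<le>degree h. \<Sum>j\<in>?J. coeff h i * ?T j i z)" by (rule sum.swap)
    finally have 1: "(\<Sum>j\<in>?J. toeplitz (F j) (toeplitz (G j) (poly h)) z) =
      (\<Sum>i\<le>degree h. coeff h i * (\<Sum>j\<in>?J. ?T j i z))" by (simp only: sum_distrib_left)
    have 2: "toeplitz H (poly h) z = (\<Sum>i\<le>degree h. coeff h i * toeplitz H (\<lambda>w. w ^ i) z)"
      by (rule toeplitz_sum[OF H]) (auto simp: poly_altdef intro: disk_poly_power)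
    show ?thesis unfolding S_def 1 2 by (simp only: right_diff_distrib sum_subtractf)
  qed
  have "(\<exists>H. integrable area_measure H \<and> finite_rank (S H)) \<longleftrightarrow> integrable area_measure D"
  proof
    assume D: "integrable area_measure D"
    have S0: "S D (\<lambda>w. w ^ p) = 0" if "p \<ge> m" for p
    proof
      fix z
      show "S D (\<lambda>w. w ^ p) z = 0 z"
      proof (cases "z \<in> unit_disk")
        case True
        have "(\<lambda>q. 0) sums S D (\<lambda>w. w ^ p) z" using Ssums[OF D that True] by simp
        from sums_unique2[OF this sums_zero] show ?thesis by simp
      next
        case False
        then show ?thesis by (simp add: S_def toeplitz_def)
      qed
    qed
    have "S D ` range poly \<subseteq> cfun.span ((\<lambda>p. S D (\<lambda>w. w ^ p)) ` {..<m})"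
    proof (rule image_subsetI, elim rangeE)
      fix f h assume "f = poly (h :: complex poly)"
      have "S D (poly h) = (\<Sum>i\<le>degree h. (\<lambda>z. coeff h i * S D (\<lambda>w. w ^ i) z))"
        by (rule ext) (simp only: Slin[OF D] sum_fun_apply)
      also have "\<dots> \<in> cfun.span ((\<lambda>p. S D (\<lambda>w. w ^ p)) ` {..<m})"
      proof (intro cfun.span_sum cfun.span_scale)
        fix i
        show "S D (\<lambda>w. w ^ i) \<in> cfun.span ((\<lambda>p. S D (\<lambda>w. w ^ p)) ` {..<m})"
        proof (cases "i < m")
          case True then show ?thesis by (intro cfun.span_base) auto
        next
          case False then show ?thesis using S0[of i] cfun.span_zero by simp
        qed
      qed
      finally show "S D f \<in> cfun.span ((\<lambda>p. S D (\<lambda>w. w ^ p)) ` {..<m})" using \<open>f = poly h\<close> by simp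
    qed
    then have "finite_rank (S D)" unfolding finite_rank_def by blast
    then show "\<exists>H. integrable area_measure H \<and> finite_rank (S H)" using D by blast
  next
    assume "\<exists>H. integrable area_measure H \<and> finite_rank (S H)"
    then obtain H B where H: "integrable area_measure H" and B: "finite B" "S H ` range poly \<subseteq> cfun.span B"
      unfolding finite_rank_def by blast
    let ?n = "Suc (card B)"
    \<comment> \<open>The factor \<open>|z|\<^sup>2\<^sup>m\<close> makes \<open>D\<close> integrable and shifts both indices of the moments by \<open>m\<close>.\<close>
    define u where "u z = (D z - H z) * z ^ m * cnj z ^ m" for z
    have Di: "integrable area_measure (\<lambda>z. D z * z ^ (m + k) * cnj z ^ (m + l))" for k l
      using m\<alpha> by (intro moment_integrable[OF \<alpha> D\<alpha>]) auto
    have Hi: "integrable area_measure (\<lambda>z. H z * z ^ (m + k) * cnj z ^ (m + l))" for k l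
      by (rule monomial_integrable[OF H])
    have ue: "u z * z ^ k * cnj z ^ l = D z * z ^ (m + k) * cnj z ^ (m + l) - H z * z ^ (m + k) * cnj z ^ (m + l)" for z k l
      unfolding u_def by (simp add: power_add algebra_simps)
    have ui: "integrable area_measure u"
      using Bochner_Integration.integrable_diff[OF Di[of 0 0] Hi[of 0 0]] by (simp only: ue[symmetric] power_0 mult_1_right)
    have um: "moment u k l = moment D (m + k) (m + l) - moment H (m + k) (m + l)" for k l
      unfolding moment_def ue by (rule Bochner_Integration.integral_diff[OF Di Hi])
    have "\<exists>\<beta>. (\<exists>i<?n. \<beta> i \<noteq> 0) \<and> (\<forall>l. (\<Sum>i<?n. \<beta> i * moment u (I i) l) = 0)" for I :: "nat \<Rightarrow> nat"
    proof -
      have "S H (\<lambda>w. w ^ (m + I i)) \<in> cfun.span B" for i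
      proof -
        have "(\<lambda>w. w ^ (m + I i)) = poly (monom 1 (m + I i) :: complex poly)" by (auto simp: poly_monom)
        then show ?thesis using B(2) by (metis image_subset_iff rangeI)
      qed
      then obtain \<beta> where b: "\<exists>i<?n. \<beta> i \<noteq> 0" "\<And>z. (\<Sum>i<?n. \<beta> i * S H (\<lambda>w. w ^ (m + I i)) z) = 0"
        using linearly_dependent_in_span[OF B(1), of "\<lambda>i. S H (\<lambda>w. w ^ (m + I i))"] by blast
      let ?c = "\<lambda>q. \<Sum>i<?n. \<beta> i * (moment D (m + I i) q - moment H (m + I i) q)"
      have z: "of_nat (q + 1) * ?c q = 0" for q
      proof (rule powser_zero_coeffs[where c = "\<lambda>q. of_nat (q + 1) * ?c q"])
        fix z :: complex assume z: "z \<in> unit_disk"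
        have "(\<lambda>q. \<Sum>i<?n. \<beta> i * (of_nat (q + 1) * (moment D (m + I i) q - moment H (m + I i) q) * z ^ q)) sums
           (\<Sum>i<?n. \<beta> i * S H (\<lambda>w. w ^ (m + I i)) z)"
          by (intro sums_sum sums_mult Ssums H z) simp
        then have "(\<lambda>q. \<Sum>i<?n. \<beta> i * (of_nat (q + 1) * (moment D (m + I i) q - moment H (m + I i) q) * z ^ q)) sums 0"
          unfolding b(2) .
        then show "(\<lambda>q. of_nat (q + 1) * ?c q * z ^ q) sums 0"
          by (simp only: sum_distrib_left sum_distrib_right mult_ac)
      qed
      have "?c q = 0" for q
      proof -
        have "of_nat (q + 1) \<noteq> (0 :: complex)" unfolding of_nat_eq_0_iff by simp
        then show ?thesis using z[of q] mult_eq_0_iff by blast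
      qed
      then have "\<forall>l. (\<Sum>i<?n. \<beta> i * moment u (I i) l) = 0" unfolding um by blast
      then show ?thesis using b(1) by blast
    qed
    then have "moment u k l = 0" for k l by (rule finite_rank_moments_zero[OF ui])
    then have "zero_moments u" using ui unfolding zero_moments_def by blast
    then have "AE z in area_measure. u z = 0" by (rule zero_moments_AE_zero)
    then have "AE z in area_measure. H z = D z"
      using AE_area_nonzero by eventually_elim (simp add: u_def)
    moreover have "D \<in> area_borel" by (rule weighted_integrable_measurable[OF D\<alpha>])
    ultimately show "integrable area_measure D" by (intro integrable_cong_AE_imp[OF H]) auto
  qed
  then show ?thesis unfolding S_def[abs_def] D_def[abs_def] .
qed

end
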